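(* Let $E$ be a topological space with its Borel $\sigma$-field, $\gamma$ a (nonnegative measure) kernel on $E$, $f:[0,1]\times E^2\to[0,\infty)$ measurable, and let $Q_u(x,A)=\int_Af(u,x,y)\gamma(x,dy)$, $u\in[0,1]$, be Markov kernels on $E$. Let $k\ge1$ be an integer and $V_0\le V_1\le\cdots\le V_k$ measurable functions $E\to[1,\infty)$ such that: (B1) each $Q_u$ has a unique invariant probability measure $\pi_u$, $\int V_k\,d\pi_u<\infty$, and for every $\ell=0,\ldots,k$ there is $\kappa_\ell\in(0,1)$ with $\sup_{u\in[0,1]}\sup_{x\in E}\frac{\|\delta_xQ_u^n-\pi_u\|_{V_\ell}}{V_\ell(x)}=O(\kappa_\ell^n)$ as $n\to\infty$; (B2) for all $(x,y)\in E^2$, $u\mapsto f(u,x,y)$ is $k$-times continuously differentiable, with $\ell$-th derivative denoted $\partial_1^{(\ell)}f$; (B3) there is $C>0$ such that for all integers $0\le s\le s+\ell\le k$ and all $x\in E$, $\sup_{u\in[0,1]}\int|\partial_1^{(\ell)}f(u,x,y)|V_s(y)\gamma(x,dy)\le CV_{s+\ell}(x)$; and for all $u\in[0,1]$, $x\in E$, $0\le s\le k$, $\lim_{h\to0}\int|\partial_1^{(k-s)}f(u+h,x,y)-\partial_1^{(k-s)}f(u,x,y)|V_s(y)\gamma(x,dy)=0$; (B4) there is $C>0$ such that for all integers $0\le s\le s+\ell\le k$ and all $x_1,x_2\in E$, $V_s(x_1)M_\ell(x_2)\le C\left(V_{s+\ell}(x_1)+V_{s+\ell}(x_2)\right)$,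 where $M_\ell(x)=\sup_{u\in[0,1]}\int|\partial_1^{(\ell)}f(u,x,y)|\gamma(x,dy)$. Then for every integer $j\ge1$ the map $u\mapsto\pi_{u,j}$ from $[0,1]$ to $\mathcal{M}_{V_0}(E^j)$ is $k$-times continuously differentiable, where $\pi_{u,j}(dx_1,\ldots,dx_j)=\pi_u(dx_1)Q_u(x_1,dx_2)\cdots Q_u(x_{j-1},dx_j)$.
   Context: For measurable $V:E\to[1,\infty)$ and $j\ge1$, $\mathcal{M}_V(E^j)$ is the Banach space of signed measures $\mu$ on $E^j$ with $\|\mu\|_V:=\sup\{\int g\,d\mu: g\text{ measurable},\ |g(x_1,\ldots,x_j)|\le V(x_1)+\cdots+V(x_j)\}<\infty$ (for $j=1$ this is $\int V\,d|\mu|$). $\delta_x$ is the Dirac mass at $x$ and $\delta_xQ_u^n=Q_u^n(x,\cdot)$. Derivatives and limits at the endpoints of $[0,1]$ are one-sided. *)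

theory Defs
  imports "HOL-Probability.Probability"
begin

definition measure_kernel :: "'a measure \<Rightarrow> 'b measure \<Rightarrow> ('a \<Rightarrow> 'b measure) \<Rightarrow> bool" where
  "measure_kernel M N K \<longleftrightarrow>
     (\<forall>x\<in>space M. sets (K x) = sets N) \<and>
     (\<forall>A\<in>sets N. (\<lambda>x. emeasure (K x) A) \<in> borel_measurable M)"

primrec kernel_power ::
    "('a::topological_space \<Rightarrow> 'a measure) \<Rightarrow> nat \<Rightarrow> 'a \<Rightarrow> 'a measure" where
  "kernel_power K 0 x = return borel x"
| "kernel_power K (Suc n) x = kernel_power K n x \<bind> K"

definition invariant_prob ::
    "('a::topological_space \<Rightarrow> 'a measure) \<Rightarrow> 'a measure \<Rightarrow> bool" where
  "invariant_prob K \<mu> \<longleftrightarrow> \<mu> \<in> space (prob_algebra borel) \<and> \<mu> \<bind> K = \<mu>"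

text \<open>
  The space of \<open>j\<close>-tuples carries the product of the Borel \<open>\<sigma>\<close>-fields, and coordinates are
  indexed by \<open>0, \<dots>, j - 1\<close>. For a general topological space this \<open>\<sigma>\<close>-field can be smaller
  than the Borel \<open>\<sigma>\<close>-field of the product topology.
\<close>

abbreviation tuple_space :: "nat \<Rightarrow> (nat \<Rightarrow> 'a::topological_space) measure" where
  "tuple_space j \<equiv> Pi\<^sub>M {..<j} (\<lambda>_. borel)"

text \<open>
  \<open>path_law \<mu> K j\<close> is \<open>\<mu>(dx\<^sub>0) K(x\<^sub>0, dx\<^sub>1) \<cdots> K(x\<^sub>j\<^sub>-\<^sub>2, dx\<^sub>j\<^sub>-\<^sub>1)\<close>. The case \<open>j = 0\<close>
  (the point mass at the empty tuple) only serves to start the recursion.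
\<close>

primrec path_law :: "'a::topological_space measure \<Rightarrow> ('a \<Rightarrow> 'a measure) \<Rightarrow> nat \<Rightarrow>
    (nat \<Rightarrow> 'a) measure" where
  "path_law \<mu> K 0 = return (tuple_space 0) (\<lambda>_. undefined)"
| "path_law \<mu> K (Suc j) = path_law \<mu> K j \<bind>
     (\<lambda>\<omega>. distr (case j of 0 \<Rightarrow> \<mu> | Suc i \<Rightarrow> K (\<omega> i)) (tuple_space (Suc j)) (\<lambda>y. fun_upd \<omega> j y))"

text \<open>
  A finite signed measure on the \<open>\<sigma>\<close>-field of \<open>M\<close> is represented by its set function; the
  measure of \<open>M\<close> itself and the values of the set function outside \<open>sets M\<close> play no role. Linear
  operations on signed measures are pointwise. Extended-valued signed measures are not needed: for
  weights bounded below by 1 their weighted norm would be infinite.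
\<close>

definition signed_measure :: "'a measure \<Rightarrow> ('a set \<Rightarrow> real) \<Rightarrow> bool" where
  "signed_measure M \<mu> \<longleftrightarrow>
     (\<forall>A::nat \<Rightarrow> 'a set. range A \<subseteq> sets M \<longrightarrow> disjoint_family A \<longrightarrow>
        (\<lambda>n. \<mu> (A n)) sums \<mu> (\<Union>n. A n))"

text \<open>
  Upper variation; the Jordan decomposition of \<open>\<mu>\<close> consists of the upper variations of \<open>\<mu>\<close>
  and of \<open>-\<mu>\<close>.
\<close>

definition upper_variation :: "'a measure \<Rightarrow> ('a set \<Rightarrow> real) \<Rightarrow> 'a measure" where
  "upper_variation M \<mu> =
     measure_of (space M) (sets M) (\<lambda>A. SUP B\<in>{B\<in>sets M. B \<subseteq> A}. ennreal (\<mu> B))"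

definition signed_integral :: "'a measure \<Rightarrow> ('a set \<Rightarrow> real) \<Rightarrow> ('a \<Rightarrow> real) \<Rightarrow> real" where
  "signed_integral M \<mu> g =
     (LINT x|upper_variation M \<mu>. g x) - (LINT x|upper_variation M (\<lambda>A. - \<mu> A). g x)"

text \<open>
  Clipping at 0 by \<open>ennreal\<close> is harmless as \<open>g = 0\<close> is admissible. So is the value 0 of the
  Bochner integral of a non-integrable \<open>g\<close>: if an admissible \<open>g\<close> fails to be integrable, then
  already the bounded admissible functions give the supremum \<open>\<infinity>\<close>.
\<close>

definition weighted_norm :: "'a measure \<Rightarrow> ('a \<Rightarrow> real) \<Rightarrow> ('a set \<Rightarrow> real) \<Rightarrow> ennreal" where
  "weighted_norm M W \<mu> =
     (SUP g\<in>{g \<in> borel_measurable M. \<forall>x\<in>space M. \<bar>g x\<bar> \<le> W x}. ennreal (signed_integral M \<mu> g))"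

definition weighted_measures :: "'a measure \<Rightarrow> ('a \<Rightarrow> real) \<Rightarrow> ('a set \<Rightarrow> real) set" where
  "weighted_measures M W = {\<mu>. signed_measure M \<mu> \<and> weighted_norm M W \<mu> < \<infinity>}"

definition tuple_weight :: "nat \<Rightarrow> ('a \<Rightarrow> real) \<Rightarrow> (nat \<Rightarrow> 'a) \<Rightarrow> real" where
  "tuple_weight j V \<omega> = (\<Sum>i<j. V (\<omega> i))"

text \<open>
  \<open>D l\<close>, for \<open>l \<le> k\<close>, are the successive derivatives on \<open>[0,1]\<close> of a \<open>k\<close>-times
  continuously differentiable \<open>D 0\<close>, one-sided at the endpoints; first for real functions, then
  for maps into \<open>weighted_measures M W\<close>.
\<close>

definition Ck_derivs :: "nat \<Rightarrow> (nat \<Rightarrow> real \<Rightarrow> real) \<Rightarrow> bool" where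
  "Ck_derivs k D \<longleftrightarrow>
     (\<forall>l<k. \<forall>u\<in>{0..1}. (D l has_real_derivative D (Suc l) u) (at u within {0..1})) \<and>
     continuous_on {0..1} (D k)"

definition Ck_measure_derivs :: "nat \<Rightarrow> 'a measure \<Rightarrow> ('a \<Rightarrow> real) \<Rightarrow>
    (nat \<Rightarrow> real \<Rightarrow> 'a set \<Rightarrow> real) \<Rightarrow> bool" where
  "Ck_measure_derivs k M W D \<longleftrightarrow>
     (\<forall>l\<le>k. \<forall>u\<in>{0..1}. D l u \<in> weighted_measures M W) \<and>
     (\<forall>l<k. \<forall>u\<in>{0..1}.
        ((\<lambda>v. weighted_norm M W (\<lambda>A. (D l v A - D l u A) / (v - u) - D (Suc l) u A)) \<longlongrightarrow> 0)
          (at u within {0..1})) \<and>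
     (\<forall>u\<in>{0..1}.
        ((\<lambda>v. weighted_norm M W (\<lambda>A. D k v A - D k u A)) \<longlongrightarrow> 0) (at u within {0..1}))"

definition Ck_into_weighted_measures :: "nat \<Rightarrow> 'a measure \<Rightarrow> ('a \<Rightarrow> real) \<Rightarrow>
    (real \<Rightarrow> 'a set \<Rightarrow> real) \<Rightarrow> bool" where
  "Ck_into_weighted_measures k M W F \<longleftrightarrow> (\<exists>D. D 0 = F \<and> Ck_measure_derivs k M W D)"

end

theory Submission
  imports Defs
begin

text \<open>
  A signed measure of finite \<open>V\<close>-norm is treated as the functional \<open>g \<mapsto> \<integral> g d\<mu>\<close> on the measurable
  functions dominated by a multiple of \<open>V\<close>; such functionals are linear and continuous under dominated
  pointwise convergence, and the Hahn decomposition identifies the weighted norm with the supremum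
  over the unit ball. The \<open>l\<close>-th derivative of the kernel maps functions of weight \<open>V n\<close> to functions
  of weight \<open>V (n + l)\<close> and is continuous and differentiable only pointwise in \<open>x\<close>. A functional turns this
  into uniform convergence on the unit ball: otherwise there are \<open>v i \<longlonglongrightarrow> u\<close> and \<open>g i\<close> in the ball with
  \<open>\<bar>L (T (v i) (g i) - T u (g i))\<bar> \<ge> \<epsilon>\<close>, contradicting dominated convergence.

  Hence there is a product rule for \<open>u \<mapsto> F u \<circ> T u\<close>, and, by geometric ergodicity, smoothness of the
  centred solution of \<open>\<mu> u \<circ> (1 - T u) = R u\<close> for smooth centred \<open>R\<close>, the derivative solving the equation
  with right-hand side \<open>R' u + \<mu> u \<circ> T' u\<close>. The invariant probability is \<open>\<pi> 0\<close> plus the solution for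
  \<open>R u = \<pi> 0 \<circ> T u - \<pi> 0\<close>. The path law arises from it by adding coordinates one at a time, each an
  instance of the product rule thanks to (B4).
\<close>

subsection \<open>Functionals dominated by a weight\<close>

text \<open>The obstacle is that \<open>T v - T u\<close> need not be small in operator norm on a
  fixed level: the hypotheses give convergence for each x only, uniformly in the test function.
  Increments are therefore always split so that the operator increment stands behind a fixed
  functional, while the increment of the functional is applied to operators at v, which are bounded
  uniformly in v. In the Poisson equation this dictates testing with \<open>potential v g\<close>
  and comparing functionals, so that the potential is never differentiated as an operator.

  The weights are a budget. The potential acts on every level without loss, because (B1) holds for
  each weight, and composition with the operator itself is free; only a derivative of the operator
  raises the level by one. Functionals that start on level k can thus be differentiated k times and
  still be defined on level 0, the weight of the conclusion.\<close>

definition wbdd :: "'a measure \<Rightarrow> ('a \<Rightarrow> real) \<Rightarrow> real \<Rightarrow> ('a \<Rightarrow> real) set" where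
  "wbdd M w c = {g \<in> borel_measurable M. \<forall>x\<in>space M. \<bar>g x\<bar> \<le> c * w x}"

text \<open>The last clause is countable additivity in functional form. It already forces
  boundedness (\<open>wfunctional_bounded\<close>) and indifference to values outside
  \<open>space M\<close> (\<open>wfunctional_cong\<close>), so neither is part of the definition. On
  functions not dominated by a multiple of the weight, \<open>L\<close> is arbitrary.\<close>

definition wfunctional :: "'a measure \<Rightarrow> ('a \<Rightarrow> real) \<Rightarrow> (('a \<Rightarrow> real) \<Rightarrow> real) \<Rightarrow> bool" where
  "wfunctional M w L \<longleftrightarrow>
     (\<forall>c f g. f \<in> wbdd M w c \<longrightarrow> g \<in> wbdd M w c \<longrightarrow> L (\<lambda>x. f x + g x) = L f + L g) \<and>
     (\<forall>c a f. f \<in> wbdd M w c \<longrightarrow> L (\<lambda>x. a * f x) = a * L f) \<and>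
     (\<forall>c h g. (\<forall>i. h i \<in> wbdd M w c) \<longrightarrow> g \<in> wbdd M w c \<longrightarrow>
        (\<forall>x\<in>space M. (\<lambda>i. h i x) \<longlonglongrightarrow> g x) \<longrightarrow> (\<lambda>i::nat. L (h i)) \<longlonglongrightarrow> L g)"

lemma wbddI: "g \<in> borel_measurable M \<Longrightarrow> (\<And>x. x \<in> space M \<Longrightarrow> \<bar>g x\<bar> \<le> c * w x) \<Longrightarrow> g \<in> wbdd M w c"
  by (simp add: wbdd_def)

lemma wbdd_measurable: "g \<in> wbdd M w c \<Longrightarrow> g \<in> borel_measurable M"
  by (simp add: wbdd_def)

lemma wbddD: "g \<in> wbdd M w c \<Longrightarrow> x \<in> space M \<Longrightarrow> \<bar>g x\<bar> \<le> c * w x"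
  by (simp add: wbdd_def)

lemma wbdd_add: "f \<in> wbdd M w c \<Longrightarrow> g \<in> wbdd M w d \<Longrightarrow> (\<lambda>x. f x + g x) \<in> wbdd M w (c + d)"
  unfolding wbdd_def by (auto simp: distrib_right intro: order_trans[OF abs_triangle_ineq add_mono])

lemma wbdd_scale: "f \<in> wbdd M w c \<Longrightarrow> (\<lambda>x. a * f x) \<in> wbdd M w (\<bar>a\<bar> * c)"
  unfolding wbdd_def by (auto simp: abs_mult mult.assoc intro: mult_left_mono)

lemma wbdd_diff: "f \<in> wbdd M w c \<Longrightarrow> g \<in> wbdd M w d \<Longrightarrow> (\<lambda>x. f x - g x) \<in> wbdd M w (c + d)"
  using wbdd_add[OF _ wbdd_scale[of g M w d "-1"], of f c] by simp

lemma wbdd_mono: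
  assumes "f \<in> wbdd M w c" "c \<le> d" "\<And>x. x \<in> space M \<Longrightarrow> 0 \<le> w x"
  shows "f \<in> wbdd M w d"
  using assms unfolding wbdd_def by (auto intro!: order_trans[OF _ mult_right_mono[of c d]])

lemma wbdd_weight_mono:
  assumes "f \<in> wbdd M w c" "\<And>x. x \<in> space M \<Longrightarrow> w x \<le> v x" "0 \<le> c"
  shows "f \<in> wbdd M v c"
  using assms unfolding wbdd_def by (auto intro!: order_trans[OF _ mult_left_mono[of "w _" "v _" c]])

lemma wbdd_limit:
  assumes "\<And>i. h i \<in> wbdd M w c" "\<And>x. x \<in> space M \<Longrightarrow> (\<lambda>i::nat. h i x) \<longlonglongrightarrow> g x"
  shows "g \<in> wbdd M w c"
proof (rule wbddI)
  show "g \<in> borel_measurable M"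
    by (rule borel_measurable_LIMSEQ_real[OF assms(2)]) (use assms(1) in \<open>auto simp: wbdd_def\<close>)
  fix x assume x: "x \<in> space M"
  show "\<bar>g x\<bar> \<le> c * w x"
    by (rule Lim_bounded[OF tendsto_rabs[OF assms(2)[OF x]]]) (use assms(1) x in \<open>auto simp: wbdd_def\<close>)
qed

lemma wfunctional_add:
  assumes "wfunctional M w L" "\<And>x. x \<in> space M \<Longrightarrow> 0 \<le> w x" "f \<in> wbdd M w c" "g \<in> wbdd M w d"
  shows "L (\<lambda>x. f x + g x) = L f + L g"
  using assms(1) wbdd_mono[OF assms(3) max.cobounded1[of c d] assms(2)]
    wbdd_mono[OF assms(4) max.cobounded2[of d c] assms(2)]
  unfolding wfunctional_def by blast

lemma wfunctional_scale:
  "wfunctional M w L \<Longrightarrow> f \<in> wbdd M w c \<Longrightarrow> L (\<lambda>x. a * f x) = a * L f"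
  unfolding wfunctional_def by blast

lemma wfunctional_diff:
  assumes L: "wfunctional M w L" and w: "\<And>x. x \<in> space M \<Longrightarrow> 0 \<le> w x"
    and f: "f \<in> wbdd M w c" and g: "g \<in> wbdd M w d"
  shows "L (\<lambda>x. f x - g x) = L f - L g"
  using wfunctional_add[OF L w f wbdd_scale[OF g, of "-1"]] wfunctional_scale[OF L g, of "-1"] by simp

lemma wfunctional_limit:
  assumes "wfunctional M w L" "\<And>i. h i \<in> wbdd M w c" "\<And>x. x \<in> space M \<Longrightarrow> (\<lambda>i::nat. h i x) \<longlonglongrightarrow> g x"
  shows "(\<lambda>i. L (h i)) \<longlonglongrightarrow> L g"
proof -
  have "\<forall>c h g. (\<forall>i. h i \<in> wbdd M w c) \<longrightarrow> g \<in> wbdd M w c \<longrightarrow>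
      (\<forall>x\<in>space M. (\<lambda>i. h i x) \<longlonglongrightarrow> g x) \<longrightarrow> (\<lambda>i::nat. L (h i)) \<longlonglongrightarrow> L g"
    using assms(1) unfolding wfunctional_def by (elim conjE)
  from this[rule_format, OF assms(2) wbdd_limit[OF assms(2,3)] assms(3)] show ?thesis .
qed

text \<open>On \<open>space M\<close> the constant sequence \<open>f\<close> converges to
  \<open>g\<close> as well, so continuity identifies the two values.\<close>

lemma wfunctional_cong:
  assumes "wfunctional M w L" "f \<in> wbdd M w c" "\<And>x. x \<in> space M \<Longrightarrow> f x = g x"
  shows "L f = L g"
proof -
  have "(\<lambda>i::nat. L f) \<longlonglongrightarrow> L g"
    by (rule wfunctional_limit[OF assms(1), of "\<lambda>_. f" c]) (use assms in auto)
  then show ?thesis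
    by (simp add: LIMSEQ_const_iff)
qed

lemma wfunctional_zero:
  assumes "wfunctional M w L" "\<And>x. x \<in> space M \<Longrightarrow> 0 \<le> w x"
  shows "L (\<lambda>x. 0) = 0"
  using wfunctional_scale[OF assms(1), of "\<lambda>x. 0" 1 0] assms(2) by (simp add: wbdd_def)

lemma wfunctional_bound_scale:
  assumes L: "wfunctional M w L" and w: "\<And>x. x \<in> space M \<Longrightarrow> 0 \<le> w x"
    and B: "\<And>g. g \<in> wbdd M w 1 \<Longrightarrow> \<bar>L g\<bar> \<le> B" and c: "0 \<le> c" and g: "g \<in> wbdd M w c"
  shows "\<bar>L g\<bar> \<le> B * c"
proof (cases "c = 0")
  case True
  have "L g = L (\<lambda>x. 0)"
    by (rule wfunctional_cong[OF L g]) (use wbddD[OF g] True in auto)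
  then show ?thesis
    using True wfunctional_zero[OF L w] by simp
next
  case False
  have "(\<lambda>x. (1 / c) * g x) \<in> wbdd M w 1"
    by (rule wbdd_mono[OF wbdd_scale[OF g]]) (use c False w in auto)
  from B[OF this] show ?thesis
    using c False wfunctional_scale[OF L g, of "1/c"] by (simp add: abs_mult divide_le_eq)
qed

text \<open>Boundedness comes for free: if \<open>\<bar>L (h i)\<bar> > i\<close>, then \<open>h i / i\<close> tends to 0 pointwise.\<close>

lemma wfunctional_bounded:
  assumes L: "wfunctional M w L" and w: "\<And>x. x \<in> space M \<Longrightarrow> 0 \<le> w x"
  obtains B where "0 \<le> B" "\<And>g c. 0 \<le> c \<Longrightarrow> g \<in> wbdd M w c \<Longrightarrow> \<bar>L g\<bar> \<le> B * c"
proof -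
  have "\<exists>B\<ge>0. \<forall>g\<in>wbdd M w 1. \<bar>L g\<bar> \<le> B"
  proof (rule ccontr)
    assume "\<not> ?thesis"
    then have "\<forall>i. \<exists>g\<in>wbdd M w 1. real (Suc i) < \<bar>L g\<bar>"
      by (meson not_le of_nat_0_le_iff)
    then obtain h where h: "\<And>i. h i \<in> wbdd M w 1" "\<And>i. real (Suc i) < \<bar>L (h i)\<bar>"
      by metis
    have "(\<lambda>i. L (\<lambda>x. inverse (real (Suc i)) * h i x)) \<longlonglongrightarrow> L (\<lambda>x. 0)"
    proof (rule wfunctional_limit[OF L, of _ 1])
      fix i show "(\<lambda>x. inverse (real (Suc i)) * h i x) \<in> wbdd M w 1"
        by (rule wbdd_mono[OF wbdd_scale[OF h(1)]]) (auto simp: w field_simps)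
    next
      fix x assume x: "x \<in> space M"
      show "(\<lambda>i. inverse (real (Suc i)) * h i x) \<longlonglongrightarrow> 0"
      proof (rule Lim_null_comparison)
        show "\<forall>\<^sub>F i in sequentially. norm (inverse (real (Suc i)) * h i x) \<le> inverse (real (Suc i)) * w x"
          using wbddD[OF h(1) x] by (auto simp: abs_mult intro!: mult_left_mono)
        show "(\<lambda>i. inverse (real (Suc i)) * w x) \<longlonglongrightarrow> 0"
          using tendsto_mult_left_zero[OF LIMSEQ_inverse_real_of_nat] by auto
      qed
    qed
    then have "(\<lambda>i. inverse (real (Suc i)) * L (h i)) \<longlonglongrightarrow> 0"
      using wfunctional_scale[OF L h(1)] wfunctional_zero[OF L w] by simp
    then have "\<forall>\<^sub>F i in sequentially. \<bar>inverse (real (Suc i)) * L (h i)\<bar> < 1"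
      by (auto dest: tendstoD[where e=1] simp: dist_real_def)
    then obtain i where "\<bar>inverse (real (Suc i)) * L (h i)\<bar> < 1"
      by (auto simp: eventually_sequentially)
    with h(2)[of i] show False
      by (simp add: abs_mult field_simps)
  qed
  then obtain B where B: "0 \<le> B" "\<And>g. g \<in> wbdd M w 1 \<Longrightarrow> \<bar>L g\<bar> \<le> B"
    by blast
  show thesis
    by (rule that[OF B(1) wfunctional_bound_scale[OF L w B(2)]])
qed

lemma wfunctional_weight_mono:
  assumes L: "wfunctional M v L" and wv: "\<And>x. x \<in> space M \<Longrightarrow> 0 \<le> w x" "\<And>x. x \<in> space M \<Longrightarrow> w x \<le> v x"
  shows "wfunctional M w L"
proof -
  have v: "0 \<le> v x" if "x \<in> space M" for x
    using wv that by force
  \<comment> \<open>For negative \<open>c\<close> a larger weight would make the bound smaller,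
    hence the passage to \<open>\<bar>c\<bar>\<close>.\<close>
  have sub: "f \<in> wbdd M v \<bar>c\<bar>" if "f \<in> wbdd M w c" for f c
    by (rule wbdd_weight_mono[OF wbdd_mono[OF that]]) (use wv in auto)
  show ?thesis
    unfolding wfunctional_def
    using wfunctional_add[OF L v sub sub] wfunctional_scale[OF L sub] wfunctional_limit[OF L sub]
    by blast
qed

lemma wfunctional_lincomb:
  assumes F: "wfunctional M w F" and G: "wfunctional M w G"
  shows "wfunctional M w (\<lambda>g. a * F g + b * G g)"
  using F G unfolding wfunctional_def
  by (intro conjI allI impI tendsto_intros) (auto simp: algebra_simps)

lemma wfunctional_sum:
  "wfunctional M w F \<Longrightarrow> wfunctional M w G \<Longrightarrow> wfunctional M w (\<lambda>g. F g + G g)"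
  using wfunctional_lincomb[of M w F G 1 1] by simp

lemma wfunctional_difference:
  "wfunctional M w F \<Longrightarrow> wfunctional M w G \<Longrightarrow> wfunctional M w (\<lambda>g. F g - G g)"
  using wfunctional_lincomb[of M w F G 1 "-1"] by simp

lemma wfunctional_divide: "wfunctional M w F \<Longrightarrow> wfunctional M w (\<lambda>g. F g / a)"
  using wfunctional_lincomb[of M w F F "1 / a" 0] by simp

lemma wfunctional_integral:
  assumes "sets N = sets M" and int: "integrable N w" and w: "\<And>x. x \<in> space M \<Longrightarrow> 0 \<le> w x"
  shows "wfunctional M w (\<lambda>g. \<integral>x. g x \<partial>N)"
proof -
  have sp: "space N = space M"
    using assms(1) by (rule sets_eq_imp_space_eq)
  have meas: "borel_measurable M = borel_measurable N"
    using assms(1) by (intro measurable_cong_sets) auto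
  have integ: "integrable N g" if "g \<in> wbdd M w c" for g c
    by (rule Bochner_Integration.integrable_bound[OF integrable_mult_right[OF int, of "c"]])
       (use that sp w in \<open>auto simp: wbdd_def meas abs_mult intro!: AE_I2 order_trans[OF _ mult_right_mono[OF abs_ge_self]]\<close>)
  show ?thesis
    unfolding wfunctional_def
  proof (intro conjI allI impI)
    fix c h g assume h: "\<forall>i. h i \<in> wbdd M w c" and g: "g \<in> wbdd M w c"
      and lim: "\<forall>x\<in>space M. (\<lambda>i::nat. h i x) \<longlonglongrightarrow> g x"
    show "(\<lambda>i. \<integral>x. h i x \<partial>N) \<longlonglongrightarrow> (\<integral>x. g x \<partial>N)"
      by (rule integral_dominated_convergence[where w="\<lambda>x. c * w x"])
         (use h g lim int in \<open>auto simp: wbdd_def meas sp\<close>)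
  qed (auto simp: integ)
qed

subsection \<open>Hahn decomposition and the weighted norm\<close>

lemma wbdd_indicator:
  assumes "A \<in> sets M" "\<And>x. x \<in> space M \<Longrightarrow> 1 \<le> w x"
  shows "indicator A \<in> wbdd M w 1"
  using assms by (fastforce simp: wbdd_def indicator_def)

lemma wbdd_indicator_mult:
  assumes "f \<in> wbdd M w c" "A \<in> sets M"
  shows "(\<lambda>x. f x * indicator A x) \<in> wbdd M w c"
proof (rule wbddI)
  show "(\<lambda>x. f x * indicator A x) \<in> borel_measurable M"
    using assms wbdd_measurable by (intro borel_measurable_times) auto
  fix x assume "x \<in> space M"
  have "\<bar>f x * indicator A x\<bar> \<le> \<bar>f x\<bar>"
    by (simp add: indicator_def)
  also have "\<dots> \<le> c * w x"
    by (rule wbddD[OF assms(1)]) fact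
  finally show "\<bar>f x * indicator A x\<bar> \<le> c * w x" .
qed

lemma wfunctional_finite_sum:
  assumes L: "wfunctional M w L" and w: "\<And>x. x \<in> space M \<Longrightarrow> 0 \<le> w x"
    and "finite S" "\<And>i. i \<in> S \<Longrightarrow> f i \<in> wbdd M w (c i)"
  shows "(\<lambda>x. \<Sum>i\<in>S. f i x) \<in> wbdd M w (\<Sum>i\<in>S. c i) \<and> L (\<lambda>x. \<Sum>i\<in>S. f i x) = (\<Sum>i\<in>S. L (f i))"
  using assms(3,4)
proof (induction S rule: finite_induct)
  case empty
  then show ?case
    using wfunctional_zero[OF L w] by (simp add: wbdd_def)
next
  case (insert i S)
  have S: "(\<lambda>x. \<Sum>i\<in>S. f i x) \<in> wbdd M w (\<Sum>i\<in>S. c i)" "f i \<in> wbdd M w (c i)"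
    using insert by auto
  show ?case
    using wfunctional_add[OF L w S(2,1)] wbdd_add[OF S(2,1)] insert by simp
qed

lemma wfunctional_sums_disjoint:
  assumes L: "wfunctional M w L" and w: "\<And>x. x \<in> space M \<Longrightarrow> 1 \<le> w x"
    and A: "range A \<subseteq> sets M" "disjoint_family A"
  shows "(\<lambda>n::nat. L (indicator (A n))) sums L (indicator (\<Union>n. A n))"
  unfolding sums_def
proof -
  have w0: "\<And>x. x \<in> space M \<Longrightarrow> 0 \<le> w x"
    using w by force
  have eq: "(\<Sum>i<n. indicator (A i) x) = (indicator (\<Union>i<n. A i) x :: real)" for n x
    by (rule indicator_UN_disjoint[symmetric]) (use A(2) in \<open>auto intro: disjoint_family_on_mono\<close>)
  have sum: "L (\<lambda>x. \<Sum>i<n. indicator (A i) x) = (\<Sum>i<n. L (indicator (A i)))" for n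
    by (rule conjunct2[OF wfunctional_finite_sum[OF L w0, where c="\<lambda>_. 1"]])
       (use A w in \<open>auto intro!: wbdd_indicator\<close>)
  have "(\<lambda>n. L (\<lambda>x. \<Sum>i<n. indicator (A i) x)) \<longlonglongrightarrow> L (indicator (\<Union>n. A n))"
  proof (rule wfunctional_limit[OF L, of _ 1])
    show "(\<lambda>x. \<Sum>i<n. indicator (A i) x) \<in> wbdd M w 1" for n
      unfolding eq using A(1) w by (intro wbdd_indicator) auto
    show "(\<lambda>n. \<Sum>i<n. indicator (A i) x :: real) \<longlonglongrightarrow> indicator (\<Union>n. A n) x" for x
      unfolding eq by (rule LIMSEQ_indicator_UN)
  qed
  then show "(\<lambda>n. \<Sum>i<n. L (indicator (A i))) \<longlonglongrightarrow> L (indicator (\<Union>n. A n))"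
    unfolding sum .
qed

lemma wfunctional_Un:
  assumes L: "wfunctional M w L" and w: "\<And>x. x \<in> space M \<Longrightarrow> 1 \<le> w x"
    and "A \<in> sets M" "B \<in> sets M" "A \<inter> B = {}"
  shows "L (indicator (A \<union> B)) = L (indicator A) + L (indicator B)"
proof -
  have w0: "\<And>x. x \<in> space M \<Longrightarrow> 0 \<le> w x"
    using w by force
  have "indicator (A \<union> B) = (\<lambda>x. indicator A x + indicator B x :: real)"
    using assms(5) by (auto simp: indicator_def fun_eq_iff)
  then show ?thesis
    using wfunctional_add[OF L w0 wbdd_indicator[OF assms(3) w] wbdd_indicator[OF assms(4) w]] by simp
qed

text \<open>\<open>P\<close> is a set of maximal mass: removing a part of negative mass or adding
  one of positive mass would exceed the supremum \<open>s\<close>, which is finite since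
  \<open>L\<close> is bounded. To reach the supremum, take sets \<open>A i\<close> whose defects
  \<open>s - m (A i)\<close> are summable. By modularity of \<open>m\<close> the defect of an
  intersection is at most the sum of the defects, so the tail intersections \<open>D n\<close> have
  defects tending to 0, and they increase to \<open>P\<close>.\<close>

lemma wfunctional_Hahn_decomposition:
  assumes L: "wfunctional M w L" and w: "\<And>x. x \<in> space M \<Longrightarrow> 1 \<le> w x"
  obtains P where "P \<in> sets M" "\<And>B. B \<in> sets M \<Longrightarrow> B \<subseteq> P \<Longrightarrow> 0 \<le> L (indicator B)"
    "\<And>B. B \<in> sets M \<Longrightarrow> B \<inter> P = {} \<Longrightarrow> L (indicator B) \<le> 0"
proof -
  define m where "m A = L (indicator A)" for A
  have w0: "\<And>x. x \<in> space M \<Longrightarrow> 0 \<le> w x"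
    using w by force
  obtain b where b: "\<And>g c. 0 \<le> c \<Longrightarrow> g \<in> wbdd M w c \<Longrightarrow> \<bar>L g\<bar> \<le> b * c"
    using wfunctional_bounded[OF L w0] by metis
  have m_le_b: "m A \<le> b" if "A \<in> sets M" for A
    using b[OF zero_le_one wbdd_indicator[OF that w]] by (simp add: m_def)
  define s where "s = (SUP A\<in>sets M. m A)"
  have bdd: "bdd_above (m ` sets M)"
    using m_le_b by (auto simp: bdd_above_def)
  have m_le: "m A \<le> s" if "A \<in> sets M" for A
    unfolding s_def by (rule cSUP_upper[OF that bdd])
  have "\<exists>A\<in>sets M. s - (1/2)^i < m A" for i :: nat
  proof -
    have "s - (1/2)^i < (SUP A\<in>sets M. m A)"
      by (simp add: s_def)
    then show ?thesis
      by (subst (asm) less_cSUP_iff) (use bdd in auto)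
  qed
  then obtain A where A: "\<And>i. A i \<in> sets M" "\<And>i. s - (1/2)^i < m (A i)"
    by metis
  have Un: "m (X \<union> Y) = m X + m Y" if "X \<in> sets M" "Y \<in> sets M" "X \<inter> Y = {}" for X Y
    unfolding m_def by (rule wfunctional_Un[OF L w that]) auto
  have Int: "m (X \<inter> Y) = m X + m Y - m (X \<union> Y)" if "X \<in> sets M" "Y \<in> sets M" for X Y
  proof -
    have "m X = m (X - Y) + m (X \<inter> Y)" "m (X \<union> Y) = m (X - Y) + m Y"
      using Un[of "X - Y" "X \<inter> Y"] Un[of "X - Y" Y] that by (auto simp: Un_Diff_Int Int_commute)
    then show ?thesis by simp
  qed
  define E where "E n k = (\<Inter>i<Suc k. A (n + i))" for n k
  have E_sets[measurable]: "E n k \<in> sets M" for n k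
    unfolding E_def using A(1) by (intro sets.finite_INT) auto
  have E_Suc: "E n (Suc k) = E n k \<inter> A (n + Suc k)" for n k
    unfolding E_def by (subst lessThan_Suc) auto
  \<comment> \<open>The subtracted term is the sum of \<open>(1/2)^i\<close> over n \<le> i \<le> n
    + k, the defects of the sets intersected so far.\<close>
  have E_ge: "s - (2 * (1/2)^n - (1/2)^(n+k)) \<le> m (E n k)" for n k
  proof (induction k)
    case 0
    then show ?case
      using A(2)[of n] by (simp add: E_def lessThan_Suc)
  next
    case (Suc k)
    have "m (E n k \<union> A (n + Suc k)) \<le> s"
      using A(1) by (intro m_le) auto
    with Suc A(2)[of "n + Suc k"] show ?case
      unfolding E_Suc using Int[OF E_sets A(1), of n k "n + Suc k"] by simp
  qed
  define D where "D n = (\<Inter>i. A (n + i))" for n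
  have D_sets: "D n \<in> sets M" for n
    unfolding D_def using A(1) by auto
  have D_ge: "s - 2 * (1/2)^n \<le> m (D n)" for n
  proof (rule LIMSEQ_le)
    show "(\<lambda>k. m (E n k)) \<longlonglongrightarrow> m (D n)"
      unfolding m_def
    proof (rule wfunctional_limit[OF L, of _ 1])
      show "(\<lambda>k. indicator (E n k) x :: real) \<longlonglongrightarrow> indicator (D n) x" for x
        unfolding E_def D_def by (rule LIMSEQ_Suc[OF LIMSEQ_indicator_INT])
    qed (intro wbdd_indicator E_sets w)
    have "(\<lambda>k. s - (2 * (1/2)^n - (1/2)^n * (1/2)^k)) \<longlonglongrightarrow> s - (2 * (1/2)^n - (1/2)^n * 0)"
      by (intro tendsto_intros LIMSEQ_realpow_zero) auto
    then show "(\<lambda>k. s - (2 * (1/2)^n - (1/2)^(n+k))) \<longlonglongrightarrow> s - 2 * (1/2)^n"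
      by (simp add: power_add)
  qed (use E_ge in auto)
  define P where "P = (\<Union>n. D n)"
  have P: "P \<in> sets M"
    unfolding P_def using D_sets by auto
  have "incseq D"
    unfolding D_def incseq_def
    by (auto simp: le_iff_add add.assoc)
  have "s \<le> m P"
  proof (rule LIMSEQ_le)
    show "(\<lambda>k. m (D k)) \<longlonglongrightarrow> m P"
      unfolding m_def P_def
      by (rule wfunctional_limit[OF L, of _ 1])
         (auto intro!: wbdd_indicator D_sets w LIMSEQ_indicator_incseq \<open>incseq D\<close>)
    have "(\<lambda>k. s - 2 * (1/2)^k) \<longlonglongrightarrow> s - 2 * 0"
      by (intro tendsto_intros LIMSEQ_realpow_zero) auto
    then show "(\<lambda>k. s - 2 * (1/2)^k) \<longlonglongrightarrow> s"
      by simp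
  qed (use D_ge in auto)
  show thesis
  proof
    show "P \<in> sets M" by fact
    fix B assume B: "B \<in> sets M"
    show "0 \<le> L (indicator B)" if "B \<subseteq> P"
    proof -
      have "P - B \<union> B = P" using that by auto
      then have "m P = m (P - B) + m B"
        using Un[of "P - B" B] P B by auto
      then show ?thesis
        using \<open>s \<le> m P\<close> m_le[of "P - B"] P B by (auto simp: m_def)
    qed
    show "L (indicator B) \<le> 0" if "B \<inter> P = {}"
      using Un[OF B P that] \<open>s \<le> m P\<close> m_le[of "B \<union> P"] P B by (auto simp: m_def)
  qed
qed

lemma positive_wfunctional_integral:
  assumes L: "wfunctional M w L" and w: "\<And>x. x \<in> space M \<Longrightarrow> 1 \<le> w x"
    and N: "sets N = sets M" "\<And>A. A \<in> sets M \<Longrightarrow> emeasure N A = ennreal (L (indicator A))"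
    and pos: "\<And>A. A \<in> sets M \<Longrightarrow> 0 \<le> L (indicator A)"
    and g: "g \<in> wbdd M w c"
  shows "integrable N g" "(\<integral>x. g x \<partial>N) = L g"
proof -
  have w0: "\<And>x. x \<in> space M \<Longrightarrow> 0 \<le> w x"
    using w by force
  have sp: "space N = space M"
    using N(1) by (rule sets_eq_imp_space_eq)
  have meas: "borel_measurable M = borel_measurable N"
    using N(1) by (intro measurable_cong_sets) auto
  have simple_eq: "simple_function M = simple_function N"
    by (simp add: simple_function_def N sp fun_eq_iff)
  interpret finite_measure N
    by (rule finite_measureI) (simp add: sp N)
  have meas_N: "measure N A = L (indicator A)" if "A \<in> sets M" for A
    using N(2)[OF that] pos[OF that] by (simp add: measure_def)
  have simple: "(\<integral>x. h x \<partial>N) = L h" if h: "simple_function M h" for h :: "_ \<Rightarrow> real"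
  proof -
    let ?A = "\<lambda>y. h -` {y} \<inter> space M" and ?S = "h ` space M"
    have fin: "finite ?S"
      using h by (auto simp: simple_function_def)
    have A: "?A y \<in> sets M" for y
      using simple_functionD(2)[OF h] by simp
    have eq: "h x = (\<Sum>y\<in>?S. y * indicator (?A y) x)" if "x \<in> space M" for x
      by (rule trans[OF simple_function_indicator_representation_banach[OF h that] sum.cong[OF refl]])
         (simp only: real_scaleR_def mult.commute)
    have bd: "(\<lambda>x. y * indicator (?A y) x) \<in> wbdd M w \<bar>y\<bar>" for y
      using wbdd_scale[OF wbdd_indicator[OF A w], where a=y] by (simp only: mult_1_right)
    have "(\<integral>x. h x \<partial>N) = (\<integral>x. (\<Sum>y\<in>?S. y * indicator (?A y) x) \<partial>N)"
      by (rule Bochner_Integration.integral_cong[OF refl]) (rule eq, simp only: sp)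
    also have "\<dots> = (\<Sum>y\<in>?S. \<integral>x. y * indicator (?A y) x \<partial>N)"
      using A by (intro Bochner_Integration.integral_sum) (auto simp: N emeasure_finite less_top[symmetric])
    also have "\<dots> = (\<Sum>y\<in>?S. y * L (indicator (?A y)))"
      using A by (intro sum.cong) (auto simp: N meas_N sp)
    also have "\<dots> = (\<Sum>y\<in>?S. L (\<lambda>x. y * indicator (?A y) x))"
      by (intro sum.cong refl wfunctional_scale[OF L wbdd_indicator[OF A w], symmetric])
    also have "\<dots> = L (\<lambda>x. \<Sum>y\<in>?S. y * indicator (?A y) x)"
      by (rule conjunct2[OF wfunctional_finite_sum[OF L w0 fin bd], symmetric])
    also have "\<dots> = L h"
      by (rule wfunctional_cong[OF L conjunct1[OF wfunctional_finite_sum[OF L w0 fin bd]]])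
         (simp_all only: eq)
    finally show ?thesis .
  qed
  obtain F where F: "\<And>i::nat. simple_function M (F i)" "\<And>x. x \<in> space M \<Longrightarrow> (\<lambda>i. F i x) \<longlonglongrightarrow> g x"
    "\<And>i x. x \<in> space M \<Longrightarrow> \<bar>F i x\<bar> \<le> 2 * \<bar>g x\<bar>"
    using borel_measurable_implies_sequence_metric[OF wbdd_measurable[OF g], of 0]
    by (simp add: dist_real_def) metis
  have [measurable]: "g \<in> borel_measurable N" "F i \<in> borel_measurable N" for i
    using wbdd_measurable[OF g] borel_measurable_simple_function[OF F(1)] by (simp_all add: meas)
  have F_wbdd: "F i \<in> wbdd M w (2 * \<bar>c\<bar>)" for i
  proof (rule wbddI)
    fix x assume x: "x \<in> space M"
    have "c * w x \<le> \<bar>c\<bar> * w x"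
      using w0[OF x] by (intro mult_right_mono) auto
    with F(3)[OF x, of i] wbddD[OF g x] show "\<bar>F i x\<bar> \<le> 2 * \<bar>c\<bar> * w x"
      by linarith
  qed (rule borel_measurable_simple_function[OF F(1)])
  have absF_wbdd: "(\<lambda>x. \<bar>F i x\<bar>) \<in> wbdd M w (2 * \<bar>c\<bar>)" for i
    using F_wbdd[of i] by (auto simp: wbdd_def)
  obtain b where b: "\<And>g c. 0 \<le> c \<Longrightarrow> g \<in> wbdd M w c \<Longrightarrow> \<bar>L g\<bar> \<le> b * c"
    using wfunctional_bounded[OF L w0] by metis
  \<comment> \<open>Integrability of \<open>g\<close> has to be proved before dominated convergence
    can be used. The bound of \<open>L\<close> on the simple functions
    \<open>\<bar>F i\<bar>\<close> is uniform in i, and Fatou's lemma carries it to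
    \<open>g\<close>; afterwards \<open>2 * \<bar>g\<bar>\<close> dominates the
    \<open>F i\<close>.\<close>
  have F_bound: "(\<integral>\<^sup>+x. ennreal (norm (F i x)) \<partial>N) \<le> ennreal (b * (2 * \<bar>c\<bar>))" for i
  proof -
    have absF: "simple_function M (\<lambda>x. \<bar>F i x\<bar>)"
      using simple_function_compose[OF F(1), of abs i] by (simp add: comp_def)
    have "integrable N (\<lambda>x. \<bar>F i x\<bar>)"
      using absF by (intro integrable_simple_function) (auto simp: simple_eq emeasure_eq_measure)
    then have "(\<integral>\<^sup>+x. ennreal (norm (F i x)) \<partial>N) = ennreal (L (\<lambda>x. \<bar>F i x\<bar>))"
      unfolding real_norm_def simple[OF absF, symmetric] by (intro nn_integral_eq_integral) auto
    also have "\<dots> \<le> ennreal (b * (2 * \<bar>c\<bar>))"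
      using b[OF _ absF_wbdd, of i] by (intro ennreal_leI) simp
    finally show ?thesis .
  qed
  show int: "integrable N g"
  proof (rule integrableI_bounded)
    have "(\<integral>\<^sup>+x. ennreal (norm (g x)) \<partial>N) = (\<integral>\<^sup>+x. liminf (\<lambda>i. ennreal (norm (F i x))) \<partial>N)"
      using F(2) sp by (intro nn_integral_cong lim_imp_Liminf[symmetric] tendsto_ennrealI tendsto_norm) auto
    also have "\<dots> \<le> liminf (\<lambda>i. \<integral>\<^sup>+x. ennreal (norm (F i x)) \<partial>N)"
      by (rule nn_integral_liminf) measurable
    also have "\<dots> \<le> ennreal (b * (2 * \<bar>c\<bar>))"
      using F_bound by (intro Liminf_le) auto
    finally show "(\<integral>\<^sup>+x. ennreal (norm (g x)) \<partial>N) < \<infinity>"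
      by (simp add: le_less_trans)
  qed measurable
  have "(\<lambda>i. \<integral>x. F i x \<partial>N) \<longlonglongrightarrow> (\<integral>x. g x \<partial>N)"
    by (intro integral_dominated_convergence[where w="\<lambda>x. 2 * \<bar>g x\<bar>"] AE_I2)
       (use F(2,3) int in \<open>simp_all add: sp\<close>)
  moreover have "(\<lambda>i. L (F i)) \<longlonglongrightarrow> L g"
    by (rule wfunctional_limit[OF L F_wbdd F(2)])
  ultimately show "(\<integral>x. g x \<partial>N) = L g"
    using simple[OF F(1)] LIMSEQ_unique by auto
qed

text \<open>The supremum defining the upper variation of A is attained at the part of A in the
  positive set P. Hence the upper variation is the measure of the positive functional
  \<open>L'\<close>, the restriction of \<open>L\<close> to P, and integrates like it.\<close>

lemma upper_variation_integral:
  assumes L: "wfunctional M w L" and w: "\<And>x. x \<in> space M \<Longrightarrow> 1 \<le> w x"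
    and P: "P \<in> sets M" "\<And>B. B \<in> sets M \<Longrightarrow> B \<subseteq> P \<Longrightarrow> 0 \<le> L (indicator B)"
      "\<And>B. B \<in> sets M \<Longrightarrow> B \<inter> P = {} \<Longrightarrow> L (indicator B) \<le> 0"
    and g: "g \<in> wbdd M w c"
  shows "(\<integral>x. g x \<partial>upper_variation M (\<lambda>A. L (indicator A))) = L (\<lambda>x. g x * indicator P x)"
proof -
  define N where "N = upper_variation M (\<lambda>A. L (indicator A))"
  define L' where "L' g = L (\<lambda>x. g x * indicator P x)" for g
  have bd: "(\<lambda>x. f x * indicator P x) \<in> wbdd M w c" if "f \<in> wbdd M w c" for f c
    by (rule wbdd_indicator_mult[OF that P(1)])
  have L': "wfunctional M w L'"
    unfolding wfunctional_def
  proof (intro conjI allI impI)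
    fix c h g assume h: "\<forall>i. h i \<in> wbdd M w c" and g: "g \<in> wbdd M w c"
      and lim: "\<forall>x\<in>space M. (\<lambda>i::nat. h i x) \<longlonglongrightarrow> g x"
    show "(\<lambda>i. L' (h i)) \<longlonglongrightarrow> L' g"
      unfolding L'_def
      by (rule wfunctional_limit[OF L bd]) (use h lim in \<open>auto intro: tendsto_intros\<close>)
  next
    fix c f g assume "f \<in> wbdd M w c" "g \<in> wbdd M w c"
    moreover have "\<And>x. x \<in> space M \<Longrightarrow> 0 \<le> w x"
      using w by force
    ultimately show "L' (\<lambda>x. f x + g x) = L' f + L' g"
      unfolding L'_def distrib_right by (intro wfunctional_add[OF L _ bd bd])
  next
    fix c a f assume "f \<in> wbdd M w c"
    then show "L' (\<lambda>x. a * f x) = a * L' f"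
      unfolding L'_def mult.assoc by (intro wfunctional_scale[OF L bd])
  qed
  have L'_ind: "L' (indicator A) = L (indicator (A \<inter> P))" for A
    unfolding L'_def by (rule arg_cong[where f=L]) (auto simp: indicator_def)
  have pos: "0 \<le> L' (indicator A)" if "A \<in> sets M" for A
    unfolding L'_ind using P(1) that by (intro P(2)) auto
  have SUP_eq: "(SUP B\<in>{B\<in>sets M. B \<subseteq> A}. ennreal (L (indicator B))) = ennreal (L' (indicator A))"
    if A: "A \<in> sets M" for A
  proof (rule antisym)
    show "(SUP B\<in>{B\<in>sets M. B \<subseteq> A}. ennreal (L (indicator B))) \<le> ennreal (L' (indicator A))"
    proof (rule SUP_least, rule ennreal_leI)
      fix B assume B: "B \<in> {B\<in>sets M. B \<subseteq> A}"
      have "L (indicator ((B \<inter> P) \<union> (B - P))) = L (indicator (B \<inter> P)) + L (indicator (B - P))"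
        by (rule wfunctional_Un[OF L w]) (use B P in auto)
      moreover have "L (indicator ((B \<inter> P) \<union> ((A - B) \<inter> P))) = L (indicator (B \<inter> P)) + L (indicator ((A - B) \<inter> P))"
        by (rule wfunctional_Un[OF L w]) (use A B P in auto)
      moreover have "(B \<inter> P) \<union> (B - P) = B" "(B \<inter> P) \<union> ((A - B) \<inter> P) = A \<inter> P"
        using B by auto
      moreover have "L (indicator (B - P)) \<le> 0" "0 \<le> L (indicator ((A - B) \<inter> P))"
        using A B P(1) by (auto intro!: P(2,3))
      ultimately show "L (indicator B) \<le> L' (indicator A)"
        by (simp add: L'_ind)
    qed
    show "ennreal (L' (indicator A)) \<le> (SUP B\<in>{B\<in>sets M. B \<subseteq> A}. ennreal (L (indicator B)))"
      unfolding L'_ind using A P(1) by (intro SUP_upper) auto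
  qed
  have em: "emeasure N A = ennreal (L' (indicator A))" if A: "A \<in> sets M" for A
  proof -
    let ?m = "\<lambda>A. SUP B\<in>{B\<in>sets M. B \<subseteq> A}. ennreal (L (indicator B))"
    \<comment> \<open>\<open>measure_of\<close> keeps a set function only if it is countably
      additive and yields the zero measure otherwise; additivity is taken over from
      \<open>L'\<close>.\<close>
    have "emeasure N A = ?m A"
      unfolding N_def upper_variation_def
    proof (rule emeasure_measure_of_sigma[OF _ _ _ A])
      show "sigma_algebra (space M) (sets M)" ..
      have "L' (indicator {}) = 0"
        using wfunctional_scale[OF L wbdd_indicator[OF sets.empty_sets w], of 0]
        by (simp add: L'_def)
      then show "positive (sets M) ?m"
        unfolding positive_def by (simp only: SUP_eq[OF sets.empty_sets]) simp
      show "countably_additive (sets M) ?m"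
      proof (rule countably_additiveI)
        fix A :: "nat \<Rightarrow> _" assume A: "range A \<subseteq> sets M" "disjoint_family A" "\<Union> (range A) \<in> sets M"
        have "(\<Sum>i. ennreal (L' (indicator (A i)))) = ennreal (L' (indicator (\<Union>i. A i)))"
          by (rule suminf_ennreal_eq[OF pos wfunctional_sums_disjoint[OF L' w]]) (use A in auto)
        moreover have "?m (A i) = ennreal (L' (indicator (A i)))" for i
          by (rule SUP_eq) (use A(1) in auto)
        ultimately show "(\<Sum>i. ?m (A i)) = ?m (\<Union> (range A))"
          by (simp only: SUP_eq[OF A(3)])
      qed
    qed
    then show ?thesis
      using SUP_eq[OF A] by simp
  qed
  have "sets N = sets M"
    by (simp add: N_def upper_variation_def)
  from positive_wfunctional_integral(2)[OF L' w this em pos g] show ?thesis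
    unfolding N_def L'_def .
qed

text \<open>The complement of a positive set for \<open>L\<close> is a positive set for its
  negative. So the two upper variations integrate the two halves of \<open>g\<close>, and linearity
  puts them together.\<close>

lemma signed_integral_wfunctional:
  assumes L: "wfunctional M w L" and w: "\<And>x. x \<in> space M \<Longrightarrow> 1 \<le> w x"
    and g: "g \<in> wbdd M w c"
  shows "signed_integral M (\<lambda>A. L (indicator A)) g = L g"
proof -
  obtain P where P: "P \<in> sets M" "\<And>B. B \<in> sets M \<Longrightarrow> B \<subseteq> P \<Longrightarrow> 0 \<le> L (indicator B)"
    "\<And>B. B \<in> sets M \<Longrightarrow> B \<inter> P = {} \<Longrightarrow> L (indicator B) \<le> 0"
    using wfunctional_Hahn_decomposition[OF L w] by blast
  have w0: "\<And>x. x \<in> space M \<Longrightarrow> 0 \<le> w x"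
    using w by force
  have bd: "(\<lambda>x. g x * indicator A x) \<in> wbdd M w c" if "A \<in> sets M" for A
    by (rule wbdd_indicator_mult[OF g that])
  have neg: "wfunctional M w (\<lambda>g. - L g)"
    using wfunctional_lincomb[OF L L, of "-1" 0] by simp
  have "(\<integral>x. g x \<partial>upper_variation M (\<lambda>A. - L (indicator A))) = - L (\<lambda>x. g x * indicator (space M - P) x)"
  proof (rule upper_variation_integral[OF neg w _ _ _ g])
    fix B assume B: "B \<in> sets M"
    show "0 \<le> - L (indicator B)" if "B \<subseteq> space M - P"
      using P(3)[OF B] that by auto
    show "- L (indicator B) \<le> 0" if "B \<inter> (space M - P) = {}"
      using P(2)[OF B] that sets.sets_into_space[OF B] by auto
  qed (use P in auto)
  moreover have "(\<integral>x. g x \<partial>upper_variation M (\<lambda>A. L (indicator A))) = L (\<lambda>x. g x * indicator P x)"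
    by (rule upper_variation_integral[OF L w P g])
  moreover have "L g = L (\<lambda>x. g x * indicator P x + g x * indicator (space M - P) x)"
    by (rule wfunctional_cong[OF L g]) (auto simp: indicator_def)
  moreover have "\<dots> = L (\<lambda>x. g x * indicator P x) + L (\<lambda>x. g x * indicator (space M - P) x)"
    using P(1) by (intro wfunctional_add[OF L w0 bd bd]) auto
  ultimately show ?thesis
    by (simp add: signed_integral_def)
qed

lemma weighted_norm_wfunctional:
  assumes L: "wfunctional M w L" and w: "\<And>x. x \<in> space M \<Longrightarrow> 1 \<le> w x"
  shows "weighted_norm M w (\<lambda>A. L (indicator A)) = (SUP g\<in>wbdd M w 1. ennreal (L g))"
proof -
  have "{g \<in> borel_measurable M. \<forall>x\<in>space M. \<bar>g x\<bar> \<le> w x} = wbdd M w 1"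
    by (simp add: wbdd_def)
  then show ?thesis
    unfolding weighted_norm_def by (simp add: signed_integral_wfunctional[OF L w] cong: SUP_cong)
qed

text \<open>The supremum in the norm clips negative values at 0; the lower bound comes from testing
  with the negative of \<open>g\<close>, which lies in the same ball.\<close>

lemma abs_le_of_weighted_norm:
  assumes "wfunctional M w L" "\<And>x. x \<in> space M \<Longrightarrow> 1 \<le> w x" "0 \<le> a"
    and "weighted_norm M w (\<lambda>A. L (indicator A)) \<le> ennreal a" "g \<in> wbdd M w 1"
  shows "\<bar>L g\<bar> \<le> a"
proof -
  have *: "L h \<le> a" if "h \<in> wbdd M w 1" for h
  proof -
    have "ennreal (L h) \<le> weighted_norm M w (\<lambda>A. L (indicator A))"
      by (subst weighted_norm_wfunctional[OF assms(1,2)]) (auto intro: SUP_upper that)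
    also note assms(4)
    finally have "ennreal (L h) \<le> ennreal a" .
    then show ?thesis
      using \<open>0 \<le> a\<close> by (simp add: ennreal_le_iff)
  qed
  show ?thesis
    using *[OF assms(5)] *[of "\<lambda>x. -1 * g x"] wbdd_scale[OF assms(5), of "-1"]
      wfunctional_scale[OF assms(1,5), of "-1"] by simp
qed

lemma weighted_norm_cong:
  assumes "\<And>A. A \<in> sets M \<Longrightarrow> \<mu> A = \<nu> A"
  shows "weighted_norm M W \<mu> = weighted_norm M W \<nu>"
proof -
  have "upper_variation M \<mu> = upper_variation M \<nu>" "upper_variation M (\<lambda>A. - \<mu> A) = upper_variation M (\<lambda>A. - \<nu> A)"
    unfolding upper_variation_def using assms by (simp_all cong: SUP_cong_simp)
  then show ?thesis
    by (simp add: weighted_norm_def signed_integral_def)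
qed

subsection \<open>Smooth families of functionals\<close>

text \<open>With S a unit ball this is convergence to 0 in the dual norm. The filter is punctured at
  u, so difference quotients are admissible, and it is one-sided at 0 and 1.\<close>

abbreviation vanishes :: "'s set \<Rightarrow> real \<Rightarrow> (real \<Rightarrow> 's \<Rightarrow> real) \<Rightarrow> bool" where
  "vanishes S u G \<equiv> uniform_limit S G (\<lambda>_. 0) (at u within {0..1})"

lemma vanishes_add:
  "vanishes S u F \<Longrightarrow> vanishes S u G \<Longrightarrow> vanishes S u (\<lambda>v g. F v g + G v g)"
  by (drule (1) uniform_limit_add) simp

lemma vanishes_cong:
  assumes "vanishes S u F" "\<And>v g. v \<in> {0..1} \<Longrightarrow> v \<noteq> u \<Longrightarrow> g \<in> S \<Longrightarrow> F v g = G v g"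
  shows "vanishes S u G"
proof -
  have *: "\<forall>\<^sub>F v in at u within {0..1}. \<forall>g\<in>S. F v g = G v g"
    using assms(2) by (auto simp: eventually_at_filter)
  show ?thesis
  proof (rule uniform_limitI)
    fix e :: real assume "0 < e"
    from uniform_limitD[OF assms(1) this] *
    show "\<forall>\<^sub>F v in at u within {0..1}. \<forall>g\<in>S. dist (G v g) 0 < e"
      by eventually_elim auto
  qed
qed

text \<open>Dominated convergence cannot be applied to the supremum over g in S, which need not be
  measurable in x. A sequence of bad pairs \<open>v i\<close>, \<open>g i\<close> replaces the
  supremum by countably many measurable functions.\<close>

lemma wfunctional_vanishes:
  assumes L: "wfunctional M w L"
    and D: "\<And>v g. v \<in> {0..1} \<Longrightarrow> v \<noteq> u \<Longrightarrow> g \<in> S \<Longrightarrow> D v g \<in> wbdd M w c"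
    and lim: "\<And>x. x \<in> space M \<Longrightarrow> vanishes S u (\<lambda>v g. D v g x)"
  shows "vanishes S u (\<lambda>v g. L (D v g))"
proof (rule ccontr)
  assume "\<not> ?thesis"
  then obtain e where e: "0 < e" "\<not> (\<forall>\<^sub>F v in at u within {0..1}. \<forall>g\<in>S. dist (L (D v g)) 0 < e)"
    by (auto simp: uniform_limit_iff)
  have "\<exists>v g. v \<in> {0..1} \<and> v \<noteq> u \<and> dist v u < d \<and> g \<in> S \<and> e \<le> \<bar>L (D v g)\<bar>" if "0 < d" for d
  proof -
    from e(2) that have "\<not> (\<forall>v\<in>{0..1}. v \<noteq> u \<and> dist v u < d \<longrightarrow> (\<forall>g\<in>S. dist (L (D v g)) 0 < e))"
      unfolding eventually_at by blast
    then show ?thesis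
      by (auto simp: not_less)
  qed
  then have "\<forall>i. \<exists>v g. v \<in> {0..1} \<and> v \<noteq> u \<and> dist v u < inverse (real (Suc i)) \<and> g \<in> S \<and> e \<le> \<bar>L (D v g)\<bar>"
    by simp
  then obtain v g where vg: "\<And>i. v i \<in> {0..1}" "\<And>i. v i \<noteq> u" "\<And>i. dist (v i) u < inverse (real (Suc i))"
    "\<And>i. g i \<in> S" "\<And>i. e \<le> \<bar>L (D (v i) (g i))\<bar>"
    by metis
  have "v \<longlonglongrightarrow> u"
  proof (rule metric_LIMSEQ_I)
    fix r :: real assume "0 < r"
    then have "\<forall>\<^sub>F i in sequentially. inverse (real (Suc i)) < r"
      using LIMSEQ_inverse_real_of_nat order_tendstoD(2) by blast
    then show "\<exists>no. \<forall>n\<ge>no. dist (v n) u < r"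
      using vg(3) by (meson eventually_sequentially less_trans)
  qed
  then have v: "filterlim v (at u within {0..1}) sequentially"
    using vg(1,2) by (simp add: filterlim_at)
  have "(\<lambda>i. L (D (v i) (g i))) \<longlonglongrightarrow> L (\<lambda>x. 0)"
  proof (rule wfunctional_limit[OF L])
    show "D (v i) (g i) \<in> wbdd M w c" for i
      using vg by (intro D) auto
    show "(\<lambda>i. D (v i) (g i) x) \<longlonglongrightarrow> 0" if x: "x \<in> space M" for x
    proof (rule metric_LIMSEQ_I)
      fix r :: real assume "0 < r"
      from uniform_limitD[OF lim[OF x] this]
      have "\<forall>\<^sub>F i in sequentially. \<forall>g\<in>S. dist (D (v i) g x) 0 < r"
        by (rule eventually_compose_filterlim[OF _ v])
      then show "\<exists>no. \<forall>n\<ge>no. dist (D (v n) (g n) x) 0 < r"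
        using vg(4) by (auto simp: eventually_sequentially)
    qed
  qed
  moreover have "L (\<lambda>x. 0) = 0"
    using wfunctional_scale[OF L D[OF vg(1,2,4)], where a=0] by simp
  ultimately have "\<forall>\<^sub>F i in sequentially. dist (L (D (v i) (g i))) 0 < e"
    using e(1) by (auto dest: tendstoD)
  then show False
    using vg(5) by (auto simp: eventually_sequentially dest!: spec leD)
qed

text \<open>Rescaling moves the functions \<open>D v g\<close> into the unit ball. Of
  \<open>G v\<close> only homogeneity is required, because in \<open>solution_wderiv\<close> it is a
  functional of a difference quotient of operators, linear on the unit ball but not given as a
  \<open>wfunctional\<close>.\<close>

lemma vanishes_compose:
  assumes G: "vanishes (wbdd M w 1) u G"
    and scale: "\<And>v a h. v \<in> {0..1} \<Longrightarrow> v \<noteq> u \<Longrightarrow> h \<in> wbdd M w 1 \<Longrightarrow> G v (\<lambda>x. a * h x) = a * G v h"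
    and D: "\<And>v g. v \<in> {0..1} \<Longrightarrow> v \<noteq> u \<Longrightarrow> g \<in> S \<Longrightarrow> D v g \<in> wbdd M w c"
    and w: "\<And>x. x \<in> space M \<Longrightarrow> 0 \<le> w x"
  shows "vanishes S u (\<lambda>v g. G v (D v g))"
proof (rule uniform_limitI)
  fix e :: real assume "0 < e"
  define d where "d = max c 1"
  have d: "0 < d" "c \<le> d"
    by (auto simp: d_def)
  have "\<forall>\<^sub>F v in at u within {0..1}. \<forall>h\<in>wbdd M w 1. dist (G v h) 0 < e / d"
    using \<open>0 < e\<close> d by (intro uniform_limitD[OF G]) auto
  then have *: "\<forall>\<^sub>F v in at u within {0..1}. v \<in> {0..1} \<and> v \<noteq> u \<and> (\<forall>h\<in>wbdd M w 1. dist (G v h) 0 < e / d)"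
    by (auto simp: eventually_at_filter elim: eventually_mono)
  show "\<forall>\<^sub>F v in at u within {0..1}. \<forall>g\<in>S. dist (G v (D v g)) 0 < e"
    using *
  proof (rule eventually_mono, intro ballI)
    fix v g assume v: "v \<in> {0..1} \<and> v \<noteq> u \<and> (\<forall>h\<in>wbdd M w 1. dist (G v h) 0 < e / d)" and g: "g \<in> S"
    have h: "(\<lambda>x. (1/d) * D v g x) \<in> wbdd M w 1"
      by (rule wbdd_mono[OF wbdd_scale[OF wbdd_mono[OF D[of v g] d(2) w]]]) (use v g d w in auto)
    have "G v (D v g) = d * G v (\<lambda>x. (1/d) * D v g x)"
      using scale[OF _ _ h, of v d] v d by simp
    moreover have "\<bar>G v (\<lambda>x. (1/d) * D v g x)\<bar> < e / d"
      using v h by auto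
    ultimately show "dist (G v (D v g)) 0 < e"
      using d by (simp add: abs_mult field_simps)
  qed
qed

lemma vanishes_compose_wfunctional:
  assumes "vanishes (wbdd M w 1) u G" "\<And>v. v \<in> {0..1} \<Longrightarrow> wfunctional M w (G v)"
    "\<And>v g. v \<in> {0..1} \<Longrightarrow> v \<noteq> u \<Longrightarrow> g \<in> S \<Longrightarrow> D v g \<in> wbdd M w c" "\<And>x. x \<in> space M \<Longrightarrow> 0 \<le> w x"
  shows "vanishes S u (\<lambda>v g. G v (D v g))"
  using assms wfunctional_scale by (intro vanishes_compose[OF assms(1)]) blast+

definition wcont :: "'a measure \<Rightarrow> ('a \<Rightarrow> real) \<Rightarrow> (real \<Rightarrow> ('a \<Rightarrow> real) \<Rightarrow> real) \<Rightarrow> bool" where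
  "wcont M w F \<longleftrightarrow> (\<forall>u\<in>{0..1}. wfunctional M w (F u) \<and> vanishes (wbdd M w 1) u (\<lambda>v g. F v g - F u g))"

definition wderiv :: "'a measure \<Rightarrow> ('a \<Rightarrow> real) \<Rightarrow> (real \<Rightarrow> ('a \<Rightarrow> real) \<Rightarrow> real) \<Rightarrow>
    (real \<Rightarrow> ('a \<Rightarrow> real) \<Rightarrow> real) \<Rightarrow> bool" where
  "wderiv M w F F' \<longleftrightarrow>
     (\<forall>u\<in>{0..1}. vanishes (wbdd M w 1) u (\<lambda>v g. (F v g - F u g) / (v - u) - F' u g))"

text \<open>
  Each differentiation costs one level of the scale of weights \<open>W 0 \<le> W 1 \<le> \<dots>\<close>: the values of
  \<open>F\<close> live at level \<open>n\<close>, those of its \<open>i\<close>-th derivative at level \<open>n - i\<close>, for \<open>i \<le> m\<close>.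
\<close>

fun smooth :: "'a measure \<Rightarrow> (nat \<Rightarrow> 'a \<Rightarrow> real) \<Rightarrow> nat \<Rightarrow> nat \<Rightarrow>
    (real \<Rightarrow> ('a \<Rightarrow> real) \<Rightarrow> real) \<Rightarrow> bool" where
  "smooth M W 0 n F = wcont M (W n) F"
| "smooth M W (Suc m) n F =
     (\<exists>i F'. n = Suc i \<and> wcont M (W n) F \<and> wderiv M (W i) F F' \<and> smooth M W m i F')"

lemma wcontD:
  assumes "wcont M w F" "u \<in> {0..1}"
  shows "wfunctional M w (F u)" "vanishes (wbdd M w 1) u (\<lambda>v g. F v g - F u g)"
  using assms by (auto simp: wcont_def)

lemma wderivD:
  "wderiv M w F F' \<Longrightarrow> u \<in> {0..1} \<Longrightarrow> vanishes (wbdd M w 1) u (\<lambda>v g. (F v g - F u g) / (v - u) - F' u g)"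
  by (auto simp: wderiv_def)

lemma smooth_wcont: "smooth M W m n F \<Longrightarrow> wcont M (W n) F"
  by (cases m) auto

lemma smooth_Suc: "smooth M W (Suc m) n F \<Longrightarrow> smooth M W m n F"
proof (induction m arbitrary: n F)
  case (Suc m)
  from Suc.prems obtain i F' where "n = Suc i" "wcont M (W n) F" "wderiv M (W i) F F'" "smooth M W (Suc m) i F'"
    by (subst (asm) smooth.simps) blast
  with Suc.IH[of i F'] show ?case
    unfolding smooth.simps(2) by blast
qed auto

lemma wcont_add:
  assumes F: "wcont M w F" and G: "wcont M w G"
  shows "wcont M w (\<lambda>u g. F u g + G u g)"
  unfolding wcont_def
proof (intro ballI conjI)
  fix u :: real assume u: "u \<in> {0..1}"
  show "wfunctional M w (\<lambda>g. F u g + G u g)"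
    by (intro wfunctional_sum wcontD[OF F] wcontD[OF G] u)
  show "vanishes (wbdd M w 1) u (\<lambda>v g. F v g + G v g - (F u g + G u g))"
    by (rule vanishes_cong[OF vanishes_add[OF wcontD(2)[OF F u] wcontD(2)[OF G u]]]) simp
qed

lemma wderiv_add:
  assumes F: "wderiv M w F F'" and G: "wderiv M w G G'"
  shows "wderiv M w (\<lambda>u g. F u g + G u g) (\<lambda>u g. F' u g + G' u g)"
  unfolding wderiv_def
proof
  fix u :: real assume u: "u \<in> {0..1}"
  show "vanishes (wbdd M w 1) u
      (\<lambda>v g. (F v g + G v g - (F u g + G u g)) / (v - u) - (F' u g + G' u g))"
    by (rule vanishes_cong[OF vanishes_add[OF wderivD[OF F u] wderivD[OF G u]]])
       (simp add: add_divide_distrib diff_divide_distrib)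
qed

lemma smooth_add: "smooth M W m n F \<Longrightarrow> smooth M W m n G \<Longrightarrow> smooth M W m n (\<lambda>u g. F u g + G u g)"
proof (induction m arbitrary: n F G)
  case 0
  then show ?case by (simp add: wcont_add)
next
  case (Suc m)
  from Suc.prems(1) obtain i F' where F: "n = Suc i" "wcont M (W n) F" "wderiv M (W i) F F'" "smooth M W m i F'"
    by auto
  from Suc.prems(2) F(1) obtain G' where G: "wcont M (W n) G" "wderiv M (W i) G G'" "smooth M W m i G'"
    by auto
  show ?case
    using F(1) wcont_add[OF F(2) G(1)] wderiv_add[OF F(3) G(2)] Suc.IH[OF F(4) G(3)] by auto
qed

lemma smooth_const:
  assumes "\<And>i. i \<le> n \<Longrightarrow> wfunctional M (W i) L" "m \<le> n"
  shows "smooth M W m n (\<lambda>_. L)"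
  using assms
proof (induction m arbitrary: n L)
  case 0
  then show ?case
    by (auto simp: wcont_def uniform_limit_iff)
next
  case (Suc m)
  then obtain i where i: "n = Suc i" "m \<le> i"
    by (cases n) auto
  have "wcont M (W n) (\<lambda>_. L)" "wderiv M (W i) (\<lambda>_. L) (\<lambda>_ _. 0)"
    using Suc.prems(1) by (auto simp: wcont_def wderiv_def uniform_limit_iff)
  moreover have "smooth M W m i (\<lambda>_ _. 0)"
    by (rule Suc.IH) (use i(2) in \<open>auto simp: wfunctional_def\<close>)
  ultimately show ?case
    using i by auto
qed

section \<open>Product rule for functionals composed with families of operators\<close>

lemma wfunctional_compose:
  assumes L: "wfunctional M w L" and w: "\<And>x. x \<in> space M \<Longrightarrow> 0 \<le> w x"
    and z: "\<And>x. x \<in> space N \<Longrightarrow> 0 \<le> z x"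
    and S: "\<And>g c. 0 \<le> c \<Longrightarrow> g \<in> wbdd N z c \<Longrightarrow> S g \<in> wbdd M w (C * c)"
    and fS: "\<And>x. x \<in> space M \<Longrightarrow> wfunctional N z (\<lambda>g. S g x)"
  shows "wfunctional N z (\<lambda>g. L (S g))"
proof -
  have S': "S g \<in> wbdd M w (C * \<bar>c\<bar>)" "g \<in> wbdd N z \<bar>c\<bar>" if "g \<in> wbdd N z c" for g c
    using S[OF abs_ge_zero wbdd_mono[OF that abs_ge_self z]] wbdd_mono[OF that abs_ge_self z] by auto
  show ?thesis
    unfolding wfunctional_def
  proof (intro conjI allI impI)
    fix c f g assume fg: "f \<in> wbdd N z c" "g \<in> wbdd N z c"
    have "L (S (\<lambda>x. f x + g x)) = L (\<lambda>x. S f x + S g x)"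
      by (rule wfunctional_cong[OF L S(1)[OF _ wbdd_add[OF S'(2)[OF fg(1)] S'(2)[OF fg(2)]]]])
         (use wfunctional_add[OF fS z fg] in auto)
    also have "\<dots> = L (S f) + L (S g)"
      by (rule wfunctional_add[OF L w S'(1)[OF fg(1)] S'(1)[OF fg(2)]])
    finally show "L (S (\<lambda>x. f x + g x)) = L (S f) + L (S g)" .
  next
    fix c a f assume f: "f \<in> wbdd N z c"
    have "L (S (\<lambda>x. a * f x)) = L (\<lambda>x. a * S f x)"
      by (rule wfunctional_cong[OF L S(1)[OF _ wbdd_scale[OF S'(2)[OF f]]]])
         (use wfunctional_scale[OF fS f] in auto)
    also have "\<dots> = a * L (S f)"
      by (rule wfunctional_scale[OF L S'(1)[OF f]])
    finally show "L (S (\<lambda>x. a * f x)) = a * L (S f)" .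
  next
    \<comment> \<open>Dominated convergence is used twice: for \<open>S\<close> at each fixed x,
      then for \<open>L\<close> under the bound on \<open>S (h i)\<close> that is uniform in
      i.\<close>
    fix c h g assume "\<forall>i. h i \<in> wbdd N z c" "g \<in> wbdd N z c" "\<forall>x\<in>space N. (\<lambda>i::nat. h i x) \<longlonglongrightarrow> g x"
    then show "(\<lambda>i. L (S (h i))) \<longlonglongrightarrow> L (S g)"
      by (intro wfunctional_limit[OF L S'(1)] wfunctional_limit[OF fS]) auto
  qed
qed

text \<open>The common interface of the kernels \<open>Q u\<close> and of the kernels that prolong a
  path; \<open>T l\<close> is the l-th derivative of \<open>T 0\<close>. Convergence is asked for at
  each x, uniformly over the unit ball of test functions. \<open>T_lipschitz\<close> provides the
  dominating function for difference quotients, one level up, where \<open>T (Suc l)\<close> takes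
  its values as well.\<close>

locale operator_family =
  fixes k :: nat and M :: "'a measure" and N :: "'b measure"
    and W :: "nat \<Rightarrow> 'a \<Rightarrow> real" and U :: "nat \<Rightarrow> 'b \<Rightarrow> real"
    and T :: "nat \<Rightarrow> real \<Rightarrow> ('b \<Rightarrow> real) \<Rightarrow> 'a \<Rightarrow> real" and C :: real
  assumes C_nonneg: "0 \<le> C"
    and W_ge_1: "n \<le> k \<Longrightarrow> x \<in> space M \<Longrightarrow> 1 \<le> W n x"
    and U_ge_1: "n \<le> k \<Longrightarrow> y \<in> space N \<Longrightarrow> 1 \<le> U n y"
    and W_Suc: "n < k \<Longrightarrow> x \<in> space M \<Longrightarrow> W n x \<le> W (Suc n) x"
    and T_wbdd: "n + l \<le> k \<Longrightarrow> u \<in> {0..1} \<Longrightarrow> 0 \<le> c \<Longrightarrow> g \<in> wbdd N (U n) c \<Longrightarrow>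
      T l u g \<in> wbdd M (W (n + l)) (C * c)"
    and T_wfunctional: "n + l \<le> k \<Longrightarrow> u \<in> {0..1} \<Longrightarrow> x \<in> space M \<Longrightarrow> wfunctional N (U n) (\<lambda>g. T l u g x)"
    and T_cont: "n + l \<le> k \<Longrightarrow> u \<in> {0..1} \<Longrightarrow> x \<in> space M \<Longrightarrow>
      vanishes (wbdd N (U n) 1) u (\<lambda>v g. T l v g x - T l u g x)"
    and T_deriv: "n + l < k \<Longrightarrow> u \<in> {0..1} \<Longrightarrow> x \<in> space M \<Longrightarrow>
      vanishes (wbdd N (U n) 1) u (\<lambda>v g. (T l v g x - T l u g x) / (v - u) - T (Suc l) u g x)"
    and T_lipschitz: "n + l < k \<Longrightarrow> u \<in> {0..1} \<Longrightarrow> v \<in> {0..1} \<Longrightarrow> x \<in> space M \<Longrightarrow> g \<in> wbdd N (U n) 1 \<Longrightarrow>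
      \<bar>T l v g x - T l u g x\<bar> \<le> C * \<bar>v - u\<bar> * W (Suc (n + l)) x"
begin

lemma W_nonneg: "n \<le> k \<Longrightarrow> x \<in> space M \<Longrightarrow> 0 \<le> W n x"
  using W_ge_1[of n x] by simp

lemma U_nonneg: "n \<le> k \<Longrightarrow> y \<in> space N \<Longrightarrow> 0 \<le> U n y"
  using U_ge_1[of n y] by simp

lemma T_difference:
  assumes "n + l \<le> k" "u \<in> {0..1}" "v \<in> {0..1}" "g \<in> wbdd N (U n) 1"
  shows "(\<lambda>x. T l v g x - T l u g x) \<in> wbdd M (W (n + l)) (2 * C)"
  using wbdd_diff[OF T_wbdd[OF assms(1,3) _ assms(4)] T_wbdd[OF assms(1,2) _ assms(4)]] by simp

lemma T_difference_quotient:
  assumes nl: "n + l < k" and u: "u \<in> {0..1}" and v: "v \<in> {0..1}" "v \<noteq> u" and g: "g \<in> wbdd N (U n) 1"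
  shows "(\<lambda>x. (T l v g x - T l u g x) / (v - u) - T (Suc l) u g x) \<in> wbdd M (W (Suc (n + l))) (2 * C)"
proof -
  have 1: "(\<lambda>x. (T l v g x - T l u g x) / (v - u)) \<in> wbdd M (W (Suc (n + l))) C"
  proof (rule wbddI)
    have "(\<lambda>x. T l v g x - T l u g x) \<in> borel_measurable M"
      by (rule wbdd_measurable[OF T_difference[of n l u v g]]) (use assms in auto)
    then show "(\<lambda>x. (T l v g x - T l u g x) / (v - u)) \<in> borel_measurable M"
      by simp
    fix x assume "x \<in> space M"
    from T_lipschitz[OF nl u v(1) this g] v(2)
    show "\<bar>(T l v g x - T l u g x) / (v - u)\<bar> \<le> C * W (Suc (n + l)) x"
      by (simp add: abs_divide divide_le_eq mult_ac)
  qed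
  have 2: "T (Suc l) u g \<in> wbdd M (W (Suc (n + l))) C"
    using T_wbdd[of n "Suc l" u 1 g] assms by simp
  show ?thesis
    using wbdd_diff[OF 1 2] by simp
qed

text \<open>Split F v T v - F u T u into (F v - F u) T v + F u (T v - T u). The first part is small
  in norm since T v is bounded uniformly in v, the second by \<open>wfunctional_vanishes\<close>
  since F u does not move.\<close>

lemma wcont_compose:
  assumes nl: "n + l \<le> k" and F: "wcont M (W (n + l)) F"
  shows "wcont N (U n) (\<lambda>u g. F u (T l u g))"
  unfolding wcont_def
proof (intro ballI conjI)
  fix u :: real assume u: "u \<in> {0..1}"
  note Fu = wcontD(1)[OF F]
  show "wfunctional N (U n) (\<lambda>g. F u (T l u g))"
    by (rule wfunctional_compose[OF Fu[OF u]])
       (use nl u in \<open>auto intro: W_nonneg U_nonneg T_wbdd T_wfunctional\<close>)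
  have 1: "vanishes (wbdd N (U n) 1) u (\<lambda>v g. F v (T l v g) - F u (T l v g))"
    by (rule vanishes_compose_wfunctional[OF wcontD(2)[OF F u], where c=C])
       (use T_wbdd[of n l _ 1] nl u W_nonneg in \<open>auto intro!: wfunctional_difference Fu\<close>)
  have 2: "vanishes (wbdd N (U n) 1) u (\<lambda>v g. F u (\<lambda>x. T l v g x - T l u g x))"
    by (rule wfunctional_vanishes[OF Fu[OF u] T_difference T_cont]) (use nl u in auto)
  show "vanishes (wbdd N (U n) 1) u (\<lambda>v g. F v (T l v g) - F u (T l u g))"
  proof (rule vanishes_cong[OF vanishes_add[OF 1 2]])
    fix v :: real and g assume "v \<in> {0..1}" "g \<in> wbdd N (U n) 1"
    then have "F u (\<lambda>x. T l v g x - T l u g x) = F u (T l v g) - F u (T l u g)"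
      by (intro wfunctional_diff[OF Fu[OF u] W_nonneg, where c="C * 1" and d="C * 1"] T_wbdd)
         (use nl u in auto)
    then show "F v (T l v g) - F u (T l v g) + F u (\<lambda>x. T l v g x - T l u g x) = F v (T l v g) - F u (T l u g)"
      by simp
  qed
qed

lemma wfunctional_level:
  assumes "wfunctional M (W n) L" "n \<le> k" "i \<le> n"
  shows "wfunctional M (W i) L"
proof -
  have "x \<in> space M \<Longrightarrow> W i x \<le> W n x" for x
    using \<open>i \<le> n\<close> \<open>n \<le> k\<close>
    by (induction n rule: dec_induct) (auto intro: order_trans[OF _ W_Suc])
  then show ?thesis
    using assms by (intro wfunctional_weight_mono[OF assms(1) W_nonneg]) auto
qed

text \<open>The error of the difference quotient has three parts: the error of the quotient of F,
  tested with T v g; F' u applied to T v g - T u g; and F u applied to the error of the quotient of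
  T. The last one lives on level n + l + 1, so F must be defined there, while F' is used on level n
  + l only.\<close>

lemma wderiv_compose:
  assumes nl: "n + l < k" and F: "wcont M (W (Suc (n + l))) F"
    and F': "wderiv M (W (n + l)) F F'" "\<And>u. u \<in> {0..1} \<Longrightarrow> wfunctional M (W (n + l)) (F' u)"
  shows "wderiv N (U n) (\<lambda>u g. F u (T l u g)) (\<lambda>u g. F' u (T l u g) + F u (T (Suc l) u g))"
  unfolding wderiv_def
proof
  fix u :: real assume u: "u \<in> {0..1}"
  note Fu1 = wcontD(1)[OF F]
  have Fu: "wfunctional M (W (n + l)) (F u)" if "u \<in> {0..1}" for u
    by (rule wfunctional_level[OF Fu1[OF that]]) (use nl in auto)
  have 1: "vanishes (wbdd N (U n) 1) u (\<lambda>v g. (F v (T l v g) - F u (T l v g)) / (v - u) - F' u (T l v g))"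
    by (rule vanishes_compose_wfunctional[OF wderivD[OF F'(1) u], where c=C])
       (use T_wbdd[of n l _ 1] nl u W_nonneg in \<open>auto intro!: wfunctional_difference wfunctional_divide Fu F'(2)\<close>)
  have 2: "vanishes (wbdd N (U n) 1) u (\<lambda>v g. F' u (\<lambda>x. T l v g x - T l u g x))"
    by (rule wfunctional_vanishes[OF F'(2)[OF u] T_difference T_cont]) (use nl u in auto)
  have 3: "vanishes (wbdd N (U n) 1) u (\<lambda>v g. F u (\<lambda>x. (T l v g x - T l u g x) / (v - u) - T (Suc l) u g x))"
    by (rule wfunctional_vanishes[OF Fu1[OF u] T_difference_quotient T_deriv]) (use nl u in auto)
  show "vanishes (wbdd N (U n) 1) u
      (\<lambda>v g. (F v (T l v g) - F u (T l u g)) / (v - u) - (F' u (T l u g) + F u (T (Suc l) u g)))"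
  proof (rule vanishes_cong[OF vanishes_add[OF vanishes_add[OF 1 2] 3]])
    fix v g assume v: "v \<in> {0..1}" "v \<noteq> u" and g: "g \<in> wbdd N (U n) 1"
    have T: "T l v g \<in> wbdd M (W (n + l)) C" "T l u g \<in> wbdd M (W (n + l)) C"
      "T (Suc l) u g \<in> wbdd M (W (Suc (n + l))) C"
      using T_wbdd[of n l _ 1 g] T_wbdd[of n "Suc l" _ 1 g] v u nl g by auto
    have "F' u (\<lambda>x. T l v g x - T l u g x) = F' u (T l v g) - F' u (T l u g)"
      by (rule wfunctional_diff[OF F'(2)[OF u] W_nonneg T(1,2)]) (use nl in auto)
    moreover
    \<comment> \<open>The quotient is its error, bounded by \<open>2 * C\<close>, plus
      \<open>T (Suc l) u g\<close>, bounded by \<open>C\<close>. The bound is on the upper level,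
      where it can be subtracted from \<open>T (Suc l) u g\<close> under \<open>F u\<close>.\<close>
    have "(\<lambda>x. (1 / (v - u)) * (T l v g x - T l u g x)) \<in> wbdd M (W (Suc (n + l))) (3 * C)"
      using wbdd_add[OF T_difference_quotient[OF nl u v g] T(3)] by simp
    from wfunctional_diff[OF Fu1[OF u] W_nonneg this T(3)]
    have "F u (\<lambda>x. (T l v g x - T l u g x) / (v - u) - T (Suc l) u g x)
      = F u (\<lambda>x. (1 / (v - u)) * (T l v g x - T l u g x)) - F u (T (Suc l) u g)"
      using nl by simp
    moreover have "F u (\<lambda>x. (1 / (v - u)) * (T l v g x - T l u g x)) = (F u (T l v g) - F u (T l u g)) / (v - u)"
      using wfunctional_scale[OF Fu[OF u] wbdd_diff[OF T(1,2)], of "1 / (v - u)"]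
        wfunctional_diff[OF Fu[OF u] W_nonneg T(1,2)] nl by simp
    ultimately show "(F v (T l v g) - F u (T l v g)) / (v - u) - F' u (T l v g)
        + F' u (\<lambda>x. T l v g x - T l u g x)
        + F u (\<lambda>x. (T l v g x - T l u g x) / (v - u) - T (Suc l) u g x)
      = (F v (T l v g) - F u (T l u g)) / (v - u) - (F' u (T l u g) + F u (T (Suc l) u g))"
      by (simp add: diff_divide_distrib)
  qed
qed

text \<open>Induction on m for all l at once, as the derivative brings in \<open>T (Suc l)\<close>.
  The levels balance: F' on level i + l composed with \<open>T l\<close>, and F on level i + (l + 1)
  composed with \<open>T (Suc l)\<close>, both act on level i.\<close>

lemma smooth_compose:
  assumes "n + l \<le> k" "m \<le> n" "smooth M W m (n + l) F"
  shows "smooth N U m n (\<lambda>u g. F u (T l u g))"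
  using assms
proof (induction m arbitrary: n l F)
  case 0
  then show ?case
    by (simp add: wcont_compose)
next
  case (Suc m)
  from Suc.prems(2) obtain i where i: "n = Suc i" "m \<le> i"
    by (cases n) auto
  from Suc.prems(3) i obtain F' where F: "wcont M (W (Suc (i + l))) F" "wderiv M (W (i + l)) F F'"
      "smooth M W m (i + l) F'"
    by auto
  have "wderiv N (U i) (\<lambda>u g. F u (T l u g)) (\<lambda>u g. F' u (T l u g) + F u (T (Suc l) u g))"
    by (rule wderiv_compose[OF _ F(1,2) wcontD(1)[OF smooth_wcont[OF F(3)]]])
       (use Suc.prems i in auto)
  moreover have "smooth N U m i (\<lambda>u g. F' u (T l u g) + F u (T (Suc l) u g))"
    by (intro smooth_add Suc.IH F(3)) (use smooth_Suc[OF Suc.prems(3)] Suc.prems i in auto)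
  moreover have "wcont N (U n) (\<lambda>u g. F u (T l u g))"
    using Suc.prems(1) by (rule wcont_compose[OF _ smooth_wcont[OF Suc.prems(3)]])
  ultimately show ?case
    using i by auto
qed

end

section \<open>From smooth families of functionals to smooth curves of signed measures\<close>

lemma smooth_derivatives:
  assumes "smooth M W m n F"
    and W: "\<And>i x. i \<le> n \<Longrightarrow> x \<in> space M \<Longrightarrow> W 0 x \<le> W i x" "\<And>x. x \<in> space M \<Longrightarrow> 0 \<le> W 0 x"
  shows "\<exists>D. D 0 = F \<and> (\<forall>l\<le>m. \<forall>u\<in>{0..1}. wfunctional M (W 0) (D l u)) \<and>
    (\<forall>l<m. wderiv M (W 0) (D l) (D (Suc l))) \<and> wcont M (W 0) (D m)"
  using assms(1) W(1)
proof (induction m arbitrary: n F)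
  \<comment> \<open>The unit ball of the smallest weight lies in all the others, so convergence on
    any level restricts to level 0, the only level in the conclusion.\<close>
  have sub: "wbdd M (W 0) 1 \<subseteq> wbdd M (W i) 1" if "\<And>x. x \<in> space M \<Longrightarrow> W 0 x \<le> W i x" for i
  proof
    fix g assume "g \<in> wbdd M (W 0) 1"
    then show "g \<in> wbdd M (W i) 1"
      by (rule wbdd_weight_mono[OF _ that]) simp_all
  qed
  {
    case (0 n F)
    have "wcont M (W 0) F"
      unfolding wcont_def
    proof (intro ballI conjI)
      fix u :: real assume u: "u \<in> {0..1}"
      from 0(1) have F: "wcont M (W n) F"
        by simp
      show "wfunctional M (W 0) (F u)"
        by (rule wfunctional_weight_mono[OF wcontD(1)[OF F u] W(2) 0(2)]) auto
      show "vanishes (wbdd M (W 0) 1) u (\<lambda>v g. F v g - F u g)"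
        by (rule uniform_limit_on_subset[OF wcontD(2)[OF F u] sub]) (rule 0(2)[OF order_refl])
    qed
    then show ?case
      by (intro exI[of _ "\<lambda>_. F"]) (auto simp: wcontD(1))
  next
    case (Suc m n F)
    from Suc.prems(1) obtain i F' where i: "n = Suc i" and F: "wcont M (W n) F" "wderiv M (W i) F F'"
        "smooth M W m i F'"
      by auto
    from Suc.IH[OF F(3)] Suc.prems(2) i
    obtain D where D: "D 0 = F'" "\<And>l u. l \<le> m \<Longrightarrow> u \<in> {0..1} \<Longrightarrow> wfunctional M (W 0) (D l u)"
        "\<And>l. l < m \<Longrightarrow> wderiv M (W 0) (D l) (D (Suc l))" "wcont M (W 0) (D m)"
      by auto
    have "wfunctional M (W 0) (F u)" if "u \<in> {0..1}" for u
      by (rule wfunctional_weight_mono[OF wcontD(1)[OF F(1) that] W(2) Suc.prems(2)]) auto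
    moreover have "wderiv M (W 0) F F'"
      using F(2) uniform_limit_on_subset[OF _ sub[of i]] Suc.prems(2) i by (auto simp: wderiv_def)
    ultimately show ?case
      using D by (intro exI[of _ "case_nat F D"]) (auto split: nat.split)
  }
qed

lemma tendsto_weighted_norm:
  assumes w: "\<And>x. x \<in> space M \<Longrightarrow> 1 \<le> w x" and G: "vanishes (wbdd M w 1) u G"
    and fG: "\<And>v. v \<in> {0..1} \<Longrightarrow> v \<noteq> u \<Longrightarrow> wfunctional M w (G v)"
  shows "((\<lambda>v. weighted_norm M w (\<lambda>A. G v (indicator A))) \<longlongrightarrow> 0) (at u within {0..1})"
proof (rule order_tendstoI)
  fix a :: ennreal assume "0 < a"
  then obtain e where e: "0 < e" "ennreal e < a"
    by (metis dense ennreal_cases infinity_ennreal_def ennreal_less_zero_iff not_less_iff_gr_or_eq top_greatest leD)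
  have *: "\<forall>\<^sub>F v in at u within {0..1}. v \<in> {0..1} \<and> v \<noteq> u"
    by (simp add: eventually_at_filter)
  show "\<forall>\<^sub>F v in at u within {0..1}. weighted_norm M w (\<lambda>A. G v (indicator A)) < a"
    using uniform_limitD[OF G e(1)] *
  proof eventually_elim
    case (elim v)
    have "weighted_norm M w (\<lambda>A. G v (indicator A)) \<le> ennreal e"
      using elim by (subst weighted_norm_wfunctional[OF fG w]) (auto intro!: SUP_least ennreal_leI)
    then show ?case
      using e(2) by simp
  qed
qed auto

lemma wfunctional_weighted_measures:
  assumes w: "\<And>x. x \<in> space M \<Longrightarrow> 1 \<le> w x" and L: "wfunctional M w L"
    and \<mu>: "\<And>A. A \<in> sets M \<Longrightarrow> \<mu> A = L (indicator A)"
  shows "\<mu> \<in> weighted_measures M w"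
proof -
  have "\<And>x. x \<in> space M \<Longrightarrow> 0 \<le> w x"
    using w by force
  then obtain b where b: "\<And>g c. 0 \<le> c \<Longrightarrow> g \<in> wbdd M w c \<Longrightarrow> \<bar>L g\<bar> \<le> b * c"
    using wfunctional_bounded[OF L] by metis
  have "weighted_norm M w \<mu> = weighted_norm M w (\<lambda>A. L (indicator A))"
    by (rule weighted_norm_cong) (rule \<mu>)
  also have "\<dots> \<le> ennreal b"
    using b[OF zero_le_one]
    by (subst weighted_norm_wfunctional[OF L w]) (auto intro!: SUP_least ennreal_leI intro: abs_le_D1)
  finally have "weighted_norm M w \<mu> < \<infinity>"
    by (simp add: le_less_trans)
  moreover have "signed_measure M \<mu>"
    unfolding signed_measure_def
  proof (intro allI impI)
    fix A :: "nat \<Rightarrow> 'a set" assume A: "range A \<subseteq> sets M" "disjoint_family A"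
    then show "(\<lambda>n. \<mu> (A n)) sums \<mu> (\<Union>n. A n)"
      using wfunctional_sums_disjoint[OF L w A] \<mu> by (simp add: range_subsetD sets.countable_UN)
  qed
  ultimately show ?thesis
    by (simp add: weighted_measures_def)
qed

lemma smooth_Ck_into_weighted_measures:
  assumes smooth: "smooth M W k k F"
    and W: "\<And>i x. i \<le> k \<Longrightarrow> x \<in> space M \<Longrightarrow> W 0 x \<le> W i x" "\<And>x. x \<in> space M \<Longrightarrow> 1 \<le> W 0 x"
    and \<mu>: "\<And>u A. u \<in> {0..1} \<Longrightarrow> A \<in> sets M \<Longrightarrow> \<mu> u A = F u (indicator A)"
  shows "Ck_into_weighted_measures k M (W 0) \<mu>"
proof -
  have W0: "\<And>x. x \<in> space M \<Longrightarrow> 0 \<le> W 0 x"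
    using W(2) by force
  obtain D where D: "D 0 = F" "\<And>l u. l \<le> k \<Longrightarrow> u \<in> {0..1} \<Longrightarrow> wfunctional M (W 0) (D l u)"
      "\<And>l. l < k \<Longrightarrow> wderiv M (W 0) (D l) (D (Suc l))" "wcont M (W 0) (D k)"
    using smooth_derivatives[OF smooth W(1) W0] by metis
  \<comment> \<open>The required curve must equal \<mu> as a function, also for u outside the
    interval and on non-measurable sets, where D 0 may differ from it. So the derivative of order 0
    is \<mu> itself.\<close>
  define E where "E l u A = (if l = 0 then \<mu> u A else D l u (indicator A))" for l u A
  have E: "E l u A = D l u (indicator A)" if "u \<in> {0..1}" "A \<in> sets M" for l u A
    using that \<mu> D(1) by (simp add: E_def)
  have "E l u \<in> weighted_measures M (W 0)" if "l \<le> k" "u \<in> {0..1}" for l u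
    by (rule wfunctional_weighted_measures[OF W(2) D(2)[OF that]]) (use E that in auto)
  moreover have "((\<lambda>v. weighted_norm M (W 0) (\<lambda>A. (E l v A - E l u A) / (v - u) - E (Suc l) u A)) \<longlongrightarrow> 0)
      (at u within {0..1})" if l: "l < k" and u: "u \<in> {0..1}" for l u
  proof (rule Lim_transform_eventually)
    show "((\<lambda>v. weighted_norm M (W 0) (\<lambda>A. (D l v (indicator A) - D l u (indicator A)) / (v - u) - D (Suc l) u (indicator A)))
        \<longlongrightarrow> 0) (at u within {0..1})"
    proof (rule tendsto_weighted_norm[OF W(2) wderivD[OF D(3)[OF l] u]])
      fix v :: real assume v: "v \<in> {0..1}"
      show "wfunctional M (W 0) (\<lambda>g. (D l v g - D l u g) / (v - u) - D (Suc l) u g)"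
        using l u v by (intro wfunctional_difference wfunctional_divide D(2)) auto
    qed
    show "\<forall>\<^sub>F v in at u within {0..1}.
        weighted_norm M (W 0) (\<lambda>A. (D l v (indicator A) - D l u (indicator A)) / (v - u) - D (Suc l) u (indicator A))
        = weighted_norm M (W 0) (\<lambda>A. (E l v A - E l u A) / (v - u) - E (Suc l) u A)"
      using E u by (auto simp: eventually_at_filter intro!: always_eventually weighted_norm_cong)
  qed
  moreover have "((\<lambda>v. weighted_norm M (W 0) (\<lambda>A. E k v A - E k u A)) \<longlongrightarrow> 0) (at u within {0..1})"
    if u: "u \<in> {0..1}" for u
  proof (rule Lim_transform_eventually)
    show "((\<lambda>v. weighted_norm M (W 0) (\<lambda>A. D k v (indicator A) - D k u (indicator A))) \<longlongrightarrow> 0)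
        (at u within {0..1})"
    proof (rule tendsto_weighted_norm[OF W(2) wcontD(2)[OF D(4) u]])
      fix v :: real assume v: "v \<in> {0..1}"
      show "wfunctional M (W 0) (\<lambda>g. D k v g - D k u g)"
        by (intro wfunctional_difference D(2) order_refl v u)
    qed
    show "\<forall>\<^sub>F v in at u within {0..1}. weighted_norm M (W 0) (\<lambda>A. D k v (indicator A) - D k u (indicator A))
        = weighted_norm M (W 0) (\<lambda>A. E k v A - E k u A)"
      using E u by (auto simp: eventually_at_filter intro!: always_eventually weighted_norm_cong)
  qed
  moreover have "E 0 = \<mu>"
    by (simp add: E_def fun_eq_iff)
  ultimately show ?thesis
    unfolding Ck_into_weighted_measures_def Ck_measure_derivs_def by (intro exI[of _ E]) auto
qed

subsection \<open>Poisson equation\<close>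

text \<open>Every point of the unit interval is a limit point of it, so limits are unique. Applied
  to derivatives of quantities that do not depend on v, such as total masses.\<close>

lemma vanishes_constD:
  assumes "vanishes S u G" "u \<in> {0..1}" "g \<in> S" "\<And>v. v \<in> {0..1} \<Longrightarrow> v \<noteq> u \<Longrightarrow> G v g = a"
  shows "a = 0"
proof -
  have nontriv: "at u within {0..1} \<noteq> bot"
    using assms(2) by (simp add: trivial_limit_within islimpt_Icc)
  have "((\<lambda>v. G v g) \<longlongrightarrow> 0) (at u within {0..1})"
    using tendsto_uniform_limitI[OF assms(1,3)] .
  moreover have "((\<lambda>v. G v g) \<longlongrightarrow> a) (at u within {0..1})"
    by (rule tendsto_eventually) (use assms(4) in \<open>auto simp: eventually_at_filter\<close>)
  ultimately show ?thesis
    using tendsto_unique[OF nontriv] by blast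
qed

text \<open>Ergodicity on each level, with constants that depend on the level but not on u, is what
  lets the potential act on every level without loss of weight.\<close>

locale ergodic_family = operator_family k M M V V T C
  for k and M :: "'a measure" and V T C +
  fixes \<pi> :: "real \<Rightarrow> ('a \<Rightarrow> real) \<Rightarrow> real"
  assumes \<pi>_wfunctional: "n \<le> k \<Longrightarrow> u \<in> {0..1} \<Longrightarrow> wfunctional M (V n) (\<pi> u)"
    and \<pi>_one: "u \<in> {0..1} \<Longrightarrow> \<pi> u (\<lambda>_. 1) = 1"
    and T_one: "u \<in> {0..1} \<Longrightarrow> x \<in> space M \<Longrightarrow> T 0 u (\<lambda>_. 1) x = 1"
    and \<pi>_invariant: "n \<le> k \<Longrightarrow> u \<in> {0..1} \<Longrightarrow> g \<in> wbdd M (V n) c \<Longrightarrow> \<pi> u (T 0 u g) = \<pi> u g"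
    and ergodic: "n \<le> k \<Longrightarrow> \<exists>\<kappa>\<in>{0<..<1}. \<exists>K. \<forall>\<^sub>F m in sequentially. \<forall>u\<in>{0..1}. \<forall>g\<in>wbdd M (V n) 1.
      \<forall>x\<in>space M. \<bar>(T 0 u ^^ m) g x - \<pi> u g\<bar> \<le> K * \<kappa> ^ m * V n x"
begin

abbreviation P :: "real \<Rightarrow> ('a \<Rightarrow> real) \<Rightarrow> 'a \<Rightarrow> real" where
  "P \<equiv> T 0"

abbreviation bd :: "nat \<Rightarrow> real \<Rightarrow> ('a \<Rightarrow> real) set" where
  "bd n \<equiv> wbdd M (V n)"

text \<open>Inverts \<open>1 - P u\<close> modulo constants.\<close>

definition potential :: "real \<Rightarrow> ('a \<Rightarrow> real) \<Rightarrow> 'a \<Rightarrow> real" where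
  "potential u g x = (\<Sum>m. (P u ^^ m) g x - \<pi> u g)"

lemma one_wbdd: "n \<le> k \<Longrightarrow> (\<lambda>_. 1) \<in> bd n 1"
  using W_ge_1 by (auto simp: wbdd_def)

lemma const_wbdd: "n \<le> k \<Longrightarrow> (\<lambda>_. a) \<in> bd n \<bar>a\<bar>"
  using wbdd_scale[OF one_wbdd, of n a] by simp

lemma T0_wbdd: "n \<le> k \<Longrightarrow> u \<in> {0..1} \<Longrightarrow> 0 \<le> c \<Longrightarrow> g \<in> bd n c \<Longrightarrow> P u g \<in> bd n (C * c)"
  using T_wbdd[of n 0] by simp

lemma T0_wfunctional: "n \<le> k \<Longrightarrow> u \<in> {0..1} \<Longrightarrow> x \<in> space M \<Longrightarrow> wfunctional M (V n) (\<lambda>g. P u g x)"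
  using T_wfunctional[of n 0] by simp

lemma T0_power_wbdd:
  assumes "n \<le> k" "u \<in> {0..1}" "0 \<le> c" "g \<in> bd n c"
  shows "(P u ^^ m) g \<in> bd n (C ^ m * c)"
proof (induction m)
  case (Suc m)
  then show ?case
    using T0_wbdd[OF assms(1,2) _ Suc] C_nonneg assms(3) by (simp add: mult.assoc)
qed (use assms in simp)

lemma T0_power_wfunctional:
  assumes "n \<le> k" "u \<in> {0..1}" "x \<in> space M"
  shows "wfunctional M (V n) (\<lambda>g. (P u ^^ m) g x)"
  using assms(3)
proof (induction m arbitrary: x)
  case 0
  then show ?case
    by (auto simp: wfunctional_def)
next
  case (Suc m)
  have "wfunctional M (V n) (\<lambda>g. P u ((P u ^^ m) g) x)"
    by (rule wfunctional_compose[OF T0_wfunctional[OF assms(1,2) Suc.prems], where C="C ^ m"])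
       (use W_nonneg T0_power_wbdd Suc.IH assms in auto)
  then show ?case by simp
qed

text \<open>The asymptotic bound is made valid for all m, with constants uniform in u, at the price
  of a larger K. For m below the threshold N the boundedness of \<open>P u\<close> suffices.\<close>

lemma geometric_ergodicity:
  assumes n: "n \<le> k"
  obtains K \<kappa> where "0 \<le> K" "0 < \<kappa>" "\<kappa> < 1"
    "\<And>u g c x m. u \<in> {0..1} \<Longrightarrow> 0 \<le> c \<Longrightarrow> g \<in> bd n c \<Longrightarrow> x \<in> space M \<Longrightarrow>
      \<bar>(P u ^^ m) g x - \<pi> u g\<bar> \<le> c * (K * V n x) * \<kappa> ^ m"
proof -
  obtain \<kappa> K0 N where \<kappa>: "0 < \<kappa>" "\<kappa> < 1" and K0: "\<And>m u g x. N \<le> m \<Longrightarrow> u \<in> {0..1} \<Longrightarrow> g \<in> bd n 1 \<Longrightarrow>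
      x \<in> space M \<Longrightarrow> \<bar>(P u ^^ m) g x - \<pi> u g\<bar> \<le> K0 * \<kappa> ^ m * V n x"
  proof -
    from ergodic[OF n] obtain \<kappa> K N where "\<kappa> \<in> {0<..<1}" "\<forall>m\<ge>N. \<forall>u\<in>{0..1}. \<forall>g\<in>bd n 1.
        \<forall>x\<in>space M. \<bar>(P u ^^ m) g x - \<pi> u g\<bar> \<le> K * \<kappa> ^ m * V n x"
      unfolding eventually_sequentially by blast
    then show ?thesis
      by (intro that[of \<kappa> N K]) auto
  qed
  \<comment> \<open>Dominates \<open>C ^ m\<close> for all m \<le> N, whether C is below or above
    1.\<close>
  define D where "D = max C 1 ^ N"
  \<comment> \<open>Division by \<open>\<kappa> ^ N\<close> compensates for the factor
    \<open>\<kappa> ^ m\<close>, which is at least \<open>\<kappa> ^ N\<close> when m \<le>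
    N.\<close>
  define K where "K = \<bar>K0\<bar> + (2 * D + \<bar>K0\<bar>) / \<kappa> ^ N"
  have D: "1 \<le> D" "\<And>m. m \<le> N \<Longrightarrow> C ^ m \<le> D"
  proof -
    fix m assume "m \<le> N"
    have "C ^ m \<le> max C 1 ^ m"
      using C_nonneg by (intro power_mono) auto
    also have "\<dots> \<le> D"
      unfolding D_def using \<open>m \<le> N\<close> by (intro power_increasing) auto
    finally show "C ^ m \<le> D" .
  qed (simp add: D_def)
  have K: "0 \<le> K"
    unfolding K_def using \<kappa> D(1) by (intro add_nonneg_nonneg divide_nonneg_nonneg) auto
  have unit: "\<bar>(P u ^^ m) g x - \<pi> u g\<bar> \<le> K * \<kappa> ^ m * V n x"
    if u: "u \<in> {0..1}" and g: "g \<in> bd n 1" and x: "x \<in> space M" for u g x m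
  proof -
    note V = W_nonneg[OF n x]
    show ?thesis
    proof (cases "N \<le> m")
      case True
      have "K0 * \<kappa> ^ m * V n x \<le> K * \<kappa> ^ m * V n x"
        unfolding K_def using V \<kappa> D(1) by (intro mult_right_mono) (auto simp: add_increasing2)
      with K0[OF True u g x] show ?thesis by simp
    next
      case False
      have pow: "\<bar>(P u ^^ i) g x\<bar> \<le> D * V n x" if "i \<le> N" for i
      proof -
        have "\<bar>(P u ^^ i) g x\<bar> \<le> C ^ i * V n x"
          using wbddD[OF T0_power_wbdd[OF n u _ g] x, of i] by simp
        also have "\<dots> \<le> D * V n x"
          using D(2)[OF that] V by (intro mult_right_mono)
        finally show ?thesis .
      qed
      have "K0 * \<kappa> ^ N * V n x \<le> \<bar>K0\<bar> * 1 * V n x"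
        using V \<kappa> by (intro mult_right_mono mult_mono) (auto simp: power_le_one)
      \<comment> \<open>A bound on \<open>\<pi> u g\<close> uniform in u is obtained by comparison
        with the N-th iterate, for which the ergodic bound already holds. This explains the second
        \<open>D\<close> and the summand \<open>\<bar>K0\<bar>\<close>.\<close>
      then have "\<bar>(P u ^^ m) g x - \<pi> u g\<bar> \<le> (2 * D + \<bar>K0\<bar>) * V n x"
        using K0[OF order_refl u g x] pow[of m] pow[of N] False by (simp add: distrib_right)
      also have "\<dots> \<le> K * \<kappa> ^ m * V n x"
      proof (rule mult_right_mono[OF _ V])
        have "(2 * D + \<bar>K0\<bar>) = (2 * D + \<bar>K0\<bar>) / \<kappa> ^ N * \<kappa> ^ N"
          using \<kappa> by simp
        also have "\<dots> \<le> K * \<kappa> ^ m"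
          unfolding K_def using \<kappa> False D(1) by (intro mult_mono power_decreasing) auto
        finally show "2 * D + \<bar>K0\<bar> \<le> K * \<kappa> ^ m" .
      qed
      finally show ?thesis .
    qed
  qed
  show thesis
  proof
    fix u c :: real and g x m
    assume u: "u \<in> {0..1}" and c: "0 \<le> c" and g: "g \<in> bd n c" and x: "x \<in> space M"
    have L: "wfunctional M (V n) (\<lambda>g. (P u ^^ m) g x - \<pi> u g)"
      using wfunctional_difference[OF T0_power_wfunctional[OF n u x] \<pi>_wfunctional[OF n u]] .
    show "\<bar>(P u ^^ m) g x - \<pi> u g\<bar> \<le> c * (K * V n x) * \<kappa> ^ m"
      using wfunctional_bound_scale[OF L W_nonneg[OF n] unit[OF u _ x] c g] by (simp add: mult_ac)
  qed (use \<kappa> K in auto)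
qed

lemma potential_summable:
  assumes "n \<le> k" "u \<in> {0..1}" "g \<in> bd n c" "x \<in> space M"
  shows "summable (\<lambda>m. (P u ^^ m) g x - \<pi> u g)"
proof -
  obtain K \<kappa> where K: "0 < \<kappa>" "\<kappa> < 1" "\<And>u g c x m. u \<in> {0..1} \<Longrightarrow> 0 \<le> c \<Longrightarrow> g \<in> bd n c \<Longrightarrow> x \<in> space M \<Longrightarrow>
      \<bar>(P u ^^ m) g x - \<pi> u g\<bar> \<le> c * (K * V n x) * \<kappa> ^ m"
    using geometric_ergodicity[OF assms(1)] by metis
  have g: "g \<in> bd n \<bar>c\<bar>"
    by (rule wbdd_mono[OF assms(3)]) (use W_nonneg assms in auto)
  show ?thesis
    by (rule summable_comparison_test'[where g="\<lambda>m. \<bar>c\<bar> * (K * V n x) * \<kappa> ^ m" and N=0])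
       (use K assms g in \<open>auto intro!: summable_mult summable_geometric\<close>)
qed

text \<open>\<open>B\<close> comes from the geometric series. The partial sums obey the same bound,
  so that functionals can be applied to the series term by term.\<close>

lemma potential_bound:
  assumes n: "n \<le> k"
  obtains B where "0 \<le> B"
    "\<And>u g c. u \<in> {0..1} \<Longrightarrow> 0 \<le> c \<Longrightarrow> g \<in> bd n c \<Longrightarrow> potential u g \<in> bd n (B * c)"
    "\<And>u g c N. u \<in> {0..1} \<Longrightarrow> 0 \<le> c \<Longrightarrow> g \<in> bd n c \<Longrightarrow>
      (\<lambda>x. \<Sum>m<N. (P u ^^ m) g x - \<pi> u g) \<in> bd n (B * c)"
proof -
  obtain K \<kappa> where K0: "0 \<le> K" and \<kappa>: "0 < \<kappa>" "\<kappa> < 1"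
    and K: "\<And>u g c x m. u \<in> {0..1} \<Longrightarrow> 0 \<le> c \<Longrightarrow> g \<in> bd n c \<Longrightarrow> x \<in> space M \<Longrightarrow>
      \<bar>(P u ^^ m) g x - \<pi> u g\<bar> \<le> c * (K * V n x) * \<kappa> ^ m"
    using geometric_ergodicity[OF n] by metis
  define B where "B = K * (1 / (1 - \<kappa>))"
  have partial: "(\<lambda>x. \<Sum>m<N. (P u ^^ m) g x - \<pi> u g) \<in> bd n (B * c)"
    if u: "u \<in> {0..1}" and c: "0 \<le> c" and g: "g \<in> bd n c" for u g c N
  proof (rule wbddI)
    show "(\<lambda>x. \<Sum>m<N. (P u ^^ m) g x - \<pi> u g) \<in> borel_measurable M"
      using wbdd_measurable[OF T0_power_wbdd[OF n u c g]] by measurable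
    fix x assume x: "x \<in> space M"
    have "\<bar>\<Sum>m<N. (P u ^^ m) g x - \<pi> u g\<bar> \<le> (\<Sum>m<N. \<bar>(P u ^^ m) g x - \<pi> u g\<bar>)"
      by (rule sum_abs)
    also have "\<dots> \<le> (\<Sum>m<N. c * (K * V n x) * \<kappa> ^ m)"
      by (rule sum_mono) (rule K[OF u c g x])
    also have "\<dots> = c * (K * V n x) * (\<Sum>m<N. \<kappa> ^ m)"
      by (simp add: sum_distrib_left)
    also have "\<dots> \<le> c * (K * V n x) * (1 / (1 - \<kappa>))"
    proof (rule mult_left_mono)
      show "(\<Sum>m<N. \<kappa> ^ m) \<le> 1 / (1 - \<kappa>)"
        using sum_le_suminf[OF summable_geometric, of \<kappa> "{..<N}"] suminf_geometric[of \<kappa>] \<kappa> by simp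
      show "0 \<le> c * (K * V n x)"
        using c K0 W_nonneg[OF n x] by simp
    qed
    finally show "\<bar>\<Sum>m<N. (P u ^^ m) g x - \<pi> u g\<bar> \<le> B * c * V n x"
      by (simp add: B_def mult_ac)
  qed
  show thesis
  proof
    show "0 \<le> B"
      using K0 \<kappa> by (simp add: B_def)
    show "potential u g \<in> bd n (B * c)"
      if "u \<in> {0..1}" "0 \<le> c" "g \<in> bd n c" for u g c
      by (rule wbdd_limit[OF partial[OF that]])
         (unfold potential_def, rule summable_LIMSEQ[OF potential_summable[OF n that(1,3)]])
  qed (rule partial)
qed

text \<open>Each term of the series is a functional of g, and the geometric majorant is the same for
  all functions in a ball; Tannery's theorem then exchanges the limit with the sum.\<close>

lemma potential_wfunctional:
  assumes n: "n \<le> k" and u: "u \<in> {0..1}" and x: "x \<in> space M"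
  shows "wfunctional M (V n) (\<lambda>g. potential u g x)"
  unfolding wfunctional_def
proof (intro conjI allI impI)
  have L: "wfunctional M (V n) (\<lambda>g. (P u ^^ m) g x - \<pi> u g)" for m
    using wfunctional_difference[OF T0_power_wfunctional[OF n u x] \<pi>_wfunctional[OF n u]] .
  {
    fix c f g assume fg: "f \<in> bd n c" "g \<in> bd n c"
    show "potential u (\<lambda>x. f x + g x) x = potential u f x + potential u g x"
      using suminf_add[OF potential_summable[OF n u fg(1) x] potential_summable[OF n u fg(2) x]]
        wfunctional_add[OF L W_nonneg[OF n] fg] by (simp add: potential_def)
  next
    fix c a f assume f: "f \<in> bd n c"
    show "potential u (\<lambda>x. a * f x) x = a * potential u f x"
      using suminf_mult[OF potential_summable[OF n u f x]] wfunctional_scale[OF L f]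
      by (simp add: potential_def)
  next
    fix c h g assume h: "\<forall>i. h i \<in> bd n c" and g: "g \<in> bd n c"
      and lim: "\<forall>x\<in>space M. (\<lambda>i::nat. h i x) \<longlonglongrightarrow> g x"
    obtain K \<kappa> where K: "0 < \<kappa>" "\<kappa> < 1" "\<And>u g c x m. u \<in> {0..1} \<Longrightarrow> 0 \<le> c \<Longrightarrow> g \<in> bd n c \<Longrightarrow> x \<in> space M \<Longrightarrow>
        \<bar>(P u ^^ m) g x - \<pi> u g\<bar> \<le> c * (K * V n x) * \<kappa> ^ m"
      using geometric_ergodicity[OF n] by metis
    have h': "h i \<in> bd n \<bar>c\<bar>" for i
      using h W_nonneg[OF n] by (auto intro: wbdd_mono)
    show "(\<lambda>i. potential u (h i) x) \<longlonglongrightarrow> potential u g x"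
      unfolding potential_def
    proof (rule conjunct2[OF conjunct2[OF tannerys_theorem]])
      show "((\<lambda>i. (P u ^^ m) (h i) x - \<pi> u (h i)) \<longlonglongrightarrow> (P u ^^ m) g x - \<pi> u g)" for m
        by (rule wfunctional_limit[OF L]) (use h lim in auto)
      show "\<forall>\<^sub>F (m, i) in at_top \<times>\<^sub>F sequentially.
          norm ((P u ^^ m) (h i) x - \<pi> u (h i)) \<le> \<bar>c\<bar> * (K * V n x) * \<kappa> ^ m"
        using K(3)[OF u abs_ge_zero h' x] by (intro always_eventually) auto
      show "summable (\<lambda>m. \<bar>c\<bar> * (K * V n x) * \<kappa> ^ m)"
        using K by (intro summable_mult summable_geometric) auto
    qed simp
  }
qed

lemma potential_partial_sums:
  assumes n: "n \<le> k" and u: "u \<in> {0..1}" and g: "g \<in> bd n c" and x: "x \<in> space M"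
  shows "(\<lambda>N. \<Sum>m<N. (P u ^^ m) g x - (P u ^^ Suc m) g x) \<longlonglongrightarrow> g x - \<pi> u g"
proof -
  have "(\<lambda>N. (P u ^^ N) g x) \<longlonglongrightarrow> \<pi> u g"
    using summable_LIMSEQ_zero[OF potential_summable[OF n u g x]] by (rule LIM_zero_cancel)
  then have "(\<lambda>N. g x - (P u ^^ N) g x) \<longlonglongrightarrow> g x - \<pi> u g"
    by (intro tendsto_intros)
  moreover have "(\<Sum>m<N. (P u ^^ m) g x - (P u ^^ Suc m) g x) = g x - (P u ^^ N) g x" for N
    using sum_lessThan_telescope'[of "\<lambda>m. (P u ^^ m) g x" N] by simp
  ultimately show ?thesis by simp
qed

text \<open>By invariance \<open>g - P u g\<close> has mean 0 under \<pi> u, so the centring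
  disappears and the series telescopes.\<close>

lemma potential_resolvent_right:
  assumes n: "n \<le> k" and u: "u \<in> {0..1}" and g: "g \<in> bd n c" and x: "x \<in> space M"
  shows "potential u (\<lambda>x. g x - P u g x) x = g x - \<pi> u g"
proof -
  have g': "g \<in> bd n \<bar>c\<bar>"
    by (rule wbdd_mono[OF g]) (use W_nonneg[OF n] in auto)
  note Tg = T0_wbdd[OF n u abs_ge_zero g']
  have "(P u ^^ m) (\<lambda>x. g x - P u g x) x - \<pi> u (\<lambda>x. g x - P u g x)
      = (P u ^^ m) g x - (P u ^^ Suc m) g x" for m
    using wfunctional_diff[OF T0_power_wfunctional[OF n u x] W_nonneg[OF n] g Tg, of m]
      wfunctional_diff[OF \<pi>_wfunctional[OF n u] W_nonneg[OF n] g Tg] \<pi>_invariant[OF n u g]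
    by (simp add: funpow_swap1)
  then show ?thesis
    using potential_partial_sums[OF assms] by (simp add: potential_def sums_def sums_unique[symmetric] del: funpow.simps)
qed

text \<open>Here \<open>P u\<close> has to pass under the infinite sum, by continuity along the
  bounded partial sums. Since it fixes constants, the centring terms cancel and the difference
  telescopes.\<close>

lemma potential_resolvent_left:
  assumes n: "n \<le> k" and u: "u \<in> {0..1}" and g: "g \<in> bd n c" and x: "x \<in> space M"
  shows "potential u g x - P u (potential u g) x = g x - \<pi> u g"
proof -
  have g': "g \<in> bd n \<bar>c\<bar>"
    by (rule wbdd_mono[OF g]) (use W_nonneg[OF n] in auto)
  obtain B where B: "\<And>N. (\<lambda>x. \<Sum>m<N. (P u ^^ m) g x - \<pi> u g) \<in> bd n (B * \<bar>c\<bar>)"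
    using potential_bound[OF n] u abs_ge_zero g' by metis
  note L = T0_wfunctional[OF n u x]
  define Z where "Z N x = (\<Sum>m<N. (P u ^^ m) g x - \<pi> u g)" for N x
  have Z: "(\<lambda>N. Z N y) \<longlonglongrightarrow> potential u g y" if "y \<in> space M" for y
    unfolding Z_def potential_def by (rule summable_LIMSEQ[OF potential_summable[OF n u g that]])
  have "(\<lambda>N. P u (Z N) x) \<longlonglongrightarrow> P u (potential u g) x"
    by (rule wfunctional_limit[OF L B[folded Z_def] Z])
  moreover have "P u (Z N) x = (\<Sum>m<N. (P u ^^ Suc m) g x - \<pi> u g)" for N
  proof -
    note pow = T0_power_wbdd[OF n u abs_ge_zero g']
    have "P u (\<lambda>x. (P u ^^ m) g x - \<pi> u g) x = (P u ^^ Suc m) g x - \<pi> u g" for m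
      using wfunctional_diff[OF L W_nonneg[OF n] pow const_wbdd[OF n], of m "\<pi> u g"]
        wfunctional_scale[OF L one_wbdd[OF n], of "\<pi> u g"] T_one[OF u x] by simp
    then show ?thesis
      unfolding Z_def
      using conjunct2[OF wfunctional_finite_sum[OF L W_nonneg[OF n] finite_lessThan wbdd_diff[OF pow const_wbdd[OF n]]]]
      by simp
  qed
  ultimately have "(\<lambda>N. Z N x - (\<Sum>m<N. (P u ^^ Suc m) g x - \<pi> u g))
      \<longlonglongrightarrow> potential u g x - P u (potential u g) x"
    using Z[OF x] by (auto intro: tendsto_diff)
  moreover have "Z N x - (\<Sum>m<N. (P u ^^ Suc m) g x - \<pi> u g)
      = (\<Sum>m<N. (P u ^^ m) g x - (P u ^^ Suc m) g x)" for N
    unfolding Z_def sum_subtractf[symmetric] by simp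
  ultimately show ?thesis
    using LIMSEQ_unique[OF _ potential_partial_sums[OF assms]] by simp
qed

lemma potential_one:
  assumes u: "u \<in> {0..1}" and x: "x \<in> space M"
  shows "potential u (\<lambda>_. 1) x = 0"
proof -
  have "(P u ^^ m) (\<lambda>_. 1) x = 1" if "x \<in> space M" for m x
    using that
  proof (induction m arbitrary: x)
    case (Suc m)
    have "P u ((P u ^^ m) (\<lambda>_. 1)) x = P u (\<lambda>_. 1) x"
      by (rule wfunctional_cong[OF T0_wfunctional[OF le0 u Suc.prems] T0_power_wbdd[OF le0 u zero_le_one one_wbdd[OF le0]]])
         (rule Suc.IH)
    then show ?case
      using T_one[OF u Suc.prems] by simp
  qed simp
  then show ?thesis
    by (simp add: potential_def \<pi>_one[OF u] x)
qed

section \<open>Centred solutions of the dual Poisson equation\<close>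

lemma solution_wfunctional:
  assumes "n \<le> k" "u \<in> {0..1}" "wfunctional M (V n) R"
  shows "wfunctional M (V n) (\<lambda>g. R (potential u g))"
proof -
  obtain B where B: "\<And>g c. 0 \<le> c \<Longrightarrow> g \<in> bd n c \<Longrightarrow> potential u g \<in> bd n (B * c)"
    using potential_bound[OF assms(1)] assms(2) by metis
  show ?thesis
    by (rule wfunctional_compose[OF assms(3) _ _ B]) (use assms W_nonneg potential_wfunctional in auto)
qed

lemma wfunctional_centered:
  assumes n: "n \<le> k" and R: "wfunctional M (V n) R" "R (\<lambda>_. 1) = 0" and g: "g \<in> bd n c"
  shows "R (\<lambda>x. g x - a) = R g"
  using wfunctional_diff[OF R(1) W_nonneg[OF n] g const_wbdd[OF n, of a]]
    wfunctional_scale[OF R(1) one_wbdd[OF n], of a] R(2) by simp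

text \<open>The right inverse is off by the constant \<open>\<pi> u g\<close>, which a centred
  \<open>R\<close> annihilates. Hence \<open>R\<close> composed with the potential solves the
  equation.\<close>

lemma solution_eq:
  assumes n: "n \<le> k" and u: "u \<in> {0..1}" and R: "wfunctional M (V n) R" "R (\<lambda>_. 1) = 0"
    and g: "g \<in> bd n c"
  shows "R (potential u (\<lambda>x. g x - P u g x)) = R g"
proof -
  have "R (\<lambda>x. g x - \<pi> u g) = R (potential u (\<lambda>x. g x - P u g x))"
    by (rule wfunctional_cong[OF R(1) wbdd_diff[OF g const_wbdd[OF n]]])
       (rule potential_resolvent_right[OF n u g, symmetric])
  then show ?thesis
    using wfunctional_centered[OF n R g] by simp
qed

lemma solution_one:
  assumes n: "n \<le> k" and u: "u \<in> {0..1}" and R: "wfunctional M (V n) R"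
  shows "R (potential u (\<lambda>_. 1)) = 0"
proof -
  have "R (\<lambda>_. 0) = R (potential u (\<lambda>_. 1))"
    by (rule wfunctional_cong[OF R, of _ 0]) (use potential_one[OF u] in \<open>auto simp: wbdd_def\<close>)
  then show ?thesis
    using wfunctional_zero[OF R W_nonneg[OF n]] by simp
qed

text \<open>The parameter v is unrelated to \<open>R\<close>: a functional that belongs to u can be
  tested through \<open>1 - P v\<close>. This is how different parameters are compared.\<close>

lemma centered_eq_resolvent:
  assumes n: "n \<le> k" and v: "v \<in> {0..1}" and R: "wfunctional M (V n) R" "R (\<lambda>_. 1) = 0"
    and g: "g \<in> bd n c"
  shows "R g = R (\<lambda>x. potential v g x - P v (potential v g) x)"
proof -
  have "R (\<lambda>x. g x - \<pi> v g) = R (\<lambda>x. potential v g x - P v (potential v g) x)"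
    by (rule wfunctional_cong[OF R(1) wbdd_diff[OF g const_wbdd[OF n]]])
       (rule potential_resolvent_left[OF n v g, symmetric])
  then show ?thesis
    using wfunctional_centered[OF n R g] by simp
qed

text \<open>The test function \<open>potential v g\<close> moves with v but stays in a fixed
  multiple of the unit ball, and convergence of \<open>P v\<close> to \<open>P u\<close> at x is
  uniform there.\<close>

lemma potential_T_difference_vanishes:
  assumes n: "n \<le> k" and u: "u \<in> {0..1}" and L: "wfunctional M (V n) L"
  shows "vanishes (bd n 1) u (\<lambda>v g. L (\<lambda>x. P v (potential v g) x - P u (potential v g) x))"
proof -
  obtain B where B: "0 \<le> B"
    "\<And>u g. u \<in> {0..1} \<Longrightarrow> g \<in> bd n 1 \<Longrightarrow> potential u g \<in> bd n B"
    using potential_bound[OF n] by (metis mult.right_neutral zero_le_one)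
  have "vanishes (bd n 1) u (\<lambda>v g. P v (potential v g) x - P u (potential v g) x)"
    if x: "x \<in> space M" for x
    by (rule vanishes_compose_wfunctional[OF T_cont[of n 0 u x]])
       (use n u x B W_nonneg T0_wfunctional in \<open>auto intro!: wfunctional_difference\<close>)
  moreover have "(\<lambda>x. P v (potential v g) x - P u (potential v g) x) \<in> bd n (C * B + C * B)"
    if "v \<in> {0..1}" "g \<in> bd n 1" for v g
    by (intro wbdd_diff T0_wbdd n u that B)
  ultimately show ?thesis
    by (intro wfunctional_vanishes[OF L])
qed

text \<open>
  With \<open>h = potential v g\<close>, which is dominated uniformly in \<open>v\<close>, the increment of the solution
  \<open>\<mu> u g = R u (potential u g)\<close> is \<open>(R v - R u) h + \<mu> u ((P v - P u) h)\<close>.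
\<close>

lemma solution_increment:
  assumes n: "n \<le> k" and u: "u \<in> {0..1}" and v: "v \<in> {0..1}"
    and Ru: "wfunctional M (V n) (R u)" "R u (\<lambda>_. 1) = 0" and Rv: "wfunctional M (V n) (R v)" "R v (\<lambda>_. 1) = 0"
    and g: "g \<in> bd n 1"
  shows "R v (potential v g) - R u (potential u g) = R v (potential v g) - R u (potential v g)
    + R u (potential u (\<lambda>x. P v (potential v g) x - P u (potential v g) x))"
proof -
  define h where "h = potential v g"
  define \<mu> where "\<mu> g = R u (potential u g)" for g
  obtain B where B: "0 \<le> B" "h \<in> bd n B"
    using potential_bound[OF n] v g unfolding h_def by (metis mult.right_neutral zero_le_one)
  have \<mu>: "wfunctional M (V n) \<mu>" "\<mu> (\<lambda>_. 1) = 0"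
    unfolding \<mu>_def using solution_wfunctional[OF n u Ru(1)] solution_one[OF n u Ru(1)] by auto
  note T = T0_wbdd[OF n u B] T0_wbdd[OF n v B]
  have "\<mu> g = \<mu> h - \<mu> (P v h)"
    using centered_eq_resolvent[OF n v \<mu> g] wfunctional_diff[OF \<mu>(1) W_nonneg[OF n] B(2) T(2)]
    by (simp add: h_def)
  moreover have "\<mu> h - \<mu> (P u h) = R u h"
    using solution_eq[OF n u Ru B(2)] wfunctional_diff[OF \<mu>(1) W_nonneg[OF n] B(2) T(1)]
    by (simp add: \<mu>_def)
  moreover have "\<mu> (\<lambda>x. P v h x - P u h x) = \<mu> (P v h) - \<mu> (P u h)"
    by (rule wfunctional_diff[OF \<mu>(1) W_nonneg[OF n] T(2,1)])
  ultimately show ?thesis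
    unfolding h_def \<mu>_def by simp
qed

lemma solution_wcont:
  assumes n: "n \<le> k" and R: "wcont M (V n) R" "\<And>u. u \<in> {0..1} \<Longrightarrow> R u (\<lambda>_. 1) = 0"
  shows "wcont M (V n) (\<lambda>u g. R u (potential u g))"
  unfolding wcont_def
proof (intro ballI conjI)
  fix u :: real assume u: "u \<in> {0..1}"
  note Ru = wcontD(1)[OF R(1)]
  show 1: "wfunctional M (V n) (\<lambda>g. R u (potential u g))"
    by (rule solution_wfunctional[OF n u Ru[OF u]])
  obtain B where B: "\<And>u g. u \<in> {0..1} \<Longrightarrow> g \<in> bd n 1 \<Longrightarrow> potential u g \<in> bd n B"
    using potential_bound[OF n] by (metis mult.right_neutral zero_le_one)
  have 2: "vanishes (bd n 1) u (\<lambda>v g. R v (potential v g) - R u (potential v g))"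
    by (rule vanishes_compose_wfunctional[OF wcontD(2)[OF R(1) u], where c=B])
       (use B W_nonneg n u in \<open>auto intro!: wfunctional_difference Ru\<close>)
  show "vanishes (bd n 1) u (\<lambda>v g. R v (potential v g) - R u (potential u g))"
  proof (rule vanishes_cong[OF vanishes_add[OF 2 potential_T_difference_vanishes[OF n u 1]]])
    fix v :: real and g assume v: "v \<in> {0..1}" and g: "g \<in> bd n 1"
    show "R v (potential v g) - R u (potential v g)
        + R u (potential u (\<lambda>x. P v (potential v g) x - P u (potential v g) x))
      = R v (potential v g) - R u (potential u g)"
      by (rule solution_increment[where R=R, OF n u v Ru[OF u] R(2)[OF u] Ru[OF v] R(2)[OF v] g, symmetric])
  qed
qed

text \<open>Put h = \<open>potential v g\<close>. As \<nu> solves the equation with right-hand side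
  R2, the value \<nu> g is R' u h + \<mu> (T' h) - \<nu> ((P v - P u) h), where T' is
  \<open>T (Suc 0) u\<close>. Subtracted from the divided increment of the solution, this leaves the
  quotient error of R at h, \<mu> of the quotient error of P at h, and \<nu> ((P v - P u) h). These
  are the three vanishing terms.\<close>

lemma solution_wderiv:
  assumes n: "n < k" and R: "wcont M (V (Suc n)) R" "\<And>u. u \<in> {0..1} \<Longrightarrow> R u (\<lambda>_. 1) = 0"
    and R': "wderiv M (V n) R R'" "\<And>u. u \<in> {0..1} \<Longrightarrow> wfunctional M (V n) (R' u)"
    and R2_def: "R2 = (\<lambda>u g. R' u g + R u (potential u (T (Suc 0) u g)))"
    and R2: "\<And>u. u \<in> {0..1} \<Longrightarrow> R2 u (\<lambda>_. 1) = 0" "\<And>u. u \<in> {0..1} \<Longrightarrow> wfunctional M (V n) (R2 u)"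
  shows "wderiv M (V n) (\<lambda>u g. R u (potential u g)) (\<lambda>u g. R2 u (potential u g))"
  unfolding wderiv_def
proof
  fix u :: real assume u: "u \<in> {0..1}"
  have n': "n \<le> k" "Suc n \<le> k" using n by auto
  note Ru1 = wcontD(1)[OF R(1)]
  have Ru: "wfunctional M (V n) (R u)" if "u \<in> {0..1}" for u
    by (rule wfunctional_level[OF Ru1[OF that]]) (use n in auto)
  define \<mu> where "\<mu> g = R u (potential u g)" for g
  define \<nu> where "\<nu> g = R2 u (potential u g)" for g
  have \<mu>1: "wfunctional M (V (Suc n)) \<mu>" and \<mu>: "wfunctional M (V n) \<mu>"
    unfolding \<mu>_def using solution_wfunctional[OF n'(2) u Ru1[OF u]] solution_wfunctional[OF n'(1) u Ru[OF u]] by auto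
  have \<nu>: "wfunctional M (V n) \<nu>" "\<nu> (\<lambda>_. 1) = 0"
    unfolding \<nu>_def using solution_wfunctional[OF n'(1) u R2(2)[OF u]] solution_one[OF n'(1) u R2(2)[OF u]] by auto
  obtain B where B: "0 \<le> B" "\<And>u g. u \<in> {0..1} \<Longrightarrow> g \<in> bd n 1 \<Longrightarrow> potential u g \<in> bd n B"
    using potential_bound[OF n'(1)] by (metis mult.right_neutral zero_le_one)
  have 1: "vanishes (bd n 1) u
      (\<lambda>v g. (R v (potential v g) - R u (potential v g)) / (v - u) - R' u (potential v g))"
    by (rule vanishes_compose_wfunctional[OF wderivD[OF R'(1) u], where c=B])
       (use B W_nonneg n u in \<open>auto intro!: wfunctional_difference wfunctional_divide Ru R'(2)\<close>)
  have quotient_vanishes: "vanishes (bd n 1) u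
      (\<lambda>v g. \<mu> (\<lambda>x. (P v g x - P u g x) / (v - u) - T (Suc 0) u g x))"
    by (rule wfunctional_vanishes[OF \<mu>1 T_difference_quotient[of n 0, simplified] T_deriv[of n 0, simplified]])
       (use n u in auto)
  have quotient: "\<mu> (\<lambda>x. (P v h x - P u h x) / (v - u) - T (Suc 0) u h x)
      = \<mu> (\<lambda>x. P v h x - P u h x) / (v - u) - \<mu> (T (Suc 0) u h)"
    if v: "v \<in> {0..1}" "v \<noteq> u" and h: "h \<in> bd n c" "0 \<le> c" for v h c
  proof -
    have T: "P v h \<in> bd n (C * c)" "P u h \<in> bd n (C * c)"
      using T0_wbdd n' u v h by auto
    have T1: "T (Suc 0) u h \<in> bd (Suc n) (C * c)"
      using T_wbdd[of n "Suc 0" u c h] n' u h by simp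
    \<comment> \<open>The bound depends on v, which is harmless: it only certifies that \<mu> is
      linear on these functions, and it is raised to the upper level to be compatible with
      \<open>T1\<close>.\<close>
    have "(\<lambda>x. (1 / (v - u)) * (P v h x - P u h x)) \<in> bd n (\<bar>1 / (v - u)\<bar> * (C * c + C * c))"
      by (rule wbdd_scale[OF wbdd_diff[OF T]])
    from wbdd_weight_mono[OF this W_Suc[OF n]]
    have "(\<lambda>x. (1 / (v - u)) * (P v h x - P u h x)) \<in> bd (Suc n) (\<bar>1 / (v - u)\<bar> * (C * c + C * c))"
      using C_nonneg h(2) by simp
    from wfunctional_diff[OF \<mu>1 W_nonneg[OF n'(2)] this T1]
    show ?thesis
      using wfunctional_scale[OF \<mu> wbdd_diff[OF T], of "1 / (v - u)"] by simp
  qed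
  \<comment> \<open>\<open>quotient_vanishes\<close> holds for a fixed unit ball of test functions.
    Homogeneity in h allows the moving functions \<open>potential v g\<close> to be
    inserted.\<close>
  have 2: "vanishes (bd n 1) u (\<lambda>v g. \<mu> (\<lambda>x. (P v (potential v g) x - P u (potential v g) x) / (v - u)
      - T (Suc 0) u (potential v g) x))"
  proof (rule vanishes_compose[OF quotient_vanishes, where c=B])
    fix v a h assume v: "v \<in> {0..1}" "v \<noteq> u" and h: "h \<in> bd n 1"
    have q: "(\<lambda>x. (P v h x - P u h x) / (v - u) - T (Suc 0) u h x) \<in> bd (Suc n) (2 * C)"
      using T_difference_quotient[of n 0 u v h] n u v h by simp
    have "\<mu> (\<lambda>x. a * ((P v h x - P u h x) / (v - u) - T (Suc 0) u h x))
      = \<mu> (\<lambda>x. (P v (\<lambda>x. a * h x) x - P u (\<lambda>x. a * h x) x) / (v - u) - T (Suc 0) u (\<lambda>x. a * h x) x)"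
    proof (rule wfunctional_cong[OF \<mu>1 wbdd_scale[OF q]])
      fix x assume x: "x \<in> space M"
      have "wfunctional M (V n) (\<lambda>g. T (Suc 0) u g x)"
        using T_wfunctional[of n "Suc 0" u x] n u x by simp
      from wfunctional_scale[OF this h] wfunctional_scale[OF T0_wfunctional[OF n'(1) _ x] h] u v(1)
      show "a * ((P v h x - P u h x) / (v - u) - T (Suc 0) u h x)
        = (P v (\<lambda>x. a * h x) x - P u (\<lambda>x. a * h x) x) / (v - u) - T (Suc 0) u (\<lambda>x. a * h x) x"
        by (simp add: right_diff_distrib diff_divide_distrib)
    qed
    then show "\<mu> (\<lambda>x. (P v (\<lambda>x. a * h x) x - P u (\<lambda>x. a * h x) x) / (v - u) - T (Suc 0) u (\<lambda>x. a * h x) x)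
      = a * \<mu> (\<lambda>x. (P v h x - P u h x) / (v - u) - T (Suc 0) u h x)"
      using wfunctional_scale[OF \<mu>1 q] by simp
  qed (use B W_nonneg n' in auto)
  show "vanishes (bd n 1) u
      (\<lambda>v g. (R v (potential v g) - R u (potential u g)) / (v - u) - R2 u (potential u g))"
  proof (rule vanishes_cong[OF vanishes_add[OF vanishes_add[OF 1 2] potential_T_difference_vanishes[OF n'(1) u \<nu>(1)]]])
    fix v g assume v: "v \<in> {0..1}" "v \<noteq> u" and g: "g \<in> bd n 1"
    define h where "h = potential v g"
    have h: "h \<in> bd n B"
      unfolding h_def using B v g by auto
    note T = T0_wbdd[OF n'(1) u B(1) h] T0_wbdd[OF n'(1) v(1) B(1) h]
    have "\<nu> g = \<nu> h - \<nu> (P v h)"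
      using centered_eq_resolvent[OF n'(1) v(1) \<nu> g] wfunctional_diff[OF \<nu>(1) W_nonneg[OF n'(1)] h T(2)]
      by (simp add: h_def)
    moreover have "\<nu> h - \<nu> (P u h) = R' u h + \<mu> (T (Suc 0) u h)"
      using solution_eq[OF n'(1) u R2(2)[OF u] R2(1)[OF u] h] wfunctional_diff[OF \<nu>(1) W_nonneg[OF n'(1)] h T(1)]
      by (simp add: \<nu>_def \<mu>_def R2_def)
    moreover have "\<nu> (\<lambda>x. P v h x - P u h x) = \<nu> (P v h) - \<nu> (P u h)"
      by (rule wfunctional_diff[OF \<nu>(1) W_nonneg[OF n'(1)] T(2,1)])
    moreover have "(R v h - \<mu> g) / (v - u) = (R v h - R u h) / (v - u) + \<mu> (\<lambda>x. P v h x - P u h x) / (v - u)"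
      unfolding h_def \<mu>_def
      by (subst solution_increment[where R=R, OF n'(1) u v(1) Ru[OF u] R(2)[OF u] Ru[OF v(1)] R(2)[OF v(1)] g])
         (rule add_divide_distrib)
    ultimately show "(R v (potential v g) - R u (potential v g)) / (v - u) - R' u (potential v g)
        + \<mu> (\<lambda>x. (P v (potential v g) x - P u (potential v g) x) / (v - u) - T (Suc 0) u (potential v g) x)
        + \<nu> (\<lambda>x. P v (potential v g) x - P u (potential v g) x)
      = (R v (potential v g) - R u (potential u g)) / (v - u) - R2 u (potential u g)"
      unfolding h_def[symmetric] quotient[OF v h B(1)] \<nu>_def[symmetric] \<mu>_def[symmetric]
      by linarith
  qed
qed

lemma T_Suc_0_one:
  assumes "0 < k" "u \<in> {0..1}" "x \<in> space M"
  shows "T (Suc 0) u (\<lambda>_. 1) x = 0"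
  using vanishes_constD[OF T_deriv[of 0 0 u x] assms(2) one_wbdd, of "- T (Suc 0) u (\<lambda>_. 1) x"] T_one assms
  by simp

text \<open>The derivative is a solution again, for the right-hand side \<open>R2\<close> one level
  lower. The induction hypothesis is used twice: for R itself, which makes the part of
  \<open>R2\<close> that contains the solution smooth, and then for \<open>R2\<close>.\<close>

lemma smooth_solution:
  assumes "m \<le> n" "n \<le> k" "smooth M V m n R" "\<And>u. u \<in> {0..1} \<Longrightarrow> R u (\<lambda>_. 1) = 0"
  shows "smooth M V m n (\<lambda>u g. R u (potential u g))"
  using assms
proof (induction m arbitrary: n R)
  case 0
  then show ?case
    unfolding smooth.simps by (intro solution_wcont[where R=R]) auto
next
  case (Suc m)
  from Suc.prems(3) obtain i R' where i: "n = Suc i" and R: "wcont M (V (Suc i)) R" "wderiv M (V i) R R'"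
      "smooth M V m i R'"
    by auto
  have ik: "i < k" "m \<le> i"
    using Suc.prems i by auto
  define R2 where "R2 = (\<lambda>u g. R' u g + R u (potential u (T (Suc 0) u g)))"
  have \<mu>: "smooth M V m n (\<lambda>u g. R u (potential u g))"
    by (rule Suc.IH) (use Suc.prems smooth_Suc[OF Suc.prems(3)] in auto)
  have R2: "smooth M V m i R2"
    unfolding R2_def
    using smooth_compose[of i "Suc 0" m "\<lambda>u g. R u (potential u g)"] \<mu> i ik
    by (intro smooth_add[OF R(3)]) auto
  \<comment> \<open>\<open>R2\<close> stays centred: R' is the derivative of functionals of total
    mass 0, and the derivative of the Markov operators kills constants.\<close>
  have R2_one: "R2 u (\<lambda>_. 1) = 0" if u: "u \<in> {0..1}" for u
  proof -
    have "R' u (\<lambda>_. 1) = 0"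
      using vanishes_constD[OF wderivD[OF R(2) u] u one_wbdd, of "- R' u (\<lambda>_. 1)"] Suc.prems(4) u ik by auto
    moreover
    have L: "wfunctional M (V n) (\<lambda>g. R u (potential u g))"
      by (rule wcontD(1)[OF smooth_wcont[OF \<mu>] u])
    have "R u (potential u (\<lambda>_. 0)) = R u (potential u (T (Suc 0) u (\<lambda>_. 1)))"
      by (rule wfunctional_cong[OF L, of _ 0]) (use T_Suc_0_one ik u in \<open>auto simp: wbdd_def\<close>)
    then have "R u (potential u (T (Suc 0) u (\<lambda>_. 1))) = 0"
      using wfunctional_zero[OF L W_nonneg] Suc.prems(2) by simp
    ultimately show ?thesis
      by (simp add: R2_def)
  qed
  have "wderiv M (V i) (\<lambda>u g. R u (potential u g)) (\<lambda>u g. R2 u (potential u g))"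
    by (rule solution_wderiv[OF ik(1) R(1) Suc.prems(4) R(2) wcontD(1)[OF smooth_wcont[OF R(3)]] R2_def
          R2_one wcontD(1)[OF smooth_wcont[OF R2]]])
  moreover have "smooth M V m i (\<lambda>u g. R2 u (potential u g))"
    by (rule Suc.IH[OF ik(2) less_imp_le[OF ik(1)] R2 R2_one])
  moreover have "wcont M (V n) (\<lambda>u g. R u (potential u g))"
    by (rule solution_wcont[where R=R, OF Suc.prems(2) smooth_wcont[OF Suc.prems(3)] Suc.prems(4)])
  ultimately show ?case
    using i by auto
qed

text \<open>Starting from the fixed \<open>\<pi> 0\<close> avoids circularity: R is smooth by
  \<open>smooth_compose\<close> alone, without any regularity of \<pi> in u. With h =
  \<open>potential u g\<close> the left inverse gives
  \<open>\<pi> 0 h - \<pi> 0 (P u h) = \<pi> 0 g - \<pi> u g\<close>, so F recovers \<pi> u.\<close>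

lemma invariant_smooth:
  obtains F where "smooth M V k k F" "\<And>u g c. u \<in> {0..1} \<Longrightarrow> g \<in> bd k c \<Longrightarrow> F u g = \<pi> u g"
proof -
  \<comment> \<open>Written as a sum with a negative term so that \<open>smooth_add\<close> and
    \<open>smooth_const\<close> apply.\<close>
  define R where "R u g = \<pi> 0 (P u g) + - \<pi> 0 g" for u g
  define F where "F u g = \<pi> 0 g + R u (potential u g)" for u g
  have neg: "wfunctional M (V i) (\<lambda>g. - \<pi> 0 g)" if "i \<le> k" for i
    using wfunctional_lincomb[OF \<pi>_wfunctional \<pi>_wfunctional, OF that _ that, of 0 0 "-1" 0] by simp
  have const: "smooth M V k k (\<lambda>u. \<pi> 0)"
    by (rule smooth_const) (auto intro: \<pi>_wfunctional)
  have R_smooth: "smooth M V k k R"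
    unfolding R_def using smooth_compose[of k 0 k "\<lambda>u. \<pi> 0"] const
    by (intro smooth_add smooth_const neg) auto
  have R_one: "R u (\<lambda>_. 1) = 0" if u: "u \<in> {0..1}" for u
  proof -
    have "\<pi> 0 (\<lambda>_. 1) = \<pi> 0 (P u (\<lambda>_. 1))"
      by (rule wfunctional_cong[OF \<pi>_wfunctional[OF le0] one_wbdd[OF le0]]) (use T_one u in auto)
    then show ?thesis
      by (simp add: R_def)
  qed
  have F_smooth: "smooth M V k k F"
    unfolding F_def by (intro smooth_add const smooth_solution R_smooth R_one order_refl)
  have F_eq: "F u g = \<pi> u g" if u: "u \<in> {0..1}" and g: "g \<in> bd k c" for u g c
  proof -
    have g': "g \<in> bd k \<bar>c\<bar>"
      by (rule wbdd_mono[OF g]) (use W_nonneg in auto)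
    obtain B where B: "0 \<le> B" "potential u g \<in> bd k (B * \<bar>c\<bar>)"
      using potential_bound[OF order_refl] u g' abs_ge_zero by metis
    have L: "wfunctional M (V k) (\<pi> 0)"
      by (rule \<pi>_wfunctional) auto
    have TZ: "P u (potential u g) \<in> bd k (C * (B * \<bar>c\<bar>))"
      by (rule T0_wbdd) (use u B in auto)
    have "\<pi> 0 (potential u g) - \<pi> 0 (P u (potential u g)) = \<pi> 0 (\<lambda>x. potential u g x - P u (potential u g) x)"
      by (rule wfunctional_diff[OF L W_nonneg B(2) TZ, symmetric]) auto
    also have "\<dots> = \<pi> 0 (\<lambda>x. g x - \<pi> u g)"
      by (rule wfunctional_cong[OF L wbdd_diff[OF B(2) TZ] potential_resolvent_left[OF order_refl u g]])
    also have "\<dots> = \<pi> 0 g - \<pi> u g"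
      using wfunctional_diff[OF L W_nonneg g const_wbdd, of "\<pi> u g"]
        wfunctional_scale[OF L one_wbdd, of "\<pi> u g"] \<pi>_one by simp
    finally show ?thesis
      by (simp add: F_def R_def)
  qed
  show thesis
    by (rule that[OF F_smooth F_eq])
qed

end

subsection \<open>Differentiating densities\<close>

text \<open>The mean value theorem on each subinterval, with the intermediate point replaced by the
  left endpoint; uniform continuity of F' limits the cost of this to \<open>e\<close> per unit
  length.\<close>

lemma riemann_sum_increment:
  fixes F F' :: "real \<Rightarrow> real"
  assumes ab: "a < b" and e: "0 < e"
    and deriv: "\<And>t. t \<in> {a..b} \<Longrightarrow> (F has_real_derivative F' t) (at t within {a..b})"
    and cont: "continuous_on {a..b} F'"
  shows "\<forall>\<^sub>F N in sequentially.
    \<bar>F b - F a\<bar> \<le> (b - a) / real N * (\<Sum>i<N. \<bar>F' (a + real i * ((b - a) / real N))\<bar>) + (b - a) * e"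
proof -
  have "uniformly_continuous_on {a..b} F'"
    by (rule compact_uniformly_continuous[OF cont]) simp
  then obtain d where d: "0 < d" "\<And>s t. s \<in> {a..b} \<Longrightarrow> t \<in> {a..b} \<Longrightarrow> dist t s < d \<Longrightarrow> dist (F' t) (F' s) < e"
    unfolding uniformly_continuous_on_def using e by metis
  obtain N0 where N0: "(b - a) / d < real N0"
    using reals_Archimedean2 by blast
  show ?thesis
    unfolding eventually_sequentially
  proof (intro exI allI impI)
    fix N assume N: "max 1 N0 \<le> N"
    define h where "h = (b - a) / real N"
    define t where "t i = a + real i * h" for i
    have h: "0 < h" "h < d" "real N * h = b - a"
    proof -
      have "(b - a) / d < real N"
        using N0 N by linarith
      then show "h < d"
        using d(1) N ab unfolding h_def by (simp add: field_simps)
    qed (use ab N in \<open>auto simp: h_def\<close>)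
    have t_mem: "t i \<in> {a..b}" if "i \<le> N" for i
    proof -
      have "real i * h \<le> real N * h"
        using that h by (intro mult_right_mono) auto
      then show ?thesis
        using h by (simp add: t_def)
    qed
    have step: "\<bar>F (t (Suc i)) - F (t i)\<bar> \<le> h * (\<bar>F' (t i)\<bar> + e)" if i: "i < N" for i
    proof -
      have t: "t i < t (Suc i)" "t (Suc i) - t i = h" "a \<le> t i" "t (Suc i) \<le> b"
        using h t_mem[of i] t_mem[of "Suc i"] i by (auto simp: t_def algebra_simps)
      have "\<exists>x\<in>{t i<..<t (Suc i)}. F (t (Suc i)) - F (t i) = F' x * (t (Suc i) - t i)"
      proof (rule mvt_simple[OF t(1), of F "\<lambda>x y. F' x * y"])
        fix x assume "t i \<le> x" "x \<le> t (Suc i)"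
        then have "(F has_real_derivative F' x) (at x within {a..b})"
          using t by (intro deriv) auto
        then have "(F has_real_derivative F' x) (at x within {t i..t (Suc i)})"
          by (rule has_field_derivative_subset) (use t in auto)
        then show "(F has_derivative (\<lambda>y. F' x * y)) (at x within {t i..t (Suc i)})"
          by (simp add: has_field_derivative_def)
      qed
      then obtain x where x: "t i < x" "x < t (Suc i)" "F (t (Suc i)) - F (t i) = F' x * h"
        using t by auto
      have "dist (F' x) (F' (t i)) < e"
        by (rule d(2)) (use x t h in \<open>auto simp: dist_real_def\<close>)
      then have "\<bar>F' x\<bar> \<le> \<bar>F' (t i)\<bar> + e"
        by (auto simp: dist_real_def)
      then show ?thesis
        using x(3) h by (simp add: abs_mult mult.commute mult_left_mono)
    qed
    have "F b - F a = (\<Sum>i<N. F (t (Suc i)) - F (t i))"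
      using sum_lessThan_telescope[of "\<lambda>i. F (t i)" N] h(3) by (simp add: t_def)
    also have "\<bar>\<dots>\<bar> \<le> (\<Sum>i<N. h * (\<bar>F' (t i)\<bar> + e))"
      by (rule order_trans[OF sum_abs sum_mono]) (use step in auto)
    also have "\<dots> = h * (\<Sum>i<N. \<bar>F' (t i)\<bar>) + real N * h * e"
      by (simp add: sum.distrib sum_distrib_left distrib_left)
    finally show "\<bar>F b - F a\<bar> \<le> (b - a) / real N * (\<Sum>i<N. \<bar>F' (a + real i * ((b - a) / real N))\<bar>) + (b - a) * e"
      unfolding h(3) by (simp add: h_def t_def)
  qed
qed

text \<open>
  Fubini for \<open>F b - F a = \<integral> F' t dt\<close> is not available because \<open>N\<close> need not be \<open>\<sigma>\<close>-finite. Riemann sums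
  and Fatou's lemma do the job.
\<close>

lemma nn_integral_increment_le:
  fixes F F' :: "real \<Rightarrow> 'a \<Rightarrow> real" and w :: "'a \<Rightarrow> real"
  assumes ab: "a \<le> b" and R: "0 \<le> R"
    and deriv: "\<And>t y. t \<in> {a..b} \<Longrightarrow> y \<in> space N \<Longrightarrow> ((\<lambda>t. F t y) has_real_derivative F' t y) (at t within {a..b})"
    and cont: "\<And>y. y \<in> space N \<Longrightarrow> continuous_on {a..b} (\<lambda>t. F' t y)"
    and meas: "\<And>t. t \<in> {a..b} \<Longrightarrow> F t \<in> borel_measurable N" "\<And>t. t \<in> {a..b} \<Longrightarrow> F' t \<in> borel_measurable N"
      "w \<in> borel_measurable N"
    and w: "\<And>y. y \<in> space N \<Longrightarrow> 0 \<le> w y"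
    and bound: "\<And>t. t \<in> {a..b} \<Longrightarrow> (\<integral>\<^sup>+y. ennreal (\<bar>F' t y\<bar> * w y) \<partial>N) \<le> ennreal R"
  shows "(\<integral>\<^sup>+y. ennreal (\<bar>F b y - F a y\<bar> * w y) \<partial>N) \<le> ennreal (R * (b - a))"
proof (cases "a = b")
  case False
  with ab have ab: "a < b" by simp
  define t where "t n i = a + real i * ((b - a) / real n)" for n i
  define G where "G n y = (b - a) / real n * (\<Sum>i<n. \<bar>F' (t n i) y\<bar>)" for n y
  have t: "t n i \<in> {a..b}" if "i < n" for n i
  proof -
    have "real i * ((b - a) / real n) \<le> real n * ((b - a) / real n)"
      using that ab by (intro mult_right_mono) auto
    then show ?thesis
      using that ab by (simp add: t_def)
  qed
  have [measurable]: "F a \<in> borel_measurable N" "F b \<in> borel_measurable N" "w \<in> borel_measurable N"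
    using meas ab by auto
  have [measurable]: "G n \<in> borel_measurable N" for n
    unfolding G_def using meas(2)[OF t] by measurable
  have G_nonneg: "0 \<le> G n y" for n y
    unfolding G_def using ab by (intro mult_nonneg_nonneg sum_nonneg) auto
  \<comment> \<open>The Riemann sums merely dominate the increment up to a small error. The minimum
    turns this one-sided bound into convergence.\<close>
  have lim: "(\<lambda>n. min (G n y) \<bar>F b y - F a y\<bar>) \<longlonglongrightarrow> \<bar>F b y - F a y\<bar>" if y: "y \<in> space N" for y
  proof (rule LIMSEQ_I)
    fix r :: real assume r: "0 < r"
    define r' where "r' = r / (2 * (b - a))"
    have r': "0 < r'" "(b - a) * r' = r / 2"
      using ab r by (auto simp: r'_def field_simps)
    have "\<forall>\<^sub>F n in sequentially. \<bar>F b y - F a y\<bar> \<le> G n y + (b - a) * r'"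
      unfolding G_def t_def
      by (rule riemann_sum_increment[OF ab r'(1) deriv[OF _ y] cont[OF y]])
    then have "\<forall>\<^sub>F n in sequentially. norm (min (G n y) \<bar>F b y - F a y\<bar> - \<bar>F b y - F a y\<bar>) < r"
      unfolding r'(2) by (rule eventually_mono) (use r in auto)
    then show "\<exists>no. \<forall>n\<ge>no. norm (min (G n y) \<bar>F b y - F a y\<bar> - \<bar>F b y - F a y\<bar>) < r"
      by (simp add: eventually_sequentially)
  qed
  have int: "(\<integral>\<^sup>+y. ennreal (min (G n y) \<bar>F b y - F a y\<bar> * w y) \<partial>N) \<le> ennreal (R * (b - a))" for n
  proof -
    have "(\<integral>\<^sup>+y. ennreal (min (G n y) \<bar>F b y - F a y\<bar> * w y) \<partial>N) \<le> (\<integral>\<^sup>+y. ennreal (G n y * w y) \<partial>N)"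
      using w by (intro nn_integral_mono ennreal_leI mult_right_mono) auto
    also have "\<dots> = (\<integral>\<^sup>+y. ennreal ((b - a) / real n) * (\<Sum>i<n. ennreal (\<bar>F' (t n i) y\<bar> * w y)) \<partial>N)"
    proof (rule nn_integral_cong)
      fix y assume y: "y \<in> space N"
      have "G n y * w y = (b - a) / real n * (\<Sum>i<n. \<bar>F' (t n i) y\<bar> * w y)"
        by (simp add: G_def sum_distrib_right mult.assoc)
      also have "ennreal \<dots> = ennreal ((b - a) / real n) * (\<Sum>i<n. ennreal (\<bar>F' (t n i) y\<bar> * w y))"
        using ab w[OF y] by (subst ennreal_mult) (auto intro!: sum_nonneg simp: sum_ennreal)
      finally show "ennreal (G n y * w y) = ennreal ((b - a) / real n) * (\<Sum>i<n. ennreal (\<bar>F' (t n i) y\<bar> * w y))" .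
    qed
    also have "\<dots> = ennreal ((b - a) / real n) * (\<Sum>i<n. \<integral>\<^sup>+y. ennreal (\<bar>F' (t n i) y\<bar> * w y) \<partial>N)"
      using meas(2)[OF t] by (subst nn_integral_cmult, measurable) (subst nn_integral_sum, auto)
    also have "\<dots> \<le> ennreal ((b - a) / real n) * (\<Sum>i<n. ennreal R)"
      by (intro mult_left_mono sum_mono bound t) auto
    also have "(\<Sum>i<n. ennreal R) = ennreal (\<Sum>i<n. R)"
      by (rule sum_ennreal) (rule R)
    also have "ennreal ((b - a) / real n) * \<dots> = ennreal ((b - a) / real n * (\<Sum>i<n. R))"
      using ab R by (intro ennreal_mult[symmetric]) auto
    \<comment> \<open>For n = 0 the left-hand side is 0: the sum is empty, and division by 0 gives
      0.\<close>
    also have "\<dots> \<le> ennreal (R * (b - a))"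
      using ab R by (intro ennreal_leI) (cases "n = 0"; simp)
    finally show ?thesis .
  qed
  have "(\<integral>\<^sup>+y. ennreal (\<bar>F b y - F a y\<bar> * w y) \<partial>N)
      = (\<integral>\<^sup>+y. liminf (\<lambda>n. ennreal (min (G n y) \<bar>F b y - F a y\<bar> * w y)) \<partial>N)"
    by (intro nn_integral_cong lim_imp_Liminf[symmetric] tendsto_ennrealI tendsto_mult_right lim) auto
  also have "\<dots> \<le> liminf (\<lambda>n. \<integral>\<^sup>+y. ennreal (min (G n y) \<bar>F b y - F a y\<bar> * w y) \<partial>N)"
    by (rule nn_integral_liminf) measurable
  also have "\<dots> \<le> ennreal (R * (b - a))"
    using int by (intro Liminf_le) auto
  finally show ?thesis .
qed simp

text \<open>If the product is not integrable, the left-hand side is the default value 0 of the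
  Bochner integral.\<close>

lemma ennreal_abs_integral_le:
  fixes h \<phi> w :: "'a \<Rightarrow> real"
  assumes "\<And>y. y \<in> space N \<Longrightarrow> \<bar>h y\<bar> \<le> w y"
  shows "ennreal \<bar>\<integral>y. h y * \<phi> y \<partial>N\<bar> \<le> (\<integral>\<^sup>+y. ennreal (\<bar>\<phi> y\<bar> * w y) \<partial>N)"
proof (cases "integrable N (\<lambda>y. h y * \<phi> y)")
  case True
  have "ennreal \<bar>\<integral>y. h y * \<phi> y \<partial>N\<bar> \<le> (\<integral>\<^sup>+y. ennreal (norm (h y * \<phi> y)) \<partial>N)"
    using integral_norm_bound_ennreal[OF True] by simp
  also have "\<dots> \<le> (\<integral>\<^sup>+y. ennreal (\<bar>\<phi> y\<bar> * w y) \<partial>N)"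
  proof (intro nn_integral_mono ennreal_leI)
    fix y assume "y \<in> space N"
    from mult_left_mono[OF assms[OF this] abs_ge_zero[of "\<phi> y"]]
    show "norm (h y * \<phi> y) \<le> \<bar>\<phi> y\<bar> * w y"
      by (simp add: abs_mult mult.commute)
  qed
  finally show ?thesis .
qed (simp add: not_integrable_integral_eq)

lemma vanishesI_ennreal:
  assumes \<rho>: "(\<rho> \<longlongrightarrow> 0) (at u within {0..1})"
    and le: "\<And>v g. v \<in> {0..1} \<Longrightarrow> v \<noteq> u \<Longrightarrow> g \<in> S \<Longrightarrow> ennreal \<bar>G v g\<bar> \<le> \<rho> v"
  shows "vanishes S u G"
proof (rule uniform_limitI)
  fix e :: real assume "0 < e"
  then have "\<forall>\<^sub>F v in at u within {0..1}. \<rho> v < ennreal e"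
    using \<rho> by (intro order_tendstoD(2)) auto
  moreover have "\<forall>\<^sub>F v in at u within {0..1}. v \<in> {0..1} \<and> v \<noteq> u"
    by (simp add: eventually_at_filter)
  ultimately show "\<forall>\<^sub>F v in at u within {0..1}. \<forall>g\<in>S. dist (G v g) 0 < e"
  proof eventually_elim
    case (elim v)
    have "\<bar>G v g\<bar> < e" if "g \<in> S" for g
    proof -
      have "ennreal \<bar>G v g\<bar> < ennreal e"
        using le[of v g] elim that by (auto intro: le_less_trans)
      then show ?thesis
        by (simp add: ennreal_less_iff)
    qed
    then show ?case by simp
  qed
qed

text \<open>Pushing \<open>K x\<close> forward along y \<mapsto> (x, y) moves the parameter from the
  integrand into the measure, so that a single function on the product is integrated.\<close>

lemma integral_measurable_subprob_algebra2:
  fixes h :: "'a \<Rightarrow> 'b \<Rightarrow> real"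
  assumes [measurable]: "(\<lambda>(x, y). h x y) \<in> borel_measurable (M \<Otimes>\<^sub>M N)" "K \<in> M \<rightarrow>\<^sub>M subprob_algebra N"
  shows "(\<lambda>x. \<integral>y. h x y \<partial>K x) \<in> borel_measurable M"
proof -
  note measurable_distr2[measurable]
  have "(\<lambda>x. \<integral>z. (case z of (x, y) \<Rightarrow> h x y) \<partial>distr (K x) (M \<Otimes>\<^sub>M N) (\<lambda>y. (x, y))) \<in> borel_measurable M"
    by (rule measurable_compose[OF _ integral_measurable_subprob_algebra]) measurable
  then show ?thesis
  proof (rule measurable_cong[THEN iffD1, rotated])
    fix x assume x: "x \<in> space M"
    have [measurable]: "(\<lambda>y. (x, y)) \<in> K x \<rightarrow>\<^sub>M M \<Otimes>\<^sub>M N"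
      using x sets_kernel[OF assms(2) x] by (simp cong: measurable_cong_sets)
    show "(\<integral>z. (case z of (x, y) \<Rightarrow> h x y) \<partial>distr (K x) (M \<Otimes>\<^sub>M N) (\<lambda>y. (x, y))) = (\<integral>y. h x y \<partial>K x)"
      by (subst integral_distr) auto
  qed
qed

text \<open>Measurability passes to limits of sequences; \<open>df_measurable_borel\<close> and
  \<open>T_measurable\<close> take derivatives along such a sequence.\<close>

lemma approach_sequence:
  assumes "u \<in> {0..1::real}"
  obtains s where "\<And>i::nat. s i \<in> {0..1}" "\<And>i. s i \<noteq> u" "filterlim s (at u within {0..1}) sequentially"
proof -
  have "u islimpt {0..1}"
    using assms by (simp add: islimpt_Icc)
  then obtain s where "\<forall>i. s i \<in> {0..1} - {u}" "s \<longlonglongrightarrow> u"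
    unfolding islimpt_sequential by blast
  then show thesis
    by (intro that[of s]) (auto simp: filterlim_at)
qed

section \<open>Kernels with smooth densities\<close>

locale smooth_kernels =
  fixes \<gamma> :: "'a::topological_space \<Rightarrow> 'a measure"
    and f :: "real \<Rightarrow> 'a \<Rightarrow> 'a \<Rightarrow> real"
    and df :: "nat \<Rightarrow> real \<Rightarrow> 'a \<Rightarrow> 'a \<Rightarrow> real"
    and Q :: "real \<Rightarrow> 'a \<Rightarrow> 'a measure"
    and V :: "nat \<Rightarrow> 'a \<Rightarrow> real"
    and k :: nat
  assumes kernel: "measure_kernel borel borel \<gamma>"
    and f_measurable: "(\<lambda>(u, x, y). f u x y) \<in>
      borel_measurable (restrict_space borel {0..1} \<Otimes>\<^sub>M (borel \<Otimes>\<^sub>M borel))"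
    and f_nonneg: "\<And>u x y. u \<in> {0..1} \<Longrightarrow> 0 \<le> f u x y"
    and Q_def: "\<And>u x. u \<in> {0..1} \<Longrightarrow> Q u x = density (\<gamma> x) (\<lambda>y. ennreal (f u x y))"
    and Q_markov: "\<And>u. u \<in> {0..1} \<Longrightarrow> Q u \<in> borel \<rightarrow>\<^sub>M prob_algebra borel"
    and V_measurable: "\<And>l. l \<le> k \<Longrightarrow> V l \<in> borel_measurable borel"
    and V_ge_1: "\<And>l x. l \<le> k \<Longrightarrow> 1 \<le> V l x"
    and V_mono: "\<And>l x. l < k \<Longrightarrow> V l x \<le> V (Suc l) x"
    and df_0: "df 0 = f"
    and df_derivs: "\<And>x y. Ck_derivs k (\<lambda>l u. df l u x y)"
    and df_bound: "\<exists>C>0. \<forall>s l x. s + l \<le> k \<longrightarrow>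
      (SUP u\<in>{0..1}. \<integral>\<^sup>+y. ennreal (\<bar>df l u x y\<bar> * V s y) \<partial>\<gamma> x) \<le> ennreal (C * V (s + l) x)"
    and df_limit: "\<And>u x s. u \<in> {0..1} \<Longrightarrow> s \<le> k \<Longrightarrow>
      ((\<lambda>h. \<integral>\<^sup>+y. ennreal (\<bar>df (k - s) (u + h) x y - df (k - s) u x y\<bar> * V s y) \<partial>\<gamma> x)
         \<longlongrightarrow> 0) (at 0 within {h. u + h \<in> {0..1}})"
begin

lemma sets_\<gamma>: "sets (\<gamma> x) = sets borel"
  using kernel by (simp add: measure_kernel_def)

lemma space_\<gamma>: "space (\<gamma> x) = UNIV"
  using sets_eq_imp_space_eq[OF sets_\<gamma>] by simp

lemma V_nonneg: "l \<le> k \<Longrightarrow> 0 \<le> V l x"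
  using V_ge_1[of l x] by simp

lemma V_le: "i \<le> n \<Longrightarrow> n \<le> k \<Longrightarrow> V i x \<le> V n x"
  by (induction n rule: dec_induct) (auto intro: order_trans[OF _ V_mono])

lemma df_deriv:
  assumes "l < k" "u \<in> {0..1}"
  shows "((\<lambda>v. df l v x y) has_real_derivative df (Suc l) u x y) (at u within {0..1})"
  using df_derivs[of x y] assms by (auto simp: Ck_derivs_def)

lemma df_cont:
  assumes "l \<le> k"
  shows "continuous_on {0..1} (\<lambda>v. df l v x y)"
proof (cases "l = k")
  case True
  then show ?thesis
    using df_derivs[of x y] by (simp add: Ck_derivs_def)
next
  case False
  then show ?thesis
    using df_deriv[of l] assms by (intro DERIV_continuous_on) auto
qed

lemma df_measurable_borel:
  assumes "l \<le> k" "u \<in> {0..1}"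
  shows "(\<lambda>y. df l u x y) \<in> borel_measurable borel"
  using assms
proof (induction l arbitrary: u)
  case 0
  have "(\<lambda>y. (u, x, y)) \<in> borel \<rightarrow>\<^sub>M (restrict_space borel {0..1} \<Otimes>\<^sub>M (borel \<Otimes>\<^sub>M borel))"
    using 0 by (intro measurable_Pair measurable_const) (auto simp: space_restrict_space)
  from measurable_compose[OF this f_measurable] show ?case
    by (simp add: df_0)
next
  case (Suc l)
  obtain s where s: "\<And>i::nat. s i \<in> {0..1}" "\<And>i. s i \<noteq> u" "filterlim s (at u within {0..1}) sequentially"
    using approach_sequence[OF Suc.prems(2)] by blast
  show ?case
  proof (rule borel_measurable_LIMSEQ_real)
    fix y
    have "((\<lambda>v. (df l v x y - df l u x y) / (v - u)) \<longlongrightarrow> df (Suc l) u x y) (at u within {0..1})"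
      using df_deriv[of l u x y] Suc.prems by (simp add: has_field_derivative_iff)
    then show "(\<lambda>i. (df l (s i) x y - df l u x y) / (s i - u)) \<longlonglongrightarrow> df (Suc l) u x y"
      by (rule filterlim_compose[OF _ s(3)])
  next
    fix i
    show "(\<lambda>y. (df l (s i) x y - df l u x y) / (s i - u)) \<in> borel_measurable borel"
      using Suc.IH[of u] Suc.IH[of "s i"] Suc.prems s by auto
  qed
qed

lemma df_measurable: "l \<le> k \<Longrightarrow> u \<in> {0..1} \<Longrightarrow> (\<lambda>y. df l u x y) \<in> borel_measurable (\<gamma> x)"
  using df_measurable_borel by (simp add: measurable_cong_sets[OF sets_\<gamma> refl])

lemma V_measurable_\<gamma>: "l \<le> k \<Longrightarrow> V l \<in> borel_measurable (\<gamma> x)"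
  using V_measurable by (simp add: measurable_cong_sets[OF sets_\<gamma> refl])

text \<open>The limit in (B3) concerns only pairs of a derivative and a weight whose orders add up
  to k. For smaller n it follows from V n \<le> V (k - l).\<close>

lemma df_limit_at:
  assumes "n + l \<le> k" "u \<in> {0..1}"
  shows "((\<lambda>v. \<integral>\<^sup>+y. ennreal (\<bar>df l v x y - df l u x y\<bar> * V n y) \<partial>\<gamma> x) \<longlongrightarrow> 0) (at u within {0..1})"
proof -
  let ?\<rho> = "\<lambda>n v. \<integral>\<^sup>+y. ennreal (\<bar>df l v x y - df l u x y\<bar> * V n y) \<partial>\<gamma> x"
  have *: "((\<lambda>h. ?\<rho> (k - l) (u + h)) \<longlongrightarrow> 0) (at 0 within {h. u + h \<in> {0..1}})"
    using df_limit[OF assms(2), of "k - l" x] assms(1) by simp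
  have "filterlim (\<lambda>v. v - u) (at 0 within {h. u + h \<in> {0..1}}) (at u within {0..1})"
    unfolding filterlim_at
    by (auto simp: eventually_at_filter intro!: tendsto_eq_intros)
  from filterlim_compose[OF * this] have "(?\<rho> (k - l) \<longlongrightarrow> 0) (at u within {0..1})"
    by simp
  then show ?thesis
  proof (rule tendsto_sandwich[OF _ _ tendsto_const, rotated 2])
    show "\<forall>\<^sub>F v in at u within {0..1}. ?\<rho> n v \<le> ?\<rho> (k - l) v"
      using assms(1) V_le[of n "k - l"]
      by (intro always_eventually allI nn_integral_mono ennreal_leI mult_left_mono) auto
  qed auto
qed

lemma integral_Q:
  assumes "u \<in> {0..1}" "h \<in> borel_measurable borel"
  shows "(\<integral>y. h y \<partial>Q u x) = (\<integral>y. h y * df 0 u x y \<partial>\<gamma> x)"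
proof -
  have [measurable]: "h \<in> borel_measurable (\<gamma> x)" "(\<lambda>y. f u x y) \<in> borel_measurable (\<gamma> x)"
    using assms(2) df_measurable[of 0 u x] assms(1) by (simp_all add: measurable_cong_sets[OF sets_\<gamma> refl] df_0)
  have "(\<integral>y. h y \<partial>Q u x) = (\<integral>y. f u x y *\<^sub>R h y \<partial>\<gamma> x)"
    unfolding Q_def[OF assms(1)] using f_nonneg[OF assms(1)] by (intro integral_density) auto
  then show ?thesis
    by (simp add: df_0 mult.commute)
qed

lemma Q_prob: "u \<in> {0..1} \<Longrightarrow> Q u x \<in> space (prob_algebra borel)"
  using measurable_space[OF Q_markov] by simp

end

text \<open>
  The kernel \<open>x \<mapsto> law of e x y\<close>, \<open>y \<sim> Q u (b x)\<close>, from \<open>S\<close> to \<open>N\<close>. With \<open>b x = x\<close>, \<open>e x y = y\<close> this is \<open>Q u\<close>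
  itself; with \<open>b \<omega> = \<omega> i\<close>, \<open>e \<omega> y = \<omega>(i + 1 := y)\<close> it adds one coordinate to a path.
\<close>

locale lifted_kernels = smooth_kernels \<gamma> f df Q V k
  for \<gamma> :: "'a::topological_space \<Rightarrow> 'a measure" and f df Q V k +
  fixes S :: "'b measure" and N :: "'c measure" and b :: "'b \<Rightarrow> 'a" and e :: "'b \<Rightarrow> 'a \<Rightarrow> 'c"
    and W :: "nat \<Rightarrow> 'b \<Rightarrow> real" and U :: "nat \<Rightarrow> 'c \<Rightarrow> real" and a :: "nat \<Rightarrow> 'b \<Rightarrow> real" and C :: real
  assumes b: "b \<in> S \<rightarrow>\<^sub>M borel"
    and e: "(\<lambda>(x, y). e x y) \<in> S \<Otimes>\<^sub>M borel \<rightarrow>\<^sub>M N"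
    and a_nonneg: "n \<le> k \<Longrightarrow> x \<in> space S \<Longrightarrow> 0 \<le> a n x"
    and U_le: "n \<le> k \<Longrightarrow> x \<in> space S \<Longrightarrow> U n (e x y) \<le> a n x + V n y"
    and bound: "n + l \<le> k \<Longrightarrow> u \<in> {0..1} \<Longrightarrow> x \<in> space S \<Longrightarrow>
      (\<integral>\<^sup>+y. ennreal (\<bar>df l u (b x) y\<bar> * (a n x + V n y)) \<partial>\<gamma> (b x)) \<le> ennreal (C * W (n + l) x)"
    and C_nonneg: "0 \<le> C"
    and W_ge_1: "n \<le> k \<Longrightarrow> x \<in> space S \<Longrightarrow> 1 \<le> W n x"
    and U_ge_1: "n \<le> k \<Longrightarrow> z \<in> space N \<Longrightarrow> 1 \<le> U n z"
    and W_Suc: "n < k \<Longrightarrow> x \<in> space S \<Longrightarrow> W n x \<le> W (Suc n) x"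
    and W_measurable: "n \<le> k \<Longrightarrow> W n \<in> borel_measurable S"
    and U_measurable: "n \<le> k \<Longrightarrow> U n \<in> borel_measurable N"
begin

text \<open>The weight \<open>a n x + V n y\<close> dominates test functions evaluated at
  \<open>e x y\<close>. For \<open>Q u\<close> itself \<open>a\<close> is 0; for paths it is the
  weight of the coordinates already present.\<close>

abbreviation wint :: "nat \<Rightarrow> 'b \<Rightarrow> ('a \<Rightarrow> real) \<Rightarrow> ennreal" where
  "wint n x \<phi> \<equiv> \<integral>\<^sup>+y. ennreal (\<bar>\<phi> y\<bar> * (a n x + V n y)) \<partial>\<gamma> (b x)"

definition T :: "nat \<Rightarrow> real \<Rightarrow> ('c \<Rightarrow> real) \<Rightarrow> 'b \<Rightarrow> real" where
  "T l u g x = (\<integral>y. g (e x y) * df l u (b x) y \<partial>\<gamma> (b x))"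

definition lift :: "real \<Rightarrow> 'b \<Rightarrow> 'c measure" where
  "lift u x = distr (Q u (b x)) N (e x)"

lemma e_measurable:
  assumes "x \<in> space S"
  shows "e x \<in> borel \<rightarrow>\<^sub>M N"
  using measurable_compose[OF measurable_Pair1'[OF assms] e] by simp

lemma e_measurable_Q: "u \<in> {0..1} \<Longrightarrow> x \<in> space S \<Longrightarrow> e x \<in> Q u (b x) \<rightarrow>\<^sub>M N"
  using e_measurable[of x] Q_prob[of u "b x"] by (simp add: space_prob_algebra cong: measurable_cong_sets)

lemma e_space: "x \<in> space S \<Longrightarrow> e x y \<in> space N"
  using measurable_space[OF e_measurable, of x y] by simp

lemma weight_nonneg: "n \<le> k \<Longrightarrow> x \<in> space S \<Longrightarrow> 0 \<le> a n x + V n y"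
  using a_nonneg[of n x] V_nonneg[of n y] by simp

lemma weight_measurable: "n \<le> k \<Longrightarrow> (\<lambda>y. a n x + V n y) \<in> borel_measurable (\<gamma> z)"
  using V_measurable_\<gamma> by simp

lemma test_measurable: "g \<in> borel_measurable N \<Longrightarrow> x \<in> space S \<Longrightarrow> (\<lambda>y. g (e x y)) \<in> borel_measurable borel"
  using measurable_compose[OF e_measurable] by blast

lemma test_le:
  assumes "n \<le> k" "x \<in> space S" "0 \<le> c" "g \<in> wbdd N (U n) c"
  shows "\<bar>g (e x y)\<bar> \<le> c * (a n x + V n y)"
  using wbddD[OF assms(4) e_space[OF assms(2)], of y] mult_left_mono[OF U_le[OF assms(1,2), of y] assms(3)]
  by linarith

lemma T_integrable:
  assumes nl: "n + l \<le> k" and u: "u \<in> {0..1}" and x: "x \<in> space S" and g: "g \<in> wbdd N (U n) c"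
  shows "integrable (\<gamma> (b x)) (\<lambda>y. g (e x y) * df l u (b x) y)"
proof (rule Bochner_Integration.integrable_bound)
  have n: "n \<le> k" "l \<le> k" using nl by auto
  have g': "g \<in> wbdd N (U n) \<bar>c\<bar>"
    by (rule wbdd_mono[OF g abs_ge_self]) (use U_ge_1[OF n(1)] in force)
  note [measurable] = weight_measurable[OF n(1)] df_measurable[OF n(2) u]
  have "integrable (\<gamma> (b x)) (\<lambda>y. df l u (b x) y * (a n x + V n y))"
  proof (rule integrableI_bounded)
    have "(\<integral>\<^sup>+y. ennreal (norm (df l u (b x) y * (a n x + V n y))) \<partial>\<gamma> (b x))
        = wint n x (df l u (b x))"
      using weight_nonneg[OF n(1) x] by (simp add: abs_mult)
    then show "(\<integral>\<^sup>+y. ennreal (norm (df l u (b x) y * (a n x + V n y))) \<partial>\<gamma> (b x)) < \<infinity>"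
      using bound[OF nl u x] by (auto intro: le_less_trans)
  qed measurable
  then show "integrable (\<gamma> (b x)) (\<lambda>y. \<bar>c\<bar> * (df l u (b x) y * (a n x + V n y)))"
    by simp
  have "(\<lambda>y. g (e x y)) \<in> borel_measurable (\<gamma> (b x))"
    using test_measurable[OF wbdd_measurable[OF g] x] by (simp add: measurable_cong_sets[OF sets_\<gamma> refl])
  then show "(\<lambda>y. g (e x y) * df l u (b x) y) \<in> borel_measurable (\<gamma> (b x))"
    by measurable
  show "AE y in \<gamma> (b x). norm (g (e x y) * df l u (b x) y) \<le> norm (\<bar>c\<bar> * (df l u (b x) y * (a n x + V n y)))"
  proof (rule AE_I2)
    fix y
    have "\<bar>g (e x y)\<bar> * \<bar>df l u (b x) y\<bar> \<le> \<bar>c\<bar> * (a n x + V n y) * \<bar>df l u (b x) y\<bar>"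
      by (rule mult_right_mono[OF test_le[OF n(1) x abs_ge_zero g']]) simp
    then show "norm (g (e x y) * df l u (b x) y) \<le> norm (\<bar>c\<bar> * (df l u (b x) y * (a n x + V n y)))"
      using weight_nonneg[OF n(1) x, of y] by (simp add: abs_mult mult_ac)
  qed
qed

lemma T_wfunctional:
  assumes nl: "n + l \<le> k" and u: "u \<in> {0..1}" and x: "x \<in> space S"
  shows "wfunctional N (U n) (\<lambda>g. T l u g x)"
  unfolding wfunctional_def
proof (intro conjI allI impI)
  fix c g h assume "g \<in> wbdd N (U n) c" "h \<in> wbdd N (U n) c"
  then show "T l u (\<lambda>z. g z + h z) x = T l u g x + T l u h x"
    unfolding T_def using T_integrable[OF nl u x] by (simp add: distrib_right)
next
  fix c d g
  show "T l u (\<lambda>z. d * g z) x = d * T l u g x"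
    unfolding T_def by (simp add: mult.assoc)
next
  fix c h g assume h: "\<forall>i. h i \<in> wbdd N (U n) c" and g: "g \<in> wbdd N (U n) c"
    and lim: "\<forall>z\<in>space N. (\<lambda>i::nat. h i z) \<longlonglongrightarrow> g z"
  have n: "n \<le> k" "l \<le> k" using nl by auto
  have w: "(\<lambda>z. c * U n z) \<in> wbdd N (U n) \<bar>c\<bar>"
    using U_measurable[OF n(1)] U_ge_1[OF n(1)] by (force simp: wbdd_def abs_mult)
  show "(\<lambda>i. T l u (h i) x) \<longlonglongrightarrow> T l u g x"
    unfolding T_def
  proof (rule integral_dominated_convergence)
    show "integrable (\<gamma> (b x)) (\<lambda>y. \<bar>c * U n (e x y) * df l u (b x) y\<bar>)"
      using T_integrable[OF nl u x w] by simp
    show "AE y in \<gamma> (b x). (\<lambda>i. h i (e x y) * df l u (b x) y) \<longlonglongrightarrow> g (e x y) * df l u (b x) y"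
      using lim e_space[OF x] by (intro AE_I2 tendsto_mult_right) auto
    show "AE y in \<gamma> (b x). norm (h i (e x y) * df l u (b x) y) \<le> \<bar>c * U n (e x y) * df l u (b x) y\<bar>" for i
    proof (rule AE_I2)
      fix y
      have "\<bar>h i (e x y)\<bar> \<le> \<bar>c * U n (e x y)\<bar>"
        using wbddD[of "h i", OF _ e_space[OF x]] h abs_ge_self order_trans by blast
      then show "norm (h i (e x y) * df l u (b x) y) \<le> \<bar>c * U n (e x y) * df l u (b x) y\<bar>"
        by (simp add: abs_mult mult_right_mono)
    qed
    show "(\<lambda>y. g (e x y) * df l u (b x) y) \<in> borel_measurable (\<gamma> (b x))"
      "(\<lambda>y. h i (e x y) * df l u (b x) y) \<in> borel_measurable (\<gamma> (b x))" for i
      using T_integrable[OF nl u x, THEN borel_measurable_integrable] g h by blast+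
  qed
qed

lemma T_diff:
  assumes "n + l \<le> k" "u \<in> {0..1}" "v \<in> {0..1}" "x \<in> space S" "g \<in> wbdd N (U n) c"
  shows "T l v g x - T l u g x = (\<integral>y. g (e x y) * (df l v (b x) y - df l u (b x) y) \<partial>\<gamma> (b x))"
  unfolding T_def using T_integrable[of n l u x g c] T_integrable[of n l v x g c] assms
  by (simp add: right_diff_distrib)

text \<open>Since V n \<ge> 1, the extra weight costs only the factor \<open>a n x + 1\<close>. It
  depends on x, which convergence at a fixed x tolerates.\<close>

lemma df_limit_weighted:
  assumes nl: "n + l \<le> k" and u: "u \<in> {0..1}" and x: "x \<in> space S"
  shows "((\<lambda>v. \<integral>\<^sup>+y. ennreal (\<bar>df l v (b x) y - df l u (b x) y\<bar> * (a n x + V n y)) \<partial>\<gamma> (b x)) \<longlongrightarrow> 0)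
    (at u within {0..1})"
proof (rule tendsto_sandwich[OF _ _ tendsto_const])
  have n: "n \<le> k" "l \<le> k" using nl by auto
  let ?\<rho> = "\<lambda>v. \<integral>\<^sup>+y. ennreal (\<bar>df l v (b x) y - df l u (b x) y\<bar> * V n y) \<partial>\<gamma> (b x)"
  show "((\<lambda>v. ennreal (a n x + 1) * ?\<rho> v) \<longlongrightarrow> 0) (at u within {0..1})"
    using ennreal_tendsto_cmult[OF _ df_limit_at[OF nl u], of "ennreal (a n x + 1)" "b x"] by simp
  have "wint n x (\<lambda>y. df l v (b x) y - df l u (b x) y)
      \<le> ennreal (a n x + 1) * ?\<rho> v" if v: "v \<in> {0..1}" for v
  proof -
    have "wint n x (\<lambda>y. df l v (b x) y - df l u (b x) y)
        \<le> (\<integral>\<^sup>+y. ennreal (a n x + 1) * ennreal (\<bar>df l v (b x) y - df l u (b x) y\<bar> * V n y) \<partial>\<gamma> (b x))"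
    proof (rule nn_integral_mono)
      fix y
      have "a n x + V n y \<le> (a n x + 1) * V n y"
        using mult_left_mono[OF V_ge_1[OF n(1), of y] a_nonneg[OF n(1) x]] by (simp add: distrib_right)
      from mult_left_mono[OF this abs_ge_zero, of "df l v (b x) y - df l u (b x) y"]
      have "\<bar>df l v (b x) y - df l u (b x) y\<bar> * (a n x + V n y)
          \<le> (a n x + 1) * (\<bar>df l v (b x) y - df l u (b x) y\<bar> * V n y)"
        by (simp only: mult_ac)
      then show "ennreal (\<bar>df l v (b x) y - df l u (b x) y\<bar> * (a n x + V n y))
          \<le> ennreal (a n x + 1) * ennreal (\<bar>df l v (b x) y - df l u (b x) y\<bar> * V n y)"
        using a_nonneg[OF n(1) x] V_nonneg[OF n(1)] by (subst ennreal_mult[symmetric]) (auto intro: ennreal_leI)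
    qed
    also have "\<dots> = ennreal (a n x + 1) * ?\<rho> v"
      using df_measurable[OF n(2) u, of "b x"] df_measurable[OF n(2) v, of "b x"] V_measurable_\<gamma>[OF n(1), of "b x"]
      by (intro nn_integral_cmult) measurable
    finally show ?thesis .
  qed
  then show "\<forall>\<^sub>F v in at u within {0..1}.
      wint n x (\<lambda>y. df l v (b x) y - df l u (b x) y) \<le> ennreal (a n x + 1) * ?\<rho> v"
    by (simp add: eventually_at_filter)
qed simp

lemma T_cont:
  assumes nl: "n + l \<le> k" and u: "u \<in> {0..1}" and x: "x \<in> space S"
  shows "vanishes (wbdd N (U n) 1) u (\<lambda>v g. T l v g x - T l u g x)"
proof (rule vanishesI_ennreal[OF df_limit_weighted[OF assms]])
  have n: "n \<le> k" using nl by auto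
  fix v :: real and g assume v: "v \<in> {0..1}" and g: "g \<in> wbdd N (U n) 1"
  show "ennreal \<bar>T l v g x - T l u g x\<bar>
      \<le> wint n x (\<lambda>y. df l v (b x) y - df l u (b x) y)"
    unfolding T_diff[OF nl u v x g]
    by (rule ennreal_abs_integral_le) (use test_le[OF n x _ g] in auto)
qed

text \<open>The weighted integral of the next derivative of the density is bounded uniformly in the
  parameter, and this bound serves as Lipschitz constant.\<close>

lemma T_lipschitz:
  assumes nl: "n + l < k" and u: "u \<in> {0..1}" and v: "v \<in> {0..1}" and x: "x \<in> space S"
    and g: "g \<in> wbdd N (U n) 1"
  shows "\<bar>T l v g x - T l u g x\<bar> \<le> C * \<bar>v - u\<bar> * W (Suc (n + l)) x"
proof -
  have n: "n \<le> k" "l < k" using nl by auto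
  have W: "0 \<le> W (Suc (n + l)) x"
    using W_ge_1[of "Suc (n + l)" x] nl x by simp
  have le: "\<bar>T l t g x - T l s g x\<bar> \<le> C * (t - s) * W (Suc (n + l)) x"
    if st: "s \<le> t" "s \<in> {0..1}" "t \<in> {0..1}" for s t
  proof -
    have sub: "{s..t} \<subseteq> {0..1}" using st by auto
    have "ennreal \<bar>T l t g x - T l s g x\<bar>
        \<le> wint n x (\<lambda>y. df l t (b x) y - df l s (b x) y)"
      unfolding T_diff[OF less_imp_le[OF nl] st(2,3) x g]
      by (rule ennreal_abs_integral_le) (use test_le[OF n(1) x _ g] in auto)
    also have "\<dots> \<le> ennreal (C * W (Suc (n + l)) x * (t - s))"
    proof (rule nn_integral_increment_le[where F'="\<lambda>t y. df (Suc l) t (b x) y"])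
      show "0 \<le> C * W (Suc (n + l)) x"
        using C_nonneg W by simp
      show "((\<lambda>t. df l t (b x) y) has_real_derivative df (Suc l) r (b x) y) (at r within {s..t})"
        if "r \<in> {s..t}" for r y
        by (rule has_field_derivative_subset[OF df_deriv[OF n(2)] sub]) (use that sub in auto)
      show "continuous_on {s..t} (\<lambda>t. df (Suc l) t (b x) y)" for y
        by (rule continuous_on_subset[OF df_cont sub]) (use n in auto)
      show "wint n x (df (Suc l) r (b x)) \<le> ennreal (C * W (Suc (n + l)) x)"
        if "r \<in> {s..t}" for r
        using bound[of n "Suc l" r x] nl x sub that by auto
    qed (use st sub n weight_nonneg[OF n(1) x] weight_measurable[OF n(1)] in \<open>auto intro!: df_measurable\<close>)
    finally show ?thesis
      using C_nonneg W st by (subst (asm) ennreal_le_iff) (auto simp: mult_ac)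
  qed
  show ?thesis
    using le[of u v] le[of v u] u v by (cases "u \<le> v") (auto simp: abs_minus_commute)
qed

text \<open>A first-order Taylor estimate: the remainder of the density is controlled by the
  oscillation of its next derivative near u in the weighted integral, which is small by
  \<open>df_limit_weighted\<close>.\<close>

lemma T_deriv:
  assumes nl: "n + l < k" and u: "u \<in> {0..1}" and x: "x \<in> space S"
  shows "vanishes (wbdd N (U n) 1) u (\<lambda>v g. (T l v g x - T l u g x) / (v - u) - T (Suc l) u g x)"
proof (rule uniform_limitI)
  fix r :: real assume r: "0 < r"
  have n: "n \<le> k" "l < k" "Suc l \<le> k" "n + Suc l \<le> k" using nl by auto
  let ?w = "\<lambda>y. a n x + V n y"
  let ?\<psi> = "\<lambda>t. \<integral>\<^sup>+y. ennreal (\<bar>df (Suc l) t (b x) y - df (Suc l) u (b x) y\<bar> * ?w y) \<partial>\<gamma> (b x)"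
  have "\<forall>\<^sub>F t in at u within {0..1}. ?\<psi> t < ennreal (r / 2)"
    using order_tendstoD(2)[OF df_limit_weighted[OF n(4) u x], of "ennreal (r / 2)"] r by simp
  then obtain d where d: "0 < d" "\<And>t. t \<in> {0..1} \<Longrightarrow> t \<noteq> u \<Longrightarrow> dist t u < d \<Longrightarrow> ?\<psi> t < ennreal (r / 2)"
    unfolding eventually_at by blast
  have \<psi>: "?\<psi> t \<le> ennreal (r / 2)" if "t \<in> {0..1}" "dist t u < d" for t
    using d(2)[OF that(1) _ that(2)] by (cases "t = u") (auto intro: less_imp_le)
  have "dist ((T l v g x - T l u g x) / (v - u) - T (Suc l) u g x) 0 < r"
    if v: "v \<in> {0..1}" "v \<noteq> u" "dist v u < d" and g: "g \<in> wbdd N (U n) 1" for v g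
  proof -
    \<comment> \<open>Subtracting the linear part makes the increment of F the Taylor remainder up
      to sign, while its derivative is \<open>df (Suc l) t - df (Suc l) u\<close>.\<close>
    define F where "F t y = df l t (b x) y - t * df (Suc l) u (b x) y" for t y
    define D where "D y = df l v (b x) y - df l u (b x) y - (v - u) * df (Suc l) u (b x) y" for y
    define s t where "s = min u v" and "t = max u v"
    have st: "{s..t} \<subseteq> {0..1}" "t - s = \<bar>v - u\<bar>" "s \<le> t" "\<And>p. p \<in> {s..t} \<Longrightarrow> dist p u < d"
      using u v by (auto simp: s_def t_def dist_real_def)
    have F_D: "\<bar>F t y - F s y\<bar> = \<bar>D y\<bar>" for y
      unfolding F_def D_def s_def t_def by (cases "u \<le> v") (auto simp: algebra_simps abs_minus_commute)
    have "T l v g x - T l u g x - (v - u) * T (Suc l) u g x = (\<integral>y. g (e x y) * D y \<partial>\<gamma> (b x))"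
      unfolding T_def D_def
      using T_integrable[OF less_imp_le[OF nl] u x g] T_integrable[OF less_imp_le[OF nl] v(1) x g]
        T_integrable[OF n(4) u x g]
      by (simp add: right_diff_distrib mult.left_commute[of _ "v - u"])
    then have "ennreal \<bar>T l v g x - T l u g x - (v - u) * T (Suc l) u g x\<bar>
        \<le> (\<integral>\<^sup>+y. ennreal (\<bar>D y\<bar> * ?w y) \<partial>\<gamma> (b x))"
      using ennreal_abs_integral_le[of "\<gamma> (b x)" "\<lambda>y. g (e x y)" ?w D] test_le[OF n(1) x _ g] by simp
    also have "\<dots> \<le> ennreal (r / 2 * (t - s))"
      unfolding F_D[symmetric]
    proof (rule nn_integral_increment_le[where F=F and F'="\<lambda>t y. df (Suc l) t (b x) y - df (Suc l) u (b x) y"])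
      show "((\<lambda>t. F t y) has_real_derivative df (Suc l) p (b x) y - df (Suc l) u (b x) y) (at p within {s..t})"
        if "p \<in> {s..t}" for p y
        unfolding F_def
        by (rule has_field_derivative_subset[OF _ st(1)])
           (use that st(1) in \<open>auto intro!: derivative_eq_intros df_deriv[OF n(2)]\<close>)
      show "continuous_on {s..t} (\<lambda>t. df (Suc l) t (b x) y - df (Suc l) u (b x) y)" for y
        by (intro continuous_intros continuous_on_subset[OF df_cont[OF n(3)] st(1)])
      show "F p \<in> borel_measurable (\<gamma> (b x))" if "p \<in> {s..t}" for p
        unfolding F_def[abs_def] using df_measurable[of l p "b x"] df_measurable[of "Suc l" u "b x"] n u that st(1) by auto
      show "(\<lambda>y. df (Suc l) p (b x) y - df (Suc l) u (b x) y) \<in> borel_measurable (\<gamma> (b x))" if "p \<in> {s..t}" for p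
        using df_measurable[of "Suc l" p "b x"] df_measurable[of "Suc l" u "b x"] n u that st(1) by auto
      show "?\<psi> p \<le> ennreal (r / 2)" if "p \<in> {s..t}" for p
        using \<psi>[of p] st that by blast
    qed (use st r weight_nonneg[OF n(1) x] weight_measurable[OF n(1)] in auto)
    finally have "\<bar>T l v g x - T l u g x - (v - u) * T (Suc l) u g x\<bar> \<le> r / 2 * \<bar>v - u\<bar>"
      using r st(2) by (simp add: ennreal_le_iff)
    moreover have "(T l v g x - T l u g x) / (v - u) - T (Suc l) u g x
        = (T l v g x - T l u g x - (v - u) * T (Suc l) u g x) / (v - u)"
      using v(2) by (simp add: diff_divide_distrib)
    ultimately have "\<bar>(T l v g x - T l u g x) / (v - u) - T (Suc l) u g x\<bar> \<le> r / 2"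
      using v(2) by (simp add: abs_divide divide_le_eq)
    then show ?thesis
      using r by simp
  qed
  then show "\<forall>\<^sub>F v in at u within {0..1}. \<forall>g\<in>wbdd N (U n) 1.
      dist ((T l v g x - T l u g x) / (v - u) - T (Suc l) u g x) 0 < r"
    unfolding eventually_at using d(1) by blast
qed

text \<open>For l = 0 the integral is taken against \<open>Q u\<close>, a probability kernel;
  \<gamma> need not be finite, so the argument through \<open>subprob_algebra\<close> does not apply
  to it. Higher l follow by difference quotients.\<close>

lemma T_measurable:
  assumes "n + l \<le> k" "u \<in> {0..1}" "g \<in> wbdd N (U n) 1"
  shows "T l u g \<in> borel_measurable S"
  using assms
proof (induction l arbitrary: u)
  case 0
  have "(\<lambda>x. Q u (b x)) \<in> S \<rightarrow>\<^sub>M subprob_algebra borel"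
    by (rule measurable_compose[OF b measurable_prob_algebraD[OF Q_markov[OF 0(2)]]])
  then have "(\<lambda>x. \<integral>y. g (e x y) \<partial>Q u (b x)) \<in> borel_measurable S"
    using measurable_compose[OF e wbdd_measurable[OF 0(3)]]
    by (intro integral_measurable_subprob_algebra2[where N=borel]) (simp_all add: case_prod_beta')
  then show ?case
    by (rule measurable_cong[THEN iffD1, rotated])
       (simp add: T_def integral_Q[OF 0(2) test_measurable[OF wbdd_measurable[OF 0(3)]]])
next
  case (Suc l)
  obtain s where s: "\<And>i::nat. s i \<in> {0..1}" "\<And>i. s i \<noteq> u" "filterlim s (at u within {0..1}) sequentially"
    using approach_sequence[OF Suc.prems(2)] by blast
  show ?case
  proof (rule borel_measurable_LIMSEQ_real)
    fix x assume x: "x \<in> space S"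
    have "n + l < k" using Suc.prems(1) by simp
    from tendsto_uniform_limitI[OF T_deriv[OF this Suc.prems(2) x] Suc.prems(3)]
    have "((\<lambda>v. (T l v g x - T l u g x) / (v - u)) \<longlongrightarrow> T (Suc l) u g x) (at u within {0..1})"
      by (rule LIM_zero_cancel)
    then show "(\<lambda>i. (T l (s i) g x - T l u g x) / (s i - u)) \<longlonglongrightarrow> T (Suc l) u g x"
      by (rule filterlim_compose[OF _ s(3)])
  next
    fix i
    show "(\<lambda>x. (T l (s i) g x - T l u g x) / (s i - u)) \<in> borel_measurable S"
      using Suc.IH[of u] Suc.IH[of "s i"] Suc.prems s by auto
  qed
qed

lemma T_wbdd:
  assumes nl: "n + l \<le> k" and u: "u \<in> {0..1}" and c: "0 \<le> c" and g: "g \<in> wbdd N (U n) c"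
  shows "T l u g \<in> wbdd S (W (n + l)) (C * c)"
proof (rule wbddI)
  have n: "n \<le> k" using nl by simp
  have U: "0 \<le> U n z" if "z \<in> space N" for z
    using U_ge_1[OF n that] by simp
  \<comment> \<open>Dividing by \<open>c + 1\<close> rather than by \<open>c\<close> covers c =
    0.\<close>
  have "(\<lambda>z. (1 / (c + 1)) * g z) \<in> wbdd N (U n) (\<bar>1 / (c + 1)\<bar> * c)"
    by (rule wbdd_scale[OF g])
  then have g': "(\<lambda>z. (1 / (c + 1)) * g z) \<in> wbdd N (U n) 1"
    by (rule wbdd_mono) (use c U in auto)
  have "(\<lambda>x. (c + 1) * T l u (\<lambda>z. (1 / (c + 1)) * g z) x) \<in> borel_measurable S"
    using T_measurable[OF nl u g'] by measurable
  moreover have "(c + 1) * T l u (\<lambda>z. (1 / (c + 1)) * g z) x = T l u g x" for x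
    unfolding T_def mult.assoc integral_mult_right_zero using c by simp
  ultimately show "T l u g \<in> borel_measurable S"
    by simp
  fix x assume x: "x \<in> space S"
  have "\<bar>T l u h x\<bar> \<le> C * W (n + l) x" if "h \<in> wbdd N (U n) 1" for h
  proof -
    have "ennreal \<bar>T l u h x\<bar> \<le> wint n x (df l u (b x))"
      unfolding T_def by (rule ennreal_abs_integral_le) (use test_le[OF n x _ that] in auto)
    also have "\<dots> \<le> ennreal (C * W (n + l) x)"
      by (rule bound[OF nl u x])
    finally show ?thesis
      using C_nonneg W_ge_1[OF nl x] by (simp add: ennreal_le_iff)
  qed
  from wfunctional_bound_scale[OF T_wfunctional[OF nl u x] U this c g]
  show "\<bar>T l u g x\<bar> \<le> C * c * W (n + l) x"
    by (simp add: mult_ac)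
qed

sublocale operator_family k S N W U T C
  by unfold_locales (fact C_nonneg W_ge_1 U_ge_1 W_Suc T_wbdd T_wfunctional T_cont T_deriv T_lipschitz)+

lemma lift_measurable:
  assumes u: "u \<in> {0..1}"
  shows "lift u \<in> S \<rightarrow>\<^sub>M prob_algebra N"
  unfolding lift_def[abs_def]
  by (rule measurable_distr_prob_space2[where M=borel]) (use measurable_compose[OF b Q_markov[OF u]] e in auto)

text \<open>Both sides are first compared on indicators only. As the right-hand side is a positive
  functional of g, \<open>positive_wfunctional_integral\<close> then yields the formula for all
  dominated g and the integrability of the weight at once.\<close>

lemma integral_bind_lift:
  assumes u: "u \<in> {0..1}" and n: "n \<le> k" and \<mu>: "\<mu> \<in> space (prob_algebra S)" and int: "integrable \<mu> (W n)"
  shows "\<And>g c. g \<in> wbdd N (U n) c \<Longrightarrow> (\<integral>z. g z \<partial>(\<mu> \<bind> lift u)) = (\<integral>x. T 0 u g x \<partial>\<mu>)"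
    and "integrable (\<mu> \<bind> lift u) (U n)"
proof -
  interpret \<mu>: prob_space \<mu>
    using \<mu> by (simp add: space_prob_algebra)
  have sets_\<mu>: "sets \<mu> = sets S"
    using \<mu> by (simp add: space_prob_algebra)
  have space_\<mu>: "space \<mu> = space S"
    by (rule sets_eq_imp_space_eq[OF sets_\<mu>])
  have meas: "lift u \<in> \<mu> \<rightarrow>\<^sub>M subprob_algebra N"
    using measurable_prob_algebraD[OF lift_measurable[OF u]] by (simp cong: measurable_cong_sets[OF sets_\<mu>])
  have sets_bind: "sets (\<mu> \<bind> lift u) = sets N"
    using meas \<mu>.not_empty by (intro sets_bind) (auto dest: sets_kernel)
  have L: "wfunctional S (W n) (\<lambda>h. \<integral>x. h x \<partial>\<mu>)"
    by (rule wfunctional_integral[OF sets_\<mu> int]) (use W_nonneg[OF n] in auto)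
  have bd: "T 0 u g \<in> wbdd S (W n) (C * c)" if "0 \<le> c" "g \<in> wbdd N (U n) c" for g c
    using T_wbdd[of n 0 u c g] n u that by simp
  have LT: "wfunctional N (U n) (\<lambda>g. \<integral>x. T 0 u g x \<partial>\<mu>)"
    by (rule wfunctional_compose[OF L _ _ bd]) (use W_nonneg U_nonneg T_wfunctional[of n 0 u] n u in auto)
  have ind: "emeasure (lift u x) A = ennreal (T 0 u (indicator A) x)" "0 \<le> T 0 u (indicator A) x"
    if A: "A \<in> sets N" and x: "x \<in> space S" for A x
  proof -
    interpret Q: prob_space "Q u (b x)"
      using Q_prob[OF u] by (simp add: space_prob_algebra)
    have space_Q: "space (Q u (b x)) = UNIV"
      using Q_prob[OF u] sets_eq_imp_space_eq[of "Q u (b x)" borel] by (simp add: space_prob_algebra)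
    note ex = e_measurable_Q[OF u x]
    have "T 0 u (indicator A) x = (\<integral>y. indicator A (e x y) \<partial>Q u (b x))"
      using integral_Q[OF u test_measurable[OF borel_measurable_indicator[OF A] x], of "b x"] by (simp add: T_def)
    also have "\<dots> = (\<integral>y. indicator (e x -` A \<inter> space (Q u (b x))) y \<partial>Q u (b x))"
      by (intro Bochner_Integration.integral_cong) (auto simp: indicator_def space_Q)
    also have "\<dots> = measure (Q u (b x)) (e x -` A \<inter> space (Q u (b x)))"
      using measurable_sets[OF ex A] by simp
    finally have T: "T 0 u (indicator A) x = measure (Q u (b x)) (e x -` A \<inter> space (Q u (b x)))" .
    show "emeasure (lift u x) A = ennreal (T 0 u (indicator A) x)" "0 \<le> T 0 u (indicator A) x"
      unfolding lift_def T by (simp_all add: emeasure_distr[OF ex A] Q.emeasure_eq_measure)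
  qed
  have ind_wbdd: "indicator A \<in> wbdd N (U n) 1" if "A \<in> sets N" for A
    by (rule wbdd_indicator[OF that U_ge_1[OF n]])
  have pos: "0 \<le> (\<integral>x. T 0 u (indicator A) x \<partial>\<mu>)" if "A \<in> sets N" for A
    using ind(2)[OF that] space_\<mu> by (intro Bochner_Integration.integral_nonneg) auto
  have em: "emeasure (\<mu> \<bind> lift u) A = ennreal (\<integral>x. T 0 u (indicator A) x \<partial>\<mu>)" if A: "A \<in> sets N" for A
  proof -
    have TA: "T 0 u (indicator A) \<in> wbdd S (W n) (C * 1)"
      by (rule bd[OF zero_le_one ind_wbdd[OF A]])
    have int_TA: "integrable \<mu> (T 0 u (indicator A))"
    proof (rule Bochner_Integration.integrable_bound[OF integrable_mult_right[OF int, of "C * 1"]])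
      show "T 0 u (indicator A) \<in> borel_measurable \<mu>"
        using wbdd_measurable[OF TA] by (simp cong: measurable_cong_sets[OF sets_\<mu>])
      show "AE x in \<mu>. norm (T 0 u (indicator A) x) \<le> norm (C * 1 * W n x)"
        using wbddD[OF TA] space_\<mu> by (intro AE_I2) (auto intro: order_trans[OF _ abs_ge_self])
    qed
    have "emeasure (\<mu> \<bind> lift u) A = (\<integral>\<^sup>+x. ennreal (T 0 u (indicator A) x) \<partial>\<mu>)"
      using ind(1)[OF A] by (subst emeasure_bind[OF \<mu>.not_empty meas A]) (auto intro!: nn_integral_cong simp: space_\<mu>)
    also have "\<dots> = ennreal (\<integral>x. T 0 u (indicator A) x \<partial>\<mu>)"
      by (rule nn_integral_eq_integral[OF int_TA]) (use ind(2)[OF A] space_\<mu> in \<open>auto intro!: AE_I2\<close>)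
    finally show ?thesis .
  qed
  note integral = positive_wfunctional_integral[OF LT U_ge_1[OF n] sets_bind em pos]
  show "(\<integral>z. g z \<partial>(\<mu> \<bind> lift u)) = (\<integral>x. T 0 u g x \<partial>\<mu>)" if "g \<in> wbdd N (U n) c" for g c
    by (rule integral(2)) (use that in auto)
  show "integrable (\<mu> \<bind> lift u) (U n)"
    by (rule integral(1)[where c=1]) (use U_measurable[OF n] U_nonneg[OF n] in \<open>auto intro!: wbddI\<close>)
qed

lemma bind_lift_prob:
  assumes "u \<in> {0..1}" "\<mu> \<in> space (prob_algebra S)"
  shows "\<mu> \<bind> lift u \<in> space (prob_algebra N)"
  using measurable_space[OF measurable_bind_prob_space[OF measurable_const lift_measurable[OF assms(1)]], of \<mu> "()" "count_space UNIV"] assms(2)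
  by simp

end

subsection \<open>The path law\<close>

text \<open>The weights correspond exactly under e, so composition with e maps balls into balls of
  the same radius and no level is lost.\<close>

lemma smooth_pushforward:
  assumes e: "e \<in> M \<rightarrow>\<^sub>M N" and U: "\<And>i z. i \<le> n \<Longrightarrow> z \<in> space N \<Longrightarrow> 0 \<le> U i z"
    and UW: "\<And>i x. i \<le> n \<Longrightarrow> x \<in> space M \<Longrightarrow> 0 \<le> W i x \<and> U i (e x) = W i x"
    and F: "smooth M W m n F"
  shows "smooth N U m n (\<lambda>u g. F u (\<lambda>x. g (e x)))"
  using F UW U
proof (induction m arbitrary: n F)
  have bd: "(\<lambda>x. g (e x)) \<in> wbdd M (W i) c"
    if "\<And>x. x \<in> space M \<Longrightarrow> 0 \<le> W i x \<and> U i (e x) = W i x" "g \<in> wbdd N (U i) c" for g i c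
    using that(1) wbddD[OF that(2)] measurable_space[OF e] measurable_compose[OF e wbdd_measurable[OF that(2)]]
    by (force intro!: wbddI)
  have vanish: "vanishes (wbdd N (U i) 1) u (\<lambda>v g. G v (\<lambda>x. g (e x)))"
    if "\<And>x. x \<in> space M \<Longrightarrow> 0 \<le> W i x \<and> U i (e x) = W i x" "vanishes (wbdd M (W i) 1) u G" for G i u
    using that(2) bd[OF that(1)] by (auto simp: uniform_limit_iff elim!: eventually_mono)
  have cont: "wcont N (U i) (\<lambda>u g. F u (\<lambda>x. g (e x)))"
    if UW: "\<And>x. x \<in> space M \<Longrightarrow> 0 \<le> W i x \<and> U i (e x) = W i x" and U: "\<And>z. z \<in> space N \<Longrightarrow> 0 \<le> U i z"
      and F: "wcont M (W i) F" for i F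
    unfolding wcont_def
  proof (intro ballI conjI)
    fix u :: real assume u: "u \<in> {0..1}"
    note L = wcontD(1)[OF F u]
    show "wfunctional N (U i) (\<lambda>g. F u (\<lambda>x. g (e x)))"
      by (rule wfunctional_compose[OF L, where C=1])
         (use UW U bd[OF UW] measurable_space[OF e] in \<open>auto simp: wfunctional_def\<close>)
    show "vanishes (wbdd N (U i) 1) u (\<lambda>v g. F v (\<lambda>x. g (e x)) - F u (\<lambda>x. g (e x)))"
      by (rule vanish[OF UW wcontD(2)[OF F u]])
  qed
  {
    case (0 n F)
    then show ?case
      using cont[of n F] by simp
  next
    case (Suc m n F)
    from Suc.prems(1) obtain i F' where i: "n = Suc i" and F: "wcont M (W n) F" "wderiv M (W i) F F'"
        "smooth M W m i F'"
      by auto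
    have "wderiv N (U i) (\<lambda>u g. F u (\<lambda>x. g (e x))) (\<lambda>u g. F' u (\<lambda>x. g (e x)))"
      unfolding wderiv_def
    proof
      fix u :: real assume u: "u \<in> {0..1}"
      show "vanishes (wbdd N (U i) 1) u (\<lambda>v g. (F v (\<lambda>x. g (e x)) - F u (\<lambda>x. g (e x))) / (v - u) - F' u (\<lambda>x. g (e x)))"
        by (rule vanish[OF _ wderivD[OF F(2) u]]) (use Suc.prems(2) i in auto)
    qed
    moreover have "smooth N U m i (\<lambda>u g. F' u (\<lambda>x. g (e x)))"
      using Suc.IH[OF F(3)] Suc.prems(2,3) i by auto
    moreover have "wcont N (U n) (\<lambda>u g. F u (\<lambda>x. g (e x)))"
      using cont[of n F] Suc.prems(2,3) F(1) by auto
    ultimately show ?case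
      using i by auto
  }
qed

lemma tuple_weight_Suc: "tuple_weight (Suc j) V \<omega> = tuple_weight j V \<omega> + V (\<omega> j)"
  by (simp add: tuple_weight_def)

lemma tuple_weight_upd: "tuple_weight (Suc j) V (fun_upd \<omega> j y) = tuple_weight j V \<omega> + V y"
  by (simp add: tuple_weight_def)

lemma tuple_weight_mono:
  "(\<And>x. V x \<le> W x) \<Longrightarrow> tuple_weight j V \<omega> \<le> tuple_weight j W \<omega>"
  unfolding tuple_weight_def by (intro sum_mono)

lemma tuple_weight_nonneg: "(\<And>x. 0 \<le> V x) \<Longrightarrow> 0 \<le> tuple_weight j V \<omega>"
  unfolding tuple_weight_def by (intro sum_nonneg)

lemma tuple_weight_ge_1: "(\<And>x. 1 \<le> V x) \<Longrightarrow> 1 \<le> tuple_weight (Suc j) V \<omega>"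
proof -
  assume V: "\<And>x. 1 \<le> V x"
  then have "\<And>x. 0 \<le> V x"
    using order_trans[OF zero_le_one] by blast
  from tuple_weight_nonneg[of V, OF this] V[of "\<omega> j"] show ?thesis
    unfolding tuple_weight_Suc by (simp add: add_increasing)
qed

lemma tuple_weight_measurable:
  "V \<in> borel_measurable borel \<Longrightarrow> tuple_weight j V \<in> borel_measurable (tuple_space j)"
  unfolding tuple_weight_def[abs_def]
  by (intro borel_measurable_sum measurable_compose[OF measurable_component_singleton]) auto

context smooth_kernels
begin

abbreviation W :: "nat \<Rightarrow> nat \<Rightarrow> (nat \<Rightarrow> 'a) \<Rightarrow> real" where
  "W j n \<equiv> tuple_weight j (V n)"

abbreviation Q_kernels :: "real \<Rightarrow> bool" where
  "Q_kernels \<equiv> lifted_kernels \<gamma> f df Q V k borel borel (\<lambda>x. x) (\<lambda>_ y. y) V V (\<lambda>_ _. 0)"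

abbreviation path_kernels :: "nat \<Rightarrow> real \<Rightarrow> bool" where
  "path_kernels i \<equiv> lifted_kernels \<gamma> f df Q V k (tuple_space (Suc i)) (tuple_space (Suc (Suc i)))
    (\<lambda>\<omega>. \<omega> i) (\<lambda>\<omega> y. fun_upd \<omega> (Suc i) y) (W (Suc i)) (W (Suc (Suc i))) (W (Suc i))"

lemma df_boundE:
  obtains C where "0 < C" "\<And>n l u x. n + l \<le> k \<Longrightarrow> u \<in> {0..1} \<Longrightarrow>
    (\<integral>\<^sup>+y. ennreal (\<bar>df l u x y\<bar> * V n y) \<partial>\<gamma> x) \<le> ennreal (C * V (n + l) x)"
proof -
  obtain C where C: "0 < C" "\<And>s l x. s + l \<le> k \<Longrightarrow>
      (SUP u\<in>{0..1}. \<integral>\<^sup>+y. ennreal (\<bar>df l u x y\<bar> * V s y) \<partial>\<gamma> x) \<le> ennreal (C * V (s + l) x)"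
    using df_bound by blast
  show thesis
    by (rule that[OF C(1)]) (rule order_trans[OF SUP_upper C(2)])
qed

lemma Q_lifted_kernels:
  obtains C where "Q_kernels C"
proof -
  obtain C where C: "0 < C" "\<And>n l u x. n + l \<le> k \<Longrightarrow> u \<in> {0..1} \<Longrightarrow>
    (\<integral>\<^sup>+y. ennreal (\<bar>df l u x y\<bar> * V n y) \<partial>\<gamma> x) \<le> ennreal (C * V (n + l) x)"
    using df_boundE by blast
  have "Q_kernels C"
    by unfold_locales (use C V_measurable V_ge_1 V_mono in auto)
  then show thesis
    by (rule that)
qed

text \<open>The kernel acts on the last coordinate \<open>\<omega> i\<close>, but the weights of the
  earlier coordinates multiply its mass. Each product V n (\<omega> j) M l (\<omega> i) is
  controlled by (B4); the new coordinate is controlled by (B3).\<close>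

lemma path_lifted_kernels:
  assumes K: "0 \<le> K" "\<And>s l u x\<^sub>1 x\<^sub>2. s + l \<le> k \<Longrightarrow> u \<in> {0..1} \<Longrightarrow>
    ennreal (V s x\<^sub>1) * (\<integral>\<^sup>+y. ennreal \<bar>df l u x\<^sub>2 y\<bar> \<partial>\<gamma> x\<^sub>2) \<le> ennreal (K * (V (s + l) x\<^sub>1 + V (s + l) x\<^sub>2))"
  obtains C where "path_kernels i C"
proof -
  obtain C where C: "0 < C" "\<And>n l u x. n + l \<le> k \<Longrightarrow> u \<in> {0..1} \<Longrightarrow>
    (\<integral>\<^sup>+y. ennreal (\<bar>df l u x y\<bar> * V n y) \<partial>\<gamma> x) \<le> ennreal (C * V (n + l) x)"
    using df_boundE by blast
  \<comment> \<open>\<open>K\<close> for the weights of the old coordinates,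
    \<open>K * real (Suc i)\<close> for the term at \<open>\<omega> i\<close> that (B4) produces
    once per coordinate, \<open>C\<close> for the new coordinate.\<close>
  define B where "B = K + K * real (Suc i) + C"
  have bound: "(\<integral>\<^sup>+y. ennreal (\<bar>df l u (\<omega> i) y\<bar> * (W (Suc i) n \<omega> + V n y)) \<partial>\<gamma> (\<omega> i))
      \<le> ennreal (B * W (Suc i) (n + l) \<omega>)" if nl: "n + l \<le> k" and u: "u \<in> {0..1}" for n l u \<omega>
  proof -
    have n: "n \<le> k" "l \<le> k" using nl by auto
    note [measurable] = df_measurable[OF n(2) u] V_measurable_\<gamma>[OF n(1)]
    have le: "V (n + l) (\<omega> i) \<le> W (Suc i) (n + l) \<omega>"
      using tuple_weight_nonneg[of "V (n + l)" i \<omega>, OF V_nonneg[OF nl]] by (simp add: tuple_weight_Suc)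
    have "(\<integral>\<^sup>+y. ennreal (\<bar>df l u (\<omega> i) y\<bar> * (W (Suc i) n \<omega> + V n y)) \<partial>\<gamma> (\<omega> i))
        = (\<integral>\<^sup>+y. (\<Sum>j<Suc i. ennreal (V n (\<omega> j)) * ennreal \<bar>df l u (\<omega> i) y\<bar>)
            + ennreal (\<bar>df l u (\<omega> i) y\<bar> * V n y) \<partial>\<gamma> (\<omega> i))"
    proof (rule nn_integral_cong)
      fix y
      have "(\<Sum>j<Suc i. ennreal (V n (\<omega> j)) * ennreal \<bar>df l u (\<omega> i) y\<bar>) = (\<Sum>j<Suc i. ennreal (V n (\<omega> j) * \<bar>df l u (\<omega> i) y\<bar>))"
        using V_nonneg[OF n(1)] by (intro sum.cong refl) (simp add: ennreal_mult)
      also have "\<dots> = ennreal (\<Sum>j<Suc i. V n (\<omega> j) * \<bar>df l u (\<omega> i) y\<bar>)"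
        using V_nonneg[OF n(1)] by (intro sum_ennreal) simp
      also have "(\<Sum>j<Suc i. V n (\<omega> j) * \<bar>df l u (\<omega> i) y\<bar>) = \<bar>df l u (\<omega> i) y\<bar> * W (Suc i) n \<omega>"
        unfolding tuple_weight_def sum_distrib_left by (simp only: mult.commute)
      finally show "ennreal (\<bar>df l u (\<omega> i) y\<bar> * (W (Suc i) n \<omega> + V n y))
          = (\<Sum>j<Suc i. ennreal (V n (\<omega> j)) * ennreal \<bar>df l u (\<omega> i) y\<bar>) + ennreal (\<bar>df l u (\<omega> i) y\<bar> * V n y)"
        using V_nonneg[OF n(1)] tuple_weight_nonneg[of "V n" "Suc i" \<omega>, OF V_nonneg[OF n(1)]]
        by (simp only: distrib_left) (rule ennreal_plus; simp)
    qed
    also have "\<dots> = (\<Sum>j<Suc i. ennreal (V n (\<omega> j)) * (\<integral>\<^sup>+y. ennreal \<bar>df l u (\<omega> i) y\<bar> \<partial>\<gamma> (\<omega> i)))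
        + (\<integral>\<^sup>+y. ennreal (\<bar>df l u (\<omega> i) y\<bar> * V n y) \<partial>\<gamma> (\<omega> i))"
      by (subst nn_integral_add, measurable) (subst nn_integral_sum, measurable, subst nn_integral_cmult, auto)
    also have "\<dots> \<le> (\<Sum>j<Suc i. ennreal (K * (V (n + l) (\<omega> j) + V (n + l) (\<omega> i)))) + ennreal (C * V (n + l) (\<omega> i))"
      by (intro add_mono sum_mono K C nl u)
    also have "(\<Sum>j<Suc i. ennreal (K * (V (n + l) (\<omega> j) + V (n + l) (\<omega> i))))
        = ennreal (\<Sum>j<Suc i. K * (V (n + l) (\<omega> j) + V (n + l) (\<omega> i)))"
      using K(1) V_nonneg[OF nl] by (intro sum_ennreal) simp
    also have "(\<Sum>j<Suc i. K * (V (n + l) (\<omega> j) + V (n + l) (\<omega> i)))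
        = K * W (Suc i) (n + l) \<omega> + K * real (Suc i) * V (n + l) (\<omega> i)"
      unfolding tuple_weight_def sum_distrib_left[symmetric] sum.distrib distrib_left
      by (simp add: distrib_left)
    also have "ennreal \<dots> + ennreal (C * V (n + l) (\<omega> i))
        = ennreal (K * W (Suc i) (n + l) \<omega> + K * real (Suc i) * V (n + l) (\<omega> i) + C * V (n + l) (\<omega> i))"
      using K(1) C(1) V_nonneg[OF nl] tuple_weight_nonneg[of "V (n + l)" "Suc i" \<omega>, OF V_nonneg[OF nl]]
      by (intro ennreal_plus[symmetric]) auto
    also have "\<dots> \<le> ennreal (B * W (Suc i) (n + l) \<omega>)"
      unfolding B_def distrib_right using K(1) C(1) le by (intro ennreal_leI add_mono order_refl mult_left_mono) auto
    finally show ?thesis .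
  qed
  have "path_kernels i B"
  proof unfold_locales
    show "(\<lambda>\<omega>. \<omega> i) \<in> tuple_space (Suc i) \<rightarrow>\<^sub>M borel"
      by (rule measurable_component_singleton) simp
    show "(\<lambda>(\<omega>, y). fun_upd \<omega> (Suc i) y) \<in> tuple_space (Suc i) \<Otimes>\<^sub>M borel \<rightarrow>\<^sub>M tuple_space (Suc (Suc i))"
      using measurable_add_dim[of "Suc i" "{..<Suc i}" "\<lambda>_. borel"] by (simp only: lessThan_Suc)
    show "0 \<le> B"
      using K(1) C(1) by (simp add: B_def)
  qed (use bound in \<open>simp_all only: tuple_weight_upd order_refl, auto intro!: tuple_weight_nonneg V_nonneg tuple_weight_ge_1 V_ge_1
      tuple_weight_mono V_mono tuple_weight_measurable V_measurable\<close>)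
  then show thesis
    by (rule that)
qed

lemma kernel_power_Q:
  assumes base: "Q_kernels C"
    and u: "u \<in> {0..1}" and n: "n \<le> k"
  defines "T \<equiv> lifted_kernels.T \<gamma> df (\<lambda>x. x) (\<lambda>_ y. y)"
  shows "kernel_power (Q u) m x \<in> space (prob_algebra borel) \<and> integrable (kernel_power (Q u) m x) (V n) \<and>
    (\<forall>g c. g \<in> wbdd borel (V n) c \<longrightarrow> (\<integral>y. g y \<partial>kernel_power (Q u) m x) = (T 0 u ^^ m) g x)"
proof (induction m)
  case 0
  have "integrable (return borel x) (V n)"
  proof (rule integrableI_bounded)
    have "(\<integral>\<^sup>+y. ennreal (norm (V n y)) \<partial>return borel x) = ennreal (norm (V n x))"
      using V_measurable[OF n] by (intro nn_integral_return) auto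
    then show "(\<integral>\<^sup>+y. ennreal (norm (V n y)) \<partial>return borel x) < \<infinity>"
      by simp
  qed (use V_measurable[OF n] in simp)
  then show ?case
    using measurable_space[OF measurable_return_prob_space, of x borel]
    by (auto intro!: integral_return dest: wbdd_measurable)
next
  case (Suc m)
  interpret base: lifted_kernels \<gamma> f df Q V k borel borel "\<lambda>x. x" "\<lambda>_ y. y" V V "\<lambda>_ _. 0" C
    by (rule base)
  have lift: "base.lift u = Q u"
    using Q_prob[OF u] by (auto simp: base.lift_def fun_eq_iff space_prob_algebra intro!: distr_id2)
  note IH = conjunct1[OF Suc] conjunct1[OF conjunct2[OF Suc]] conjunct2[OF conjunct2[OF Suc]]
  note bind = base.integral_bind_lift[OF u n IH(1,2), unfolded lift] base.bind_lift_prob[OF u IH(1), unfolded lift]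
  have "(\<integral>y. g y \<partial>kernel_power (Q u) (Suc m) x) = (T 0 u ^^ Suc m) g x" if g: "g \<in> wbdd borel (V n) c" for g c
  proof -
    have "g \<in> wbdd borel (V n) \<bar>c\<bar>"
      by (rule wbdd_mono[OF g]) (use V_nonneg[OF n] in auto)
    then have "T 0 u g \<in> wbdd borel (V n) (C * \<bar>c\<bar>)"
      unfolding T_def using base.T_wbdd[of n 0 u "\<bar>c\<bar>" g] u n by simp
    then have "(\<integral>y. T 0 u g y \<partial>kernel_power (Q u) m x) = (T 0 u ^^ m) (T 0 u g) x"
      using IH(3) by blast
    \<comment> \<open>\<open>kernel_power\<close> adds the new kernel at the end of the chain, that
      is, innermost on test functions, whereas \<open>^^\<close> adds it outermost; the iterates
      commute.\<close>
    then show ?thesis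
      using bind(1)[OF g] by (simp add: T_def funpow_swap1)
  qed
  then show ?case
    using bind by auto
qed

abbreviation gap :: "(real \<Rightarrow> 'a measure) \<Rightarrow> nat \<Rightarrow> nat \<Rightarrow> ennreal" where
  "gap \<pi> l n \<equiv> SUP u\<in>{0..1}. SUP x. weighted_norm borel (V l)
     (\<lambda>A. measure (kernel_power (Q u) n x) A - measure (\<pi> u) A) / ennreal (V l x)"

lemma Q_ergodic_family:
  assumes base: "Q_kernels C"
    and invariant: "\<And>u. u \<in> {0..1} \<Longrightarrow> invariant_prob (Q u) (\<pi> u)"
    and integrable: "\<And>u. u \<in> {0..1} \<Longrightarrow> integrable (\<pi> u) (V k)"
    and ergodic: "\<And>l. l \<le> k \<Longrightarrow> \<exists>\<kappa>\<in>{0<..<1}. \<exists>K::real. \<forall>\<^sub>F n in sequentially.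
      gap \<pi> l n \<le> ennreal (K * \<kappa> ^ n)"
  shows "ergodic_family k borel V (lifted_kernels.T \<gamma> df (\<lambda>x. x) (\<lambda>_ y. y)) C (\<lambda>u g. \<integral>x. g x \<partial>\<pi> u)"
proof -
  interpret base: lifted_kernels \<gamma> f df Q V k borel borel "\<lambda>x. x" "\<lambda>_ y. y" V V "\<lambda>_ _. 0" C
    by (rule base)
  have lift: "base.lift u = Q u" if u: "u \<in> {0..1}" for u
    using Q_prob[OF u] by (auto simp: base.lift_def fun_eq_iff space_prob_algebra intro!: distr_id2)
  have \<pi>: "\<pi> u \<in> space (prob_algebra borel)" "\<pi> u \<bind> Q u = \<pi> u" "sets (\<pi> u) = sets borel" "prob_space (\<pi> u)"
    if "u \<in> {0..1}" for u
    using invariant[OF that] by (auto simp: invariant_prob_def space_prob_algebra)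
  have int: "integrable (\<pi> u) (V n)" if "u \<in> {0..1}" "n \<le> k" for u n
  proof (rule Bochner_Integration.integrable_bound[OF integrable[OF that(1)]])
    show "V n \<in> borel_measurable (\<pi> u)"
      using V_measurable[OF that(2)] by (simp cong: measurable_cong_sets[OF \<pi>(3)[OF that(1)]])
    show "AE x in \<pi> u. norm (V n x) \<le> norm (V k x)"
      using V_le[OF that(2) order_refl] V_nonneg[OF that(2)] V_nonneg[OF order_refl] by (intro AE_I2) simp
  qed
  have \<pi>_fun: "wfunctional borel (V n) (\<lambda>g. \<integral>x. g x \<partial>\<pi> u)" if "u \<in> {0..1}" "n \<le> k" for u n
    by (rule wfunctional_integral[OF \<pi>(3) int]) (use that V_nonneg in auto)
  show ?thesis
  proof unfold_locales
    show "wfunctional borel (V n) (\<lambda>g. \<integral>x. g x \<partial>\<pi> u)" if "n \<le> k" "u \<in> {0..1}" for n u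
      by (rule \<pi>_fun[OF that(2,1)])
    show "(\<integral>x. 1 \<partial>\<pi> u) = (1::real)" if "u \<in> {0..1}" for u
      using prob_space.prob_space[OF \<pi>(4)[OF that]] by simp
    show "base.T 0 u (\<lambda>_. 1) x = 1" if "u \<in> {0..1}" for u x
    proof -
      have "prob_space (Q u x)"
        using Q_prob[OF that] by (simp add: space_prob_algebra)
      then have "(\<integral>y. 1 \<partial>Q u x) = (1::real)"
        by (simp add: prob_space.prob_space)
      then show ?thesis
        using integral_Q[OF that, of "\<lambda>_. 1" x] by (simp add: base.T_def)
    qed
    show "(\<integral>x. base.T 0 u g x \<partial>\<pi> u) = (\<integral>x. g x \<partial>\<pi> u)"
      if "n \<le> k" "u \<in> {0..1}" "g \<in> wbdd borel (V n) c" for n u g c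
      using base.integral_bind_lift(1)[OF that(2,1) \<pi>(1)[OF that(2)] int[OF that(2,1)] that(3)]
      unfolding lift[OF that(2)] \<pi>(2)[OF that(2)] by (rule sym)
    fix n assume n: "n \<le> k"
    obtain \<kappa> K where \<kappa>: "0 < \<kappa>" "\<kappa> < 1" and K: "\<forall>\<^sub>F m in sequentially.
      gap \<pi> n m \<le> ennreal (K * \<kappa> ^ m)"
      using ergodic[OF n] by auto
    have "\<forall>\<^sub>F m in sequentially. \<forall>u\<in>{0..1}. \<forall>g\<in>wbdd borel (V n) 1.
      \<forall>x\<in>space borel. \<bar>(base.T 0 u ^^ m) g x - (\<integral>x. g x \<partial>\<pi> u)\<bar> \<le> \<bar>K\<bar> * \<kappa> ^ m * V n x"
      using K
    proof (rule eventually_mono, intro ballI)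
      fix m and u :: real and g and x :: 'a
      assume le: "gap \<pi> n m \<le> ennreal (K * \<kappa> ^ m)"
        and u: "u \<in> {0..1}" and g: "g \<in> wbdd borel (V n) 1"
      let ?P = "kernel_power (Q u) m x"
      let ?\<mu> = "\<lambda>A. measure ?P A - measure (\<pi> u) A"
      define L where "L g = (\<integral>y. g y \<partial>?P) - (\<integral>y. g y \<partial>\<pi> u)" for g :: "'a \<Rightarrow> real"
      note P = kernel_power_Q[OF base u n, of m x]
      have sets_P: "sets ?P = sets borel"
        using P by (simp add: space_prob_algebra)
      have "wfunctional borel (V n) (\<lambda>g. \<integral>y. g y \<partial>?P)"
        by (rule wfunctional_integral[OF sets_P]) (use P V_nonneg n in auto)
      then have L: "wfunctional borel (V n) L"
        unfolding L_def[abs_def] by (rule wfunctional_difference) (rule \<pi>_fun[OF u n])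
      \<comment> \<open>The set function in (B1) agrees with the functional \<open>L\<close> on
        indicators of measurable sets, which is all that the weighted norm sees.\<close>
      have norm_eq: "weighted_norm borel (V n) ?\<mu> = weighted_norm borel (V n) (\<lambda>A. L (indicator A))"
        by (rule weighted_norm_cong) (simp add: L_def sets_P \<pi>(3)[OF u])
      have "weighted_norm borel (V n) ?\<mu> / ennreal (V n x) \<le> ennreal (K * \<kappa> ^ m)"
        using order_trans[OF order_trans[OF SUP_upper[OF UNIV_I] SUP_upper[OF u]] le] .
      \<comment> \<open>For negative K the bound has been clipped to 0 by \<open>ennreal\<close>;
        \<open>\<bar>K\<bar>\<close> makes it a nonnegative real bound.\<close>
      also have "\<dots> \<le> ennreal (\<bar>K\<bar> * \<kappa> ^ m)"
        using \<kappa> by (intro ennreal_leI mult_right_mono) auto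
      finally have "weighted_norm borel (V n) ?\<mu> / ennreal (V n x) * ennreal (V n x)
          \<le> ennreal (\<bar>K\<bar> * \<kappa> ^ m) * ennreal (V n x)"
        by (rule mult_right_mono) simp
      moreover have "weighted_norm borel (V n) ?\<mu> / ennreal (V n x) * ennreal (V n x) = weighted_norm borel (V n) ?\<mu>"
        using V_ge_1[OF n, of x] by (simp add: ennreal_divide_times ennreal_divide_self)
      moreover have "ennreal (\<bar>K\<bar> * \<kappa> ^ m) * ennreal (V n x) = ennreal (\<bar>K\<bar> * \<kappa> ^ m * V n x)"
        using \<kappa> V_nonneg[OF n, of x] by (simp add: ennreal_mult)
      ultimately have "weighted_norm borel (V n) ?\<mu> \<le> ennreal (\<bar>K\<bar> * \<kappa> ^ m * V n x)"
        by simp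
      then have "\<bar>L g\<bar> \<le> \<bar>K\<bar> * \<kappa> ^ m * V n x"
        unfolding norm_eq using \<kappa> V_ge_1[OF n] V_nonneg[OF n]
        by (intro abs_le_of_weighted_norm[OF L _ _ _ g]) auto
      then show "\<bar>(base.T 0 u ^^ m) g x - (\<integral>x. g x \<partial>\<pi> u)\<bar> \<le> \<bar>K\<bar> * \<kappa> ^ m * V n x"
        using P g by (simp add: L_def)
    qed
    then show "\<exists>\<kappa>\<in>{0<..<1}. \<exists>K. \<forall>\<^sub>F m in sequentially. \<forall>u\<in>{0..1}. \<forall>g\<in>wbdd borel (V n) 1.
      \<forall>x\<in>space borel. \<bar>(base.T 0 u ^^ m) g x - (\<integral>x. g x \<partial>\<pi> u)\<bar> \<le> K * \<kappa> ^ m * V n x"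
      using \<kappa> by (intro bexI[of _ \<kappa>] exI[of _ "\<bar>K\<bar>"]) auto
  qed
qed

text \<open>The recursion starts at the point mass on the empty tuple, so the first bind is
  evaluation at that tuple.\<close>

lemma path_law_1:
  assumes "\<mu> \<in> space (prob_algebra borel)"
  shows "path_law \<mu> K (Suc 0) = distr \<mu> (tuple_space (Suc 0)) (\<lambda>y. fun_upd (\<lambda>_. undefined) 0 y)"
    and "(\<lambda>y. fun_upd (\<lambda>_. undefined) 0 y) \<in> borel \<rightarrow>\<^sub>M tuple_space (Suc 0)"
proof -
  have e: "(\<lambda>(\<omega>, y). fun_upd \<omega> 0 y) \<in> tuple_space 0 \<Otimes>\<^sub>M borel \<rightarrow>\<^sub>M tuple_space (Suc 0)"
    using measurable_add_dim[of 0 "{..<0}" "\<lambda>_. borel"] by (simp only: lessThan_Suc)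
  have pt: "(\<lambda>_. undefined) \<in> space (tuple_space 0)"
    by (simp add: space_PiM)
  have "(\<lambda>\<omega>. distr \<mu> (tuple_space (Suc 0)) (\<lambda>y. fun_upd \<omega> 0 y)) \<in> tuple_space 0 \<rightarrow>\<^sub>M prob_algebra (tuple_space (Suc 0))"
    by (rule measurable_distr_prob_space2[OF measurable_const[OF assms] e])
  from bind_return[OF measurable_prob_algebraD[OF this] pt]
  show "path_law \<mu> K (Suc 0) = distr \<mu> (tuple_space (Suc 0)) (\<lambda>y. fun_upd (\<lambda>_. undefined) 0 y)"
    by simp
  show "(\<lambda>y. fun_upd (\<lambda>_. undefined) 0 y) \<in> borel \<rightarrow>\<^sub>M tuple_space (Suc 0)"
    using measurable_compose[OF measurable_Pair1'[OF pt] e] by simp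
qed

abbreviation law :: "(real \<Rightarrow> 'a measure) \<Rightarrow> real \<Rightarrow> nat \<Rightarrow> (nat \<Rightarrow> 'a) measure" where
  "law \<pi> u \<equiv> path_law (\<pi> u) (Q u)"

text \<open>The induction invariant of \<open>path_law_smooth\<close>. Agreement with the path law
  is claimed for the largest weight, whose test functions include those of the lower levels;
  integrability of that weight is what \<open>integral_bind_lift\<close> needs to add the next
  coordinate.\<close>

definition path_derivatives :: "(real \<Rightarrow> 'a measure) \<Rightarrow> nat \<Rightarrow> (real \<Rightarrow> ((nat \<Rightarrow> 'a) \<Rightarrow> real) \<Rightarrow> real) \<Rightarrow> bool" where
  "path_derivatives \<pi> j G \<longleftrightarrow> smooth (tuple_space j) (W j) k k G \<and>
    (\<forall>u\<in>{0..1}. law \<pi> u j \<in> space (prob_algebra (tuple_space j)) \<and>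
      integrable (law \<pi> u j) (W j k) \<and>
      (\<forall>g c. g \<in> wbdd (tuple_space j) (W j k) c \<longrightarrow>
        G u g = (\<integral>\<omega>. g \<omega> \<partial>law \<pi> u j)))"

lemma path_law_smooth:
  assumes K: "0 \<le> K" "\<And>s l u x\<^sub>1 x\<^sub>2. s + l \<le> k \<Longrightarrow> u \<in> {0..1} \<Longrightarrow>
    ennreal (V s x\<^sub>1) * (\<integral>\<^sup>+y. ennreal \<bar>df l u x\<^sub>2 y\<bar> \<partial>\<gamma> x\<^sub>2) \<le> ennreal (K * (V (s + l) x\<^sub>1 + V (s + l) x\<^sub>2))"
    and \<pi>: "\<And>u. u \<in> {0..1} \<Longrightarrow> \<pi> u \<in> space (prob_algebra borel)"
      "\<And>u. u \<in> {0..1} \<Longrightarrow> integrable (\<pi> u) (V k)"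
    and F: "smooth borel V k k F" "\<And>u g c. u \<in> {0..1} \<Longrightarrow> g \<in> wbdd borel (V k) c \<Longrightarrow> F u g = (\<integral>x. g x \<partial>\<pi> u)"
  shows "\<exists>G. path_derivatives \<pi> (Suc i) G"
proof (induction i)
  case 0
  let ?e = "\<lambda>y::'a. fun_upd (\<lambda>_::nat. undefined) 0 y"
  note e = path_law_1(2)[OF \<pi>(1)[of 0], simplified]
  have weight: "W (Suc 0) n (?e y) = V n y" for n y
    by (simp add: tuple_weight_def)
  have smooth: "smooth (tuple_space (Suc 0)) (W (Suc 0)) k k (\<lambda>u g. F u (\<lambda>x. g (?e x)))"
    by (rule smooth_pushforward[OF e _ _ F(1)]) (auto simp: weight V_nonneg intro!: tuple_weight_nonneg)
  have "path_derivatives \<pi> (Suc 0) (\<lambda>u g. F u (\<lambda>x. g (?e x)))"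
    unfolding path_derivatives_def
  proof (intro conjI ballI allI impI smooth)
    fix u :: real assume u: "u \<in> {0..1}"
    have sets_\<pi>: "sets (\<pi> u) = sets borel"
      using \<pi>(1)[OF u] by (simp add: space_prob_algebra)
    have e\<pi>: "?e \<in> \<pi> u \<rightarrow>\<^sub>M tuple_space (Suc 0)"
      using e by (simp cong: measurable_cong_sets[OF sets_\<pi>])
    note path = path_law_1(1)[OF \<pi>(1)[OF u], of "Q u"]
    show "law \<pi> u (Suc 0) \<in> space (prob_algebra (tuple_space (Suc 0)))"
      unfolding path using \<pi>(1)[OF u] prob_space.prob_space_distr[OF _ e\<pi>] by (simp add: space_prob_algebra)
    show "integrable (law \<pi> u (Suc 0)) (W (Suc 0) k)"
      unfolding path using \<pi>(2)[OF u]
      by (subst integrable_distr_eq[OF e\<pi> tuple_weight_measurable[OF V_measurable[OF order_refl]]]) (simp add: weight)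
    fix g c assume g: "g \<in> wbdd (tuple_space (Suc 0)) (W (Suc 0) k) c"
    have "(\<lambda>x. g (?e x)) \<in> wbdd borel (V k) c"
      using wbddD[OF g] measurable_space[OF e] measurable_compose[OF e wbdd_measurable[OF g]]
      by (intro wbddI) (auto simp: weight[symmetric] simp del: fun_upd_apply)
    then show "F u (\<lambda>x. g (?e x)) = (\<integral>\<omega>. g \<omega> \<partial>law \<pi> u (Suc 0))"
      unfolding path integral_distr[OF e\<pi> wbdd_measurable[OF g]] by (rule F(2)[OF u])
  qed
  then show ?case by blast
next
  case (Suc i)
  then obtain G where G: "smooth (tuple_space (Suc i)) (W (Suc i)) k k G"
    and path: "\<And>u. u \<in> {0..1} \<Longrightarrow> law \<pi> u (Suc i) \<in> space (prob_algebra (tuple_space (Suc i)))"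
      "\<And>u. u \<in> {0..1} \<Longrightarrow> integrable (law \<pi> u (Suc i)) (W (Suc i) k)"
      "\<And>u g c. u \<in> {0..1} \<Longrightarrow> g \<in> wbdd (tuple_space (Suc i)) (W (Suc i) k) c \<Longrightarrow>
        G u g = (\<integral>\<omega>. g \<omega> \<partial>law \<pi> u (Suc i))"
    unfolding path_derivatives_def by blast
  obtain C where "path_kernels i C"
    using path_lifted_kernels[OF K] by blast
  then interpret step: lifted_kernels \<gamma> f df Q V k "tuple_space (Suc i)" "tuple_space (Suc (Suc i))"
    "\<lambda>\<omega>. \<omega> i" "\<lambda>\<omega> y. fun_upd \<omega> (Suc i) y" "W (Suc i)" "W (Suc (Suc i))"
    "W (Suc i)" C .
  \<comment> \<open>Composition with the operator of order l = 0 keeps both the order of smoothness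
    and the level at k, so it can be repeated for every coordinate.\<close>
  have smooth: "smooth (tuple_space (Suc (Suc i))) (W (Suc (Suc i))) k k (\<lambda>u g. G u (step.T 0 u g))"
    using step.smooth_compose[of k 0 k G] G by simp
  have path_Suc: "law \<pi> u (Suc (Suc i)) = law \<pi> u (Suc i) \<bind> step.lift u" for u
    unfolding path_law.simps(2)[of _ _ "Suc i"] step.lift_def[abs_def] by simp
  have "path_derivatives \<pi> (Suc (Suc i)) (\<lambda>u g. G u (step.T 0 u g))"
    unfolding path_derivatives_def
  proof (intro conjI ballI allI impI smooth)
    fix u :: real assume u: "u \<in> {0..1}"
    note bind = step.integral_bind_lift[OF u order_refl path(1,2)[OF u]]
    show "law \<pi> u (Suc (Suc i)) \<in> space (prob_algebra (tuple_space (Suc (Suc i))))"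
      unfolding path_Suc by (rule step.bind_lift_prob[OF u path(1)[OF u]])
    show "integrable (law \<pi> u (Suc (Suc i))) (W (Suc (Suc i)) k)"
      unfolding path_Suc by (rule bind(2))
    fix g c assume g: "g \<in> wbdd (tuple_space (Suc (Suc i))) (W (Suc (Suc i)) k) c"
    have g': "g \<in> wbdd (tuple_space (Suc (Suc i))) (W (Suc (Suc i)) k) \<bar>c\<bar>"
      by (rule wbdd_mono[OF g abs_ge_self]) (rule tuple_weight_nonneg, rule V_nonneg, rule order_refl)
    have "step.T 0 u g \<in> wbdd (tuple_space (Suc i)) (W (Suc i) k) (C * \<bar>c\<bar>)"
      using step.T_wbdd[of k 0 u "\<bar>c\<bar>" g] u g' by simp
    from path(3)[OF u this] show "G u (step.T 0 u g) = (\<integral>\<omega>. g \<omega> \<partial>law \<pi> u (Suc (Suc i)))"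
      unfolding path_Suc bind(1)[OF g] .
  qed
  then show ?case by blast
qed

end

theorem corollary2:
  fixes \<gamma> :: "'a::topological_space \<Rightarrow> 'a measure"
    and f :: "real \<Rightarrow> 'a \<Rightarrow> 'a \<Rightarrow> real"
    and df :: "nat \<Rightarrow> real \<Rightarrow> 'a \<Rightarrow> 'a \<Rightarrow> real"
    and Q :: "real \<Rightarrow> 'a \<Rightarrow> 'a measure"
    and \<pi> :: "real \<Rightarrow> 'a measure"
    and V :: "nat \<Rightarrow> 'a \<Rightarrow> real"
    and M :: "nat \<Rightarrow> 'a \<Rightarrow> ennreal"
    and k j :: nat
  assumes kernel: "measure_kernel borel borel \<gamma>"
    and f_measurable: "(\<lambda>(u, x, y). f u x y) \<in>
      borel_measurable (restrict_space borel {0..1} \<Otimes>\<^sub>M (borel \<Otimes>\<^sub>M borel))"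
    and f_nonneg: "\<And>u x y. u \<in> {0..1} \<Longrightarrow> 0 \<le> f u x y"
    and Q_def: "\<And>u x. u \<in> {0..1} \<Longrightarrow> Q u x = density (\<gamma> x) (\<lambda>y. ennreal (f u x y))"
    and Q_markov: "\<And>u. u \<in> {0..1} \<Longrightarrow> Q u \<in> borel \<rightarrow>\<^sub>M prob_algebra borel"
    and k: "k \<ge> 1"
    and V_measurable: "\<And>l. l \<le> k \<Longrightarrow> V l \<in> borel_measurable borel"
    and V_ge_1: "\<And>l x. l \<le> k \<Longrightarrow> 1 \<le> V l x"
    and V_mono: "\<And>l x. l < k \<Longrightarrow> V l x \<le> V (Suc l) x"
    and B1_invariant: "\<And>u. u \<in> {0..1} \<Longrightarrow> invariant_prob (Q u) (\<pi> u)"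
    and B1_unique: "\<And>u \<nu>. u \<in> {0..1} \<Longrightarrow> invariant_prob (Q u) \<nu> \<Longrightarrow> \<nu> = \<pi> u"
    and B1_integrable: "\<And>u. u \<in> {0..1} \<Longrightarrow> (\<integral>\<^sup>+x. ennreal (V k x) \<partial>\<pi> u) < \<infinity>"
    and B1_ergodic: "\<And>l. l \<le> k \<Longrightarrow> \<exists>\<kappa>\<in>{0<..<1}. \<exists>K::real. \<forall>\<^sub>F n in sequentially.
      (SUP u\<in>{0..1}. SUP x. weighted_norm borel (V l)
         (\<lambda>A. measure (kernel_power (Q u) n x) A - measure (\<pi> u) A) / ennreal (V l x))
      \<le> ennreal (K * \<kappa> ^ n)"
    and B2_zero: "df 0 = f"
    and B2: "\<And>x y. Ck_derivs k (\<lambda>l u. df l u x y)"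
    and B3_bound: "\<exists>C>0. \<forall>s l x. s + l \<le> k \<longrightarrow>
      (SUP u\<in>{0..1}. \<integral>\<^sup>+y. ennreal (\<bar>df l u x y\<bar> * V s y) \<partial>\<gamma> x) \<le> ennreal (C * V (s + l) x)"
    and B3_limit: "\<And>u x s. u \<in> {0..1} \<Longrightarrow> s \<le> k \<Longrightarrow>
      ((\<lambda>h. \<integral>\<^sup>+y. ennreal (\<bar>df (k - s) (u + h) x y - df (k - s) u x y\<bar> * V s y) \<partial>\<gamma> x)
         \<longlongrightarrow> 0) (at 0 within {h. u + h \<in> {0..1}})"
    and M_def: "\<And>l x. l \<le> k \<Longrightarrow> M l x = (SUP u\<in>{0..1}. \<integral>\<^sup>+y. ennreal \<bar>df l u x y\<bar> \<partial>\<gamma> x)"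
    and B4: "\<exists>C>0. \<forall>s l x\<^sub>1 x\<^sub>2. s + l \<le> k \<longrightarrow>
      ennreal (V s x\<^sub>1) * M l x\<^sub>2 \<le> ennreal (C * (V (s + l) x\<^sub>1 + V (s + l) x\<^sub>2))"
    and j: "j \<ge> 1"
  shows "Ck_into_weighted_measures k (tuple_space j) (tuple_weight j (V 0))
    (\<lambda>u. measure (path_law (\<pi> u) (Q u) j))"
proof -
  interpret smooth_kernels \<gamma> f df Q V k
    by unfold_locales (fact kernel f_measurable f_nonneg Q_def Q_markov V_measurable V_ge_1 V_mono B2_zero B2 B3_bound B3_limit)+
  have \<pi>: "\<pi> u \<in> space (prob_algebra borel)" if "u \<in> {0..1}" for u
    using B1_invariant[OF that] by (simp add: invariant_prob_def)
  have int: "integrable (\<pi> u) (V k)" if u: "u \<in> {0..1}" for u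
  proof (rule integrableI_bounded)
    have "sets (\<pi> u) = sets borel"
      using \<pi>[OF u] by (simp add: space_prob_algebra)
    then show "V k \<in> borel_measurable (\<pi> u)"
      using V_measurable[OF order_refl] by (simp cong: measurable_cong_sets)
    show "(\<integral>\<^sup>+x. ennreal (norm (V k x)) \<partial>\<pi> u) < \<infinity>"
      using B1_integrable[OF u] V_nonneg[OF order_refl] by simp
  qed
  obtain K where K: "0 < K" "\<And>s l x\<^sub>1 x\<^sub>2. s + l \<le> k \<Longrightarrow>
      ennreal (V s x\<^sub>1) * M l x\<^sub>2 \<le> ennreal (K * (V (s + l) x\<^sub>1 + V (s + l) x\<^sub>2))"
    using B4 by blast
  have M_le: "ennreal (V s x\<^sub>1) * (\<integral>\<^sup>+y. ennreal \<bar>df l u x\<^sub>2 y\<bar> \<partial>\<gamma> x\<^sub>2) \<le> ennreal (K * (V (s + l) x\<^sub>1 + V (s + l) x\<^sub>2))"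
    if "s + l \<le> k" "u \<in> {0..1}" for s l u x\<^sub>1 x\<^sub>2
  proof -
    have "(\<integral>\<^sup>+y. ennreal \<bar>df l u x\<^sub>2 y\<bar> \<partial>\<gamma> x\<^sub>2) \<le> M l x\<^sub>2"
      using that by (subst M_def) (auto intro!: SUP_upper)
    from mult_left_mono[OF this] K(2)[OF that(1)] show ?thesis
      by (rule order_trans) simp
  qed
  obtain C where base: "Q_kernels C"
    using Q_lifted_kernels by blast
  interpret ergodic_family k borel V "lifted_kernels.T \<gamma> df (\<lambda>x. x) (\<lambda>_ y. y)" C "\<lambda>u g. \<integral>x. g x \<partial>\<pi> u"
    by (rule Q_ergodic_family[OF base B1_invariant int B1_ergodic])
  obtain F where F: "smooth borel V k k F" "\<And>u g c. u \<in> {0..1} \<Longrightarrow> g \<in> wbdd borel (V k) c \<Longrightarrow> F u g = (\<integral>x. g x \<partial>\<pi> u)"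
    using invariant_smooth by blast
  obtain i where i: "j = Suc i"
    using j by (cases j) auto
  let ?W = "\<lambda>n. tuple_weight j (V n)"
  have "\<exists>G. path_derivatives \<pi> j G"
    unfolding i by (rule path_law_smooth[where F=F, OF less_imp_le[OF K(1)] M_le \<pi> int F])
  then obtain G where "path_derivatives \<pi> j G" ..
  note G = this[unfolded path_derivatives_def]
  have W_ge_1: "1 \<le> ?W n \<omega>" if "n \<le> k" for n \<omega>
    unfolding i by (rule tuple_weight_ge_1[OF V_ge_1[OF that]])
  show ?thesis
  proof (rule smooth_Ck_into_weighted_measures[OF conjunct1[OF G]])
    show "?W 0 \<omega> \<le> ?W n \<omega>" if "n \<le> k" for n \<omega>
      by (rule tuple_weight_mono[OF V_le[OF le0 that]])
    show "1 \<le> ?W 0 \<omega>" for \<omega>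
      by (rule W_ge_1) simp
    show "measure (path_law (\<pi> u) (Q u) j) A = G u (indicator A)"
      if u: "u \<in> {0..1}" and A: "A \<in> sets (tuple_space j)" for u A
    proof -
      \<comment> \<open>Indicators are dominated since the weight is at least 1, so the functional
        and the law agree on them.\<close>
      have "indicator A \<in> wbdd (tuple_space j) (?W k) 1"
        by (rule wbdd_indicator[OF A W_ge_1[OF order_refl]])
      with bspec[OF conjunct2[OF G] u] have "G u (indicator A) = (\<integral>\<omega>. indicator A \<omega> \<partial>law \<pi> u j)"
        "sets (law \<pi> u j) = sets (tuple_space j)"
        by (auto simp: space_prob_algebra)
      with A show ?thesis
        by simp
    qed
  qed
qed

end
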